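(* Let $N\ge3$ and assume (V), (K) with $a_0,a\in\mathbb{R}$, $b_0>\min\{a_0,-\frac{N-a_0}{2},-\frac{N+2}{2}\}$ and $b<\max\{a,-2\}$. Then $-\Delta u+V(|x|)u=K(|x|)f(u)$ in $\mathbb{R}^N$ has a nonnegative nontrivial radial solution for every continuous $f:\mathbb{R}\to\mathbb{R}$ with $f(0)=0$ satisfying: (f7) $\sup_{t>0}\frac{|f(t)|}{\min\{t^{q_1-1},t^{q_2-1}\}}<+\infty$ for some $q_1,q_2<2$ with $q_1\in\mathcal{I}_1(a_0,b_0)$ and $q_2\in\mathcal{I}_2(a,b)$; (f8) there exists $\theta<2$ such that $\liminf_{t\to0^+}F(t)/t^\theta>0$.
   Context: $F(t)=\int_0^tf(s)ds$. (V): $V:(0,\infty)\to[0,\infty)$ continuous with $\liminf_{r\to0^+}V(r)/r^{a_0}>0$, $\liminf_{r\to\infty}V(r)/r^a>0$. (K): $K:(0,\infty)\to(0,\infty)$ continuous with $\limsup_{r\to0^+}K(r)/r^{b_0}<\infty$, $\limsup_{r\to\infty}K(r)/r^b<\infty$. $H^1_{V,r}$: radial $u\in D^{1,2}(\mathbb{R}^N)$ with $\int V(|x|)u^2<\infty$, norm $\|u\|^2=\int|\nabla u|^2+\int V(|x|)u^2$. Radial solution: $u\in H^1_{V,r}$ with $\int\nabla u\cdot\nabla h+\int V(|x|)uh=\int K(|x|)f(u)h$ for all $h\in H^1_{V,r}$. $q_*(a_0,b_0):=\max\{1,2\frac{N+b_0}{N+a_0},2\frac{2N-2+2b_0-a_0}{2N-2+a_0}\}$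 if $a_0<-(2N-2)$; $\max\{1,2\frac{N+b_0}{N+a_0}\}$ if $-(2N-2)\le a_0<-N$; $1$ if $a_0\ge -N$. $q^*(a_0,b_0):=+\infty$ if $a_0\le-(2N-2)$; $2\frac{2N-2+2b_0-a_0}{2N-2+a_0}$ if $-(2N-2)<a_0\le -N$; $\min\{2\frac{N+b_0}{N+a_0},2\frac{2N-2+2b_0-a_0}{2N-2+a_0}\}$ if $-N<a_0<-2$; $2\frac{N+b_0}{N-2}$ if $a_0\ge-2$. $\mathcal{I}_1(a_0,b_0):=(q_*,q^* )$. $q_{**}(a,b):=\max\{1,2\frac{N+b}{N-2}\}$ if $a\le-2$; $\max\{1,2\frac{N+b}{N+a},2\frac{2N-2+2b-a}{2N-2+a}\}$ if $a>-2$. $\mathcal{I}_2(a,b):=(q_{**},+\infty)$. *)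

theory Defs
  imports "HOL-Analysis.Analysis" "HOL-Library.Liminf_Limsup"
begin

definition test_fun :: "(real^'n \<Rightarrow> real) \<Rightarrow> bool" where
  "test_fun \<phi> \<longleftrightarrow> (\<forall>x. \<phi> differentiable (at x))
     \<and> (\<forall>i. continuous_on UNIV (\<lambda>x. frechet_derivative \<phi> (at x) (axis i 1)))
     \<and> (\<exists>C. compact C \<and> (\<forall>x. x \<notin> C \<longrightarrow> \<phi> x = 0))"

definition weak_grad :: "(real^'n \<Rightarrow> real) \<Rightarrow> (real^'n \<Rightarrow> real^'n) \<Rightarrow> bool" where
  "weak_grad u g \<longleftrightarrow> g \<in> borel_measurable lebesgue \<and>
     (\<forall>i \<phi>. test_fun \<phi> \<longrightarrow>
        integrable lebesgue (\<lambda>x. u x * frechet_derivative \<phi> (at x) (axis i 1))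
      \<and> integrable lebesgue (\<lambda>x. g x $ i * \<phi> x)
      \<and> (\<integral>x. u x * frechet_derivative \<phi> (at x) (axis i 1) \<partial>lebesgue)
          = - (\<integral>x. g x $ i * \<phi> x \<partial>lebesgue))"

definition D12 :: "(real^'n \<Rightarrow> real) \<Rightarrow> bool" where
  "D12 u \<longleftrightarrow> u \<in> borel_measurable lebesgue
     \<and> integrable lebesgue (\<lambda>x. \<bar>u x\<bar> powr (2 * real CARD('n) / (real CARD('n) - 2)))
     \<and> (\<exists>g. weak_grad u g \<and> integrable lebesgue (\<lambda>x. (norm (g x))\<^sup>2))"

definition radial :: "(real^'n \<Rightarrow> real) \<Rightarrow> bool" where
  "radial u \<longleftrightarrow> (\<exists>v. AE x in lebesgue. u x = v (norm x))"

definition H1Vr :: "(real \<Rightarrow> real) \<Rightarrow> (real^'n \<Rightarrow> real) \<Rightarrow> bool" where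
  "H1Vr V u \<longleftrightarrow> D12 u \<and> radial u \<and> integrable lebesgue (\<lambda>x. V (norm x) * (u x)\<^sup>2)"

definition radial_solution ::
  "(real \<Rightarrow> real) \<Rightarrow> (real \<Rightarrow> real) \<Rightarrow> (real \<Rightarrow> real) \<Rightarrow> (real^'n \<Rightarrow> real) \<Rightarrow> bool" where
  "radial_solution V K f u \<longleftrightarrow> H1Vr V u \<and>
     (\<forall>g h gh. weak_grad u g \<longrightarrow> H1Vr V h \<longrightarrow> weak_grad h gh \<longrightarrow>
        integrable lebesgue (\<lambda>x. g x \<bullet> gh x)
      \<and> integrable lebesgue (\<lambda>x. V (norm x) * u x * h x)
      \<and> integrable lebesgue (\<lambda>x. K (norm x) * f (u x) * h x)
      \<and> (\<integral>x. g x \<bullet> gh x \<partial>lebesgue) + (\<integral>x. V (norm x) * u x * h x \<partial>lebesgue)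
          = (\<integral>x. K (norm x) * f (u x) * h x \<partial>lebesgue))"

definition Fprim :: "(real \<Rightarrow> real) \<Rightarrow> real \<Rightarrow> real" where
  "Fprim f t = integral {0..t} f"

definition q_low1 :: "real \<Rightarrow> real \<Rightarrow> real \<Rightarrow> real" where
  "q_low1 N a0 b0 =
    (if a0 < -(2*N-2) then Max {1, 2*(N+b0)/(N+a0), 2*(2*N-2+2*b0-a0)/(2*N-2+a0)}
     else if a0 < -N then max 1 (2*(N+b0)/(N+a0))
     else 1)"

definition q_up1 :: "real \<Rightarrow> real \<Rightarrow> real \<Rightarrow> ereal" where
  "q_up1 N a0 b0 =
    (if a0 \<le> -(2*N-2) then \<infinity>
     else if a0 \<le> -N then ereal (2*(2*N-2+2*b0-a0)/(2*N-2+a0))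
     else if a0 < -2 then ereal (min (2*(N+b0)/(N+a0)) (2*(2*N-2+2*b0-a0)/(2*N-2+a0)))
     else ereal (2*(N+b0)/(N-2)))"

definition I1 :: "real \<Rightarrow> real \<Rightarrow> real \<Rightarrow> real set" where
  "I1 N a0 b0 = {q. q_low1 N a0 b0 < q \<and> ereal q < q_up1 N a0 b0}"

definition q_low2 :: "real \<Rightarrow> real \<Rightarrow> real \<Rightarrow> real" where
  "q_low2 N a b =
    (if a \<le> -2 then max 1 (2*(N+b)/(N-2))
     else Max {1, 2*(N+b)/(N+a), 2*(2*N-2+2*b-a)/(2*N-2+a)})"

definition I2 :: "real \<Rightarrow> real \<Rightarrow> real \<Rightarrow> real set" where
  "I2 N a b = {q. q_low2 N a b < q}"

end

theory Submission
  imports Defs "HOL-Complex_Analysis.Great_Picard"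
begin

text \<open>
  Both exponents are below 2, so Hoelder's inequality alone controls the nonlinear term. Put
  \<open>W = V + 1 / |x|\<^sup>2\<close>. By Hardy's inequality \<open>\<integral> W u\<^sup>2\<close> is bounded by the squared norm of \<open>u\<close>, and
  \<open>K |u| powr q \<le> \<epsilon> W u\<^sup>2 + C w\<close>, where \<open>w = K powr (2/(2-q)) * W powr (-q/(2-q))\<close> is integrable near 0 for
  \<open>q = q1\<close> and near infinity for \<open>q = q2\<close> because of the conditions defining the intervals
  \<open>I1\<close> and \<open>I2\<close>. Hence the energy, half the squared norm minus \<open>\<integral> K F(u)\<close>, is coercive, and
  \<open>\<integral> K F(u)\<close> is continuous along norm-bounded sequences that converge almost everywhere.

  A radial function in \<open>D12\<close> is almost everywhere equal to a continuous profile \<open>v(|x|)\<close>, recovered from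
  the gradient through the flux of the divergence-free field \<open>x / |x| ^ n\<close>. The profiles of a bounded
  sequence are equicontinuous away from the origin, so a minimizing sequence converges pointwise along a
  subsequence, and the parallelogram identity makes its gradients a Cauchy sequence; no weak compactness is
  needed. Replacing \<open>u\<close> by its positive part does not increase the energy, which gives a nonnegative
  minimizer; its energy is negative by (f8), and its Euler--Lagrange equation is the weak form of the problem.
\<close>

section \<open>Lebesgue integration and square-integrable functions\<close>

lemma borel_measurable_lebesgue_continuous:
  "continuous_on UNIV f \<Longrightarrow> f \<in> borel_measurable lebesgue"
  by (intro measurable_completion) (simp add: borel_measurable_continuous_onI)

lemma integrable_completionI:
  fixes f :: "'a \<Rightarrow> 'b::{banach, second_countable_topology}"
  assumes "integrable M f"
  shows "integrable (completion M) f"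
  using assms integrable_completion[OF borel_measurable_integrable[OF assms]] by simp

lemma lebesgue_integral_cong_AE:
  fixes f g :: "'a::euclidean_space \<Rightarrow> 'b::euclidean_space"
  assumes "AE x in lebesgue. f x = g x"
  shows "integrable lebesgue f \<longleftrightarrow> integrable lebesgue g"
    and "(\<integral>x. f x \<partial>lebesgue) = (\<integral>x. g x \<partial>lebesgue)"
proof -
  have sym: "AE x in lebesgue. g x = f x" using assms by eventually_elim simp
  have measurable_iff: "f \<in> borel_measurable lebesgue \<longleftrightarrow> g \<in> borel_measurable lebesgue"
    using borel_measurable_AE[OF _ assms] borel_measurable_AE[OF _ sym] by blast
  then show integrable_iff: "integrable lebesgue f \<longleftrightarrow> integrable lebesgue g"
    using integrable_cong_AE[OF _ _ assms] borel_measurable_integrable by blast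
  show "(\<integral>x. f x \<partial>lebesgue) = (\<integral>x. g x \<partial>lebesgue)"
  proof (cases "integrable lebesgue f")
    case True
    then show ?thesis using integrable_iff by (intro integral_cong_AE assms) auto
  next
    case False
    then show ?thesis using integrable_iff by (simp add: not_integrable_integral_eq)
  qed
qed

lemma lebesgue_measurable_borel_representative:
  fixes f :: "'a::euclidean_space \<Rightarrow> 'b::euclidean_space"
  assumes "f \<in> borel_measurable lebesgue"
  obtains h where "h \<in> borel_measurable borel" "AE x in lebesgue. f x = h x"
proof -
  have "\<exists>p. p \<in> borel_measurable lborel \<and> (AE x in lborel. f x \<bullet> i = p x)" for i
    using completion_ex_borel_measurable_real[of "\<lambda>x. f x \<bullet> i" lborel] assms by auto
  then obtain p where p: "\<And>i. p i \<in> borel_measurable lborel" "\<And>i. AE x in lborel. f x \<bullet> i = p i x"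
    by metis
  define h where "h x = (\<Sum>i\<in>Basis. p i x *\<^sub>R i)" for x
  show ?thesis
  proof
    show "h \<in> borel_measurable borel" unfolding h_def using p(1) by auto
    have "AE x in lborel. \<forall>i\<in>Basis. f x \<bullet> i = p i x"
      by (rule AE_finite_allI) (auto intro: p(2))
    then have "AE x in lborel. f x = h x"
    proof eventually_elim
      case (elim x)
      have "f x = (\<Sum>i\<in>Basis. (f x \<bullet> i) *\<^sub>R i)" by (simp add: euclidean_representation)
      then show ?case using elim by (simp add: h_def)
    qed
    then show "AE x in lebesgue. f x = h x" by (rule AE_completion)
  qed
qed

lemma borel_measurable_lebesgue_indicator_norm:
  "A \<in> sets borel \<Longrightarrow> (\<lambda>x::'a::euclidean_space. indicator A (norm x) :: real) \<in> borel_measurable lebesgue"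
  by (intro measurable_completion) auto

lemma integrable_indicator_norm_mult:
  fixes f :: "'a::euclidean_space \<Rightarrow> real"
  assumes "integrable lebesgue f" "A \<in> sets borel"
  shows "integrable lebesgue (\<lambda>x. indicator A (norm x) * f x)"
proof (rule Bochner_Integration.integrable_bound[OF assms(1)])
  show "(\<lambda>x. indicator A (norm x) * f x) \<in> borel_measurable lebesgue"
    using assms by (intro borel_measurable_times borel_measurable_lebesgue_indicator_norm) auto
qed (auto simp: indicator_def)

lemma Fatou_integrable:
  fixes f :: "nat \<Rightarrow> 'a \<Rightarrow> real"
  assumes f: "\<And>k. integrable M (f k)" "\<And>k. AE x in M. 0 \<le> f k x" "\<And>k. (\<integral>x. f k x \<partial>M) \<le> A"
    and lim: "AE x in M. (\<lambda>k. f k x) \<longlonglongrightarrow> F x" and F: "F \<in> borel_measurable M"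
  shows "integrable M F" "(\<integral>x. F x \<partial>M) \<le> A"
proof -
  have "0 \<le> (\<integral>x. f 0 x \<partial>M)" by (rule integral_nonneg_AE[OF f(2)])
  then have A_nonneg: "A \<ge> 0" using f(3)[of 0] by linarith
  have "AE x in M. \<forall>k. 0 \<le> f k x" using f(2) by (simp add: AE_all_countable)
  then have F_nonneg: "AE x in M. 0 \<le> F x"
    using lim by eventually_elim (auto intro: LIMSEQ_le_const)
  have "(\<integral>\<^sup>+x. ennreal (F x) \<partial>M) = (\<integral>\<^sup>+x. liminf (\<lambda>k. ennreal (f k x)) \<partial>M)"
  proof (rule nn_integral_cong_AE)
    show "AE x in M. ennreal (F x) = liminf (\<lambda>k. ennreal (f k x))"
      using lim by eventually_elim (auto intro!: lim_imp_Liminf[symmetric] tendsto_ennrealI)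
  qed
  also have "\<dots> \<le> liminf (\<lambda>k. \<integral>\<^sup>+x. ennreal (f k x) \<partial>M)"
    using f(1) by (intro nn_integral_liminf) auto
  also have "\<dots> \<le> ennreal A"
  proof -
    have "(\<integral>\<^sup>+x. ennreal (f k x) \<partial>M) \<le> ennreal A" for k
      using f by (subst nn_integral_eq_integral) (auto intro: ennreal_leI)
    then have "limsup (\<lambda>k. \<integral>\<^sup>+x. ennreal (f k x) \<partial>M) \<le> ennreal A" by (intro Limsup_bounded) auto
    then show ?thesis using Liminf_le_Limsup[of sequentially "\<lambda>k. \<integral>\<^sup>+x. ennreal (f k x) \<partial>M"] by auto
  qed
  finally have bound: "(\<integral>\<^sup>+x. ennreal (F x) \<partial>M) \<le> ennreal A" .
  show "integrable M F"
    by (rule integrableI_nonneg[OF F F_nonneg]) (use bound in \<open>auto intro: le_less_trans\<close>)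
  then show "(\<integral>x. F x \<partial>M) \<le> A"
    using bound A_nonneg F_nonneg by (simp add: nn_integral_eq_integral)
qed

lemma Fatou_integrable_LIMSEQ:
  fixes f :: "nat \<Rightarrow> 'a \<Rightarrow> real"
  assumes f: "\<And>k. integrable M (f k)" "\<And>k. AE x in M. 0 \<le> f k x" "(\<lambda>k. \<integral>x. f k x \<partial>M) \<longlonglongrightarrow> A"
    and lim: "AE x in M. (\<lambda>k. f k x) \<longlonglongrightarrow> F x" and F: "F \<in> borel_measurable M"
  shows "integrable M F" "(\<integral>x. F x \<partial>M) \<le> A"
proof -
  have bound: "integrable M F \<and> (\<integral>x. F x \<partial>M) \<le> A + e" if "e > 0" for e
  proof -
    obtain k0 where k0: "\<And>k. k \<ge> k0 \<Longrightarrow> \<bar>(\<integral>x. f k x \<partial>M) - A\<bar> < e"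
      using LIMSEQ_D[OF f(3) \<open>e > 0\<close>] by auto
    have "(\<integral>x. f (k + k0) x \<partial>M) \<le> A + e" for k using k0[of "k + k0"] by simp
    moreover have "AE x in M. (\<lambda>k. f (k + k0) x) \<longlonglongrightarrow> F x"
      using lim by eventually_elim (rule LIMSEQ_ignore_initial_segment)
    ultimately show ?thesis using Fatou_integrable[of M "\<lambda>k. f (k + k0)", OF f(1,2) _ _ F] by blast
  qed
  then show "integrable M F" using zero_less_one by blast
  show "(\<integral>x. F x \<partial>M) \<le> A" by (rule field_le_epsilon) (use bound in blast)
qed

lemma tendsto_integral_excess:
  fixes F :: "nat \<Rightarrow> 'a \<Rightarrow> real"
  assumes F: "\<And>k. integrable M (F k)" and G: "integrable M G"
    and lim: "AE x in M. (\<lambda>k. F k x) \<longlonglongrightarrow> G x"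
    and a: "\<And>k. integrable M (a k)" "\<And>k. AE x in M. 0 \<le> a k x"
    and w: "integrable M w" and dominated: "\<And>k. AE x in M. \<bar>F k x - G x\<bar> \<le> a k x + w x"
  shows "(\<lambda>k. \<integral>x. max 0 (\<bar>F k x - G x\<bar> - a k x) \<partial>M) \<longlonglongrightarrow> 0"
proof -
  let ?excess = "\<lambda>k x. max 0 (\<bar>F k x - G x\<bar> - a k x)"
  have "(\<lambda>k. \<integral>x. ?excess k x \<partial>M) \<longlonglongrightarrow> (\<integral>x. 0 \<partial>M)"
  proof (rule integral_dominated_convergence)
    show "integrable M (\<lambda>x. \<bar>w x\<bar>)" using w by simp
    have "AE x in M. \<forall>k. 0 \<le> a k x" using a(2) by (simp add: AE_all_countable)
    then show "AE x in M. (\<lambda>k. ?excess k x) \<longlonglongrightarrow> 0"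
      using lim
    proof eventually_elim
      case (elim x)
      have "norm (?excess k x) \<le> \<bar>F k x - G x\<bar>" for k using spec[OF elim(1), of k] by simp
      then show ?case
        by (intro Lim_null_comparison[OF always_eventually tendsto_rabs_zero[OF LIM_zero[OF elim(2)]]]) simp
    qed
    show "AE x in M. norm (?excess k x) \<le> \<bar>w x\<bar>" for k using dominated[of k] by eventually_elim auto
    show "?excess k \<in> borel_measurable M" for k using F[of k] G a(1)[of k] by simp
  qed simp
  then show ?thesis by simp
qed

text \<open>A variant of dominated convergence in which part of the dominating function is merely bounded
  in \<open>L\<^sup>1\<close>, but with a factor that can be made arbitrarily small.\<close>

lemma tendsto_integral_absorbed:
  fixes F :: "nat \<Rightarrow> 'a \<Rightarrow> real"
  assumes F: "\<And>k. integrable M (F k)" and G: "integrable M G"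
    and lim: "AE x in M. (\<lambda>k. F k x) \<longlonglongrightarrow> G x"
    and a: "\<And>k. integrable M (a k)" "\<And>k. AE x in M. 0 \<le> a k x" "\<And>k. (\<integral>x. a k x \<partial>M) \<le> A"
    and w: "integrable M w"
    and absorb: "\<And>e. e > 0 \<Longrightarrow> \<exists>C. \<forall>k. AE x in M. \<bar>F k x - G x\<bar> \<le> e * a k x + C * w x"
  shows "(\<lambda>k. \<integral>x. F k x \<partial>M) \<longlonglongrightarrow> (\<integral>x. G x \<partial>M)"
proof (rule LIMSEQ_I)
  fix r :: real assume r_pos: "r > 0"
  have A_nonneg: "A \<ge> 0" using integral_nonneg_AE[OF a(2)[of 0]] a(3)[of 0] by linarith
  define e where "e = r / (2 * (A + 1))"
  have e_pos: "e > 0" using r_pos A_nonneg by (simp add: e_def)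
  obtain C where C: "\<And>k. AE x in M. \<bar>F k x - G x\<bar> \<le> e * a k x + C * w x"
    using absorb[OF e_pos] by blast
  let ?excess = "\<lambda>k x. max 0 (\<bar>F k x - G x\<bar> - e * a k x)"
  have ea: "integrable M (\<lambda>x. e * a k x)" "AE x in M. 0 \<le> e * a k x" for k
    using a(1,2)[of k] e_pos by (auto elim!: eventually_mono)
  have excess_int: "integrable M (?excess k)" for k using F[of k] G ea(1)[of k] by simp
  obtain k0 where k0: "\<And>k. k \<ge> k0 \<Longrightarrow> \<bar>\<integral>x. ?excess k x \<partial>M\<bar> < r / 2"
    using LIMSEQ_D[OF tendsto_integral_excess[OF F G lim ea integrable_mult_right[OF w] C], of "r / 2"] r_pos by auto
  show "\<exists>k0. \<forall>k\<ge>k0. norm ((\<integral>x. F k x \<partial>M) - (\<integral>x. G x \<partial>M)) < r"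
  proof (intro exI allI impI)
    fix k assume k: "k \<ge> k0"
    have "\<bar>(\<integral>x. F k x \<partial>M) - (\<integral>x. G x \<partial>M)\<bar> \<le> (\<integral>x. \<bar>F k x - G x\<bar> \<partial>M)"
      using integral_abs_bound[of M "\<lambda>x. F k x - G x"] F[of k] G by simp
    also have "\<dots> \<le> (\<integral>x. ?excess k x + e * a k x \<partial>M)"
      using F[of k] G excess_int[of k] ea(1)[of k] by (intro integral_mono) auto
    also have "\<dots> = (\<integral>x. ?excess k x \<partial>M) + e * (\<integral>x. a k x \<partial>M)" using excess_int[of k] ea(1)[of k] by simp
    also have "\<dots> < r / 2 + e * (A + 1)"
      using k0[OF k] a(3)[of k] e_pos by (intro add_less_le_mono mult_left_mono) auto
    also have "\<dots> = r" using A_nonneg by (simp add: e_def field_simps)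
    finally show "norm ((\<integral>x. F k x \<partial>M) - (\<integral>x. G x \<partial>M)) < r" by simp
  qed
qed

definition square_integrable :: "'a measure \<Rightarrow> ('a \<Rightarrow> 'b::euclidean_space) \<Rightarrow> bool" where
  "square_integrable M g \<longleftrightarrow> g \<in> borel_measurable M \<and> integrable M (\<lambda>x. (norm (g x))\<^sup>2)"

definition L2_norm :: "'a measure \<Rightarrow> ('a \<Rightarrow> 'b::euclidean_space) \<Rightarrow> real" where
  "L2_norm M g = sqrt (\<integral>x. (norm (g x))\<^sup>2 \<partial>M)"

lemma square_integrableD:
  assumes "square_integrable M g"
  shows "g \<in> borel_measurable M" "integrable M (\<lambda>x. (norm (g x))\<^sup>2)"
  using assms by (auto simp: square_integrable_def)

lemma L2_norm_nonneg: "L2_norm M g \<ge> 0"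
  by (simp add: L2_norm_def)

lemma L2_norm_power2: "(L2_norm M g)\<^sup>2 = (\<integral>x. (norm (g x))\<^sup>2 \<partial>M)"
  by (simp add: L2_norm_def)

lemma norm_add_power2_le: "(norm (a + b))\<^sup>2 \<le> 2 * (norm a)\<^sup>2 + 2 * (norm (b::'a::real_normed_vector))\<^sup>2"
  using sum_squares_bound[of "norm a" "norm b"] power_mono[OF norm_triangle_ineq[of a b], of 2]
  by (simp add: power2_sum)

lemma square_integrable_scaleR:
  "square_integrable M g \<Longrightarrow> square_integrable M (\<lambda>x. c *\<^sub>R g x)"
  by (auto simp: square_integrable_def power_mult_distrib)

lemma square_integrable_add:
  assumes "square_integrable M g" "square_integrable M h"
  shows "square_integrable M (\<lambda>x. g x + h x)"
  unfolding square_integrable_def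
proof
  have [measurable]: "g \<in> borel_measurable M" "h \<in> borel_measurable M"
    using assms by (simp_all add: square_integrable_def)
  show "(\<lambda>x. g x + h x) \<in> borel_measurable M" by measurable
  show "integrable M (\<lambda>x. (norm (g x + h x))\<^sup>2)"
  proof (rule Bochner_Integration.integrable_bound)
    show "integrable M (\<lambda>x. 2 * (norm (g x))\<^sup>2 + 2 * (norm (h x))\<^sup>2)"
      using assms by (simp add: square_integrable_def)
    show "AE x in M. norm ((norm (g x + h x))\<^sup>2) \<le> norm (2 * (norm (g x))\<^sup>2 + 2 * (norm (h x))\<^sup>2)"
      using norm_add_power2_le by auto
  qed measurable
qed

lemma square_integrable_diff:
  "square_integrable M g \<Longrightarrow> square_integrable M h \<Longrightarrow> square_integrable M (\<lambda>x. g x - h x)"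
  using square_integrable_add[OF _ square_integrable_scaleR[of M h "-1"], of g] by simp

lemma square_integrable_bound:
  assumes "square_integrable M g" "h \<in> borel_measurable M" "AE x in M. norm (h x) \<le> norm (g x)"
  shows "square_integrable M h"
  unfolding square_integrable_def
proof (intro conjI assms(2) Bochner_Integration.integrable_bound[OF square_integrableD(2)[OF assms(1)]])
  show "(\<lambda>x. (norm (h x))\<^sup>2) \<in> borel_measurable M" using assms(2) by measurable
  show "AE x in M. norm ((norm (h x))\<^sup>2) \<le> norm ((norm (g x))\<^sup>2)"
    using assms(3) by eventually_elim (simp add: power_mono)
qed

lemma integrable_norm_mult_norm:
  assumes "square_integrable M g" "square_integrable M h"
  shows "integrable M (\<lambda>x. norm (g x) * norm (h x))"
proof (rule Bochner_Integration.integrable_bound)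
  have [measurable]: "g \<in> borel_measurable M" "h \<in> borel_measurable M"
    using assms by (simp_all add: square_integrable_def)
  show "integrable M (\<lambda>x. (norm (g x))\<^sup>2 + (norm (h x))\<^sup>2)"
    using assms by (simp add: square_integrable_def)
  have "norm (g x) * norm (h x) \<le> (norm (g x))\<^sup>2 + (norm (h x))\<^sup>2" for x
    using sum_squares_bound[of "norm (g x)" "norm (h x)"]
      mult_nonneg_nonneg[OF norm_ge_zero[of "g x"] norm_ge_zero[of "h x"]] by linarith
  then show "AE x in M. norm (norm (g x) * norm (h x)) \<le> norm ((norm (g x))\<^sup>2 + (norm (h x))\<^sup>2)"
    by simp
  show "(\<lambda>x. norm (g x) * norm (h x)) \<in> borel_measurable M" by measurable
qed

lemma nn_integral_norm_power2:
  "square_integrable M g \<Longrightarrow> (\<integral>\<^sup>+x. (ennreal (norm (g x)))\<^sup>2 \<partial>M) = ennreal ((L2_norm M g)\<^sup>2)"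
  by (simp add: square_integrable_def ennreal_power nn_integral_eq_integral L2_norm_power2)

lemma L2_Cauchy_Schwarz:
  assumes "square_integrable M g" "square_integrable M h"
  shows "(\<integral>x. norm (g x) * norm (h x) \<partial>M) \<le> L2_norm M g * L2_norm M h"
proof -
  have [measurable]: "g \<in> borel_measurable M" "h \<in> borel_measurable M"
    using assms by (simp_all add: square_integrable_def)
  have "(\<integral>\<^sup>+x. ennreal (norm (g x)) * ennreal (norm (h x)) \<partial>M) = ennreal (\<integral>x. norm (g x) * norm (h x) \<partial>M)"
    using integrable_norm_mult_norm[OF assms]
    by (subst nn_integral_eq_integral[symmetric]) (auto simp: ennreal_mult[symmetric])
  then have "ennreal ((\<integral>x. norm (g x) * norm (h x) \<partial>M)\<^sup>2) \<le> ennreal ((L2_norm M g)\<^sup>2) * ennreal ((L2_norm M h)\<^sup>2)"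
    using Cauchy_Schwarz_nn_integral[of "\<lambda>x. ennreal (norm (g x))" M "\<lambda>x. ennreal (norm (h x))"]
    by (simp only: nn_integral_norm_power2[OF assms(1)] nn_integral_norm_power2[OF assms(2)]) (simp add: ennreal_power)
  then have "(\<integral>x. norm (g x) * norm (h x) \<partial>M)\<^sup>2 \<le> (L2_norm M g * L2_norm M h)\<^sup>2"
    by (simp add: ennreal_mult[symmetric] power_mult_distrib)
  then show ?thesis by (rule power2_le_imp_le) (simp add: L2_norm_nonneg)
qed

lemma integrable_if_le_norm_mult_norm:
  fixes p :: "'a \<Rightarrow> real"
  assumes g: "square_integrable M g" and h: "square_integrable M h"
    and p: "p \<in> borel_measurable M" "AE x in M. \<bar>p x\<bar> \<le> norm (g x) * norm (h x)"
  shows "integrable M p" "\<bar>\<integral>x. p x \<partial>M\<bar> \<le> L2_norm M g * L2_norm M h"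
proof -
  note gh = integrable_norm_mult_norm[OF g h]
  show p_int: "integrable M p"
    by (rule Bochner_Integration.integrable_bound[OF gh p(1)]) (use p(2) in eventually_elim, simp)
  have "\<bar>\<integral>x. p x \<partial>M\<bar> \<le> (\<integral>x. \<bar>p x\<bar> \<partial>M)" by (rule integral_abs_bound)
  also have "\<dots> \<le> (\<integral>x. norm (g x) * norm (h x) \<partial>M)"
    by (rule integral_mono_AE) (use p_int gh p(2) in auto)
  also have "\<dots> \<le> L2_norm M g * L2_norm M h" by (rule L2_Cauchy_Schwarz[OF g h])
  finally show "\<bar>\<integral>x. p x \<partial>M\<bar> \<le> L2_norm M g * L2_norm M h" .
qed

lemma square_integrable_borel_representative:
  fixes g :: "'a::euclidean_space \<Rightarrow> 'b::euclidean_space"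
  assumes g: "square_integrable lebesgue g"
  obtains h where "h \<in> borel_measurable borel" "AE x in lebesgue. g x = h x"
    "square_integrable lebesgue h" "L2_norm lebesgue h = L2_norm lebesgue g"
proof -
  obtain h where h: "h \<in> borel_measurable borel" "AE x in lebesgue. g x = h x"
    by (rule lebesgue_measurable_borel_representative[OF square_integrableD(1)[OF g]])
  have "square_integrable lebesgue h"
    by (rule square_integrable_bound[OF g]) (use h in \<open>auto intro: measurable_completion elim!: eventually_mono\<close>)
  moreover have "L2_norm lebesgue h = L2_norm lebesgue g"
    unfolding L2_norm_def by (rule arg_cong[where f=sqrt], rule lebesgue_integral_cong_AE(2))
      (use h(2) in \<open>auto elim!: eventually_mono\<close>)
  ultimately show ?thesis using that h by blast
qed

lemma square_integrable_integrable_inner: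
  "square_integrable M g \<Longrightarrow> square_integrable M h \<Longrightarrow> integrable M (\<lambda>x. g x \<bullet> h x)"
  by (rule integrable_if_le_norm_mult_norm(1)[of M g h])
    (auto dest!: square_integrableD(1) simp: Cauchy_Schwarz_ineq2)

lemma AE_summable_if_summable_integrals:
  fixes f :: "nat \<Rightarrow> 'a \<Rightarrow> real"
  assumes f: "\<And>j. integrable M (f j)" "\<And>j x. 0 \<le> f j x"
    and integral_le: "\<And>j. (\<integral>x. f j x \<partial>M) \<le> b j" and b: "summable b"
  shows "AE x in M. summable (\<lambda>j. f j x)"
proof -
  have b_nonneg: "0 \<le> b j" for j using Bochner_Integration.integral_nonneg[OF f(2)] integral_le[of j] by (rule order_trans)
  note [measurable] = borel_measurable_integrable[OF f(1)]
  have "(\<integral>\<^sup>+x. (\<Sum>j. ennreal (f j x)) \<partial>M) = (\<Sum>j. \<integral>\<^sup>+x. ennreal (f j x) \<partial>M)"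
    by (intro nn_integral_suminf) auto
  also have "\<dots> \<le> (\<Sum>j. ennreal (b j))"
    using f integral_le by (intro suminf_le allI) (auto simp: nn_integral_eq_integral ennreal_leI)
  also have "\<dots> = ennreal (\<Sum>j. b j)" by (rule suminf_ennreal2[OF b_nonneg b])
  finally have "(\<integral>\<^sup>+x. (\<Sum>j. ennreal (f j x)) \<partial>M) \<noteq> \<infinity>" by (auto simp: top_unique)
  then have "AE x in M. (\<Sum>j. ennreal (f j x)) \<noteq> \<infinity>" by (intro nn_integral_PInf_AE) auto
  then show ?thesis by eventually_elim (auto intro!: summable_suminf_not_top f(2))
qed

lemma convergent_if_summable_weighted_increments:
  fixes y :: "nat \<Rightarrow> 'a::banach"
  assumes "summable (\<lambda>j. 2 ^ j * (norm (y (Suc j) - y j))\<^sup>2)"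
  shows "convergent y"
proof -
  define \<Delta> where "\<Delta> j = y (Suc j) - y j" for j
  have AM_GM: "norm (\<Delta> j) \<le> (1/2) ^ j + 2 ^ j * (norm (\<Delta> j))\<^sup>2" for j
  proof -
    have "0 \<le> 2 ^ j * (norm (\<Delta> j) - (1/2) ^ j)\<^sup>2" by simp
    also have "\<dots> = 2 ^ j * (norm (\<Delta> j))\<^sup>2 - 2 * (2 ^ j * (1/2) ^ j) * norm (\<Delta> j) + (2 ^ j * (1/2) ^ j) * (1/2) ^ j"
      by (simp add: power2_diff algebra_simps power2_eq_square)
    also have "(2::real) ^ j * (1/2) ^ j = 1" by (simp add: power_mult_distrib[symmetric])
    finally show ?thesis using norm_ge_zero[of "\<Delta> j"] by linarith
  qed
  have "summable (\<lambda>j. (1/2) ^ j + 2 ^ j * (norm (\<Delta> j))\<^sup>2)"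
    using assms by (intro summable_add summable_geometric) (auto simp: \<Delta>_def)
  from summable_comparison_test'[OF this, of 0 \<Delta>] have "summable \<Delta>" using AM_GM by simp
  then have "convergent (\<lambda>j. y 0 + (\<Sum>i<j. \<Delta> i))"
    by (intro convergent_add convergent_const) (simp add: summable_iff_convergent)
  moreover have "y 0 + (\<Sum>i<j. \<Delta> i) = y j" for j
    unfolding \<Delta>_def using sum_lessThan_telescope[of y j] by (simp add: algebra_simps)
  ultimately show ?thesis by simp
qed

lemma AE_convergent_if_L2_rapidly_Cauchy:
  fixes gs :: "nat \<Rightarrow> 'a \<Rightarrow> 'b::euclidean_space"
  assumes gs: "\<And>j. square_integrable M (gs j)"
    and rapid: "\<And>j. (\<integral>x. (norm (gs (Suc j) x - gs j x))\<^sup>2 \<partial>M) \<le> (1/4) ^ j"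
  shows "AE x in M. convergent (\<lambda>j. gs j x)"
proof -
  have "AE x in M. summable (\<lambda>j. 2 ^ j * (norm (gs (Suc j) x - gs j x))\<^sup>2)"
  proof (rule AE_summable_if_summable_integrals)
    show "integrable M (\<lambda>x. 2 ^ j * (norm (gs (Suc j) x - gs j x))\<^sup>2)" for j
      using square_integrableD(2)[OF square_integrable_diff[OF gs gs]] by simp
    have "(\<integral>x. 2 ^ j * (norm (gs (Suc j) x - gs j x))\<^sup>2 \<partial>M) \<le> 2 ^ j * (1/4) ^ j" for j
      using rapid[of j] by simp
    also have "(2::real) ^ j * (1/4) ^ j = (1/2) ^ j" for j by (simp add: power_mult_distrib[symmetric])
    finally show "(\<integral>x. 2 ^ j * (norm (gs (Suc j) x - gs j x))\<^sup>2 \<partial>M) \<le> (1/2) ^ j" for j .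
  qed (auto intro: summable_geometric)
  then show ?thesis by eventually_elim (rule convergent_if_summable_weighted_increments)
qed

lemma L2_Cauchy_rapid_subsequence:
  fixes gs :: "nat \<Rightarrow> 'a \<Rightarrow> 'b::euclidean_space"
  assumes "\<And>e. e > 0 \<Longrightarrow> \<exists>N. \<forall>m\<ge>N. \<forall>n\<ge>N. (\<integral>x. (norm (gs m x - gs n x))\<^sup>2 \<partial>M) < e"
  obtains s :: "nat \<Rightarrow> nat" where "strict_mono s"
    "\<And>j. (\<integral>x. (norm (gs (s (Suc j)) x - gs (s j) x))\<^sup>2 \<partial>M) \<le> (1/4) ^ j"
proof -
  have "\<forall>j. \<exists>N. \<forall>m\<ge>N. \<forall>n\<ge>N. (\<integral>x. (norm (gs m x - gs n x))\<^sup>2 \<partial>M) < (1/4) ^ j"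
    using assms by simp
  then obtain N where N: "\<And>j m n. m \<ge> N j \<Longrightarrow> n \<ge> N j \<Longrightarrow> (\<integral>x. (norm (gs m x - gs n x))\<^sup>2 \<partial>M) < (1/4) ^ j"
    by metis
  define s where "s = rec_nat (N 0) (\<lambda>j p. max (Suc p) (N (Suc j)))"
  have s_Suc: "s (Suc j) = max (Suc (s j)) (N (Suc j))" for j by (simp add: s_def)
  have s_mono: "strict_mono s" by (rule strict_monoI_Suc) (simp add: s_Suc)
  have "s j \<ge> N j" for j by (cases j) (auto simp: s_Suc s_def)
  moreover have "s (Suc j) \<ge> s j" for j by (simp add: s_Suc)
  ultimately have "(\<integral>x. (norm (gs (s (Suc j)) x - gs (s j) x))\<^sup>2 \<partial>M) \<le> (1/4) ^ j" for j
    by (intro less_imp_le[OF N]) (auto intro: order_trans)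
  then show ?thesis using that s_mono by blast
qed

lemma L2_distance_le_AE_limit:
  assumes h: "square_integrable M h" and gs: "\<And>j. square_integrable M (gs j)"
    and lim: "AE x in M. (\<lambda>j. gs j x) \<longlonglongrightarrow> g x" and g: "g \<in> borel_measurable M"
    and distance_le: "\<And>j. (\<integral>x. (norm (h x - gs j x))\<^sup>2 \<partial>M) \<le> e"
  shows "square_integrable M (\<lambda>x. h x - g x)" "(\<integral>x. (norm (h x - g x))\<^sup>2 \<partial>M) \<le> e"
proof -
  have "AE x in M. (\<lambda>j. (norm (h x - gs j x))\<^sup>2) \<longlonglongrightarrow> (norm (h x - g x))\<^sup>2"
    using lim by eventually_elim (intro tendsto_intros)
  moreover have [measurable]: "(\<lambda>x. h x - g x) \<in> borel_measurable M" using square_integrableD(1)[OF h] g by simp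
  ultimately show "square_integrable M (\<lambda>x. h x - g x)" "(\<integral>x. (norm (h x - g x))\<^sup>2 \<partial>M) \<le> e"
    using Fatou_integrable[of M "\<lambda>j x. (norm (h x - gs j x))\<^sup>2" e "\<lambda>x. (norm (h x - g x))\<^sup>2"]
      square_integrableD(2)[OF square_integrable_diff[OF h gs]] distance_le
    by (simp_all add: square_integrable_def)
qed

proposition L2_Cauchy_limit:
  fixes gs :: "nat \<Rightarrow> 'a \<Rightarrow> 'b::euclidean_space"
  assumes gs: "\<And>k. square_integrable M (gs k)"
    and Cauchy: "\<And>e. e > 0 \<Longrightarrow> \<exists>N. \<forall>m\<ge>N. \<forall>n\<ge>N. (\<integral>x. (norm (gs m x - gs n x))\<^sup>2 \<partial>M) < e"
  obtains g and s :: "nat \<Rightarrow> nat" where "strict_mono s" "square_integrable M g"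
    "AE x in M. (\<lambda>j. gs (s j) x) \<longlonglongrightarrow> g x" "(\<lambda>j. L2_norm M (\<lambda>x. gs (s j) x - g x)) \<longlonglongrightarrow> 0"
proof -
  note [measurable] = square_integrableD(1)[OF gs]
  obtain s :: "nat \<Rightarrow> nat" where s: "strict_mono s"
    and rapid: "\<And>j. (\<integral>x. (norm (gs (s (Suc j)) x - gs (s j) x))\<^sup>2 \<partial>M) \<le> (1/4) ^ j"
    using L2_Cauchy_rapid_subsequence[OF Cauchy] by blast
  define g where "g x = lim (\<lambda>j. gs (s j) x)" for x
  have g: "g \<in> borel_measurable M" unfolding g_def by measurable
  have lim: "AE x in M. (\<lambda>j. gs (s j) x) \<longlonglongrightarrow> g x"
    using AE_convergent_if_L2_rapidly_Cauchy[OF gs rapid]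
    by eventually_elim (simp add: g_def convergent_LIMSEQ_iff)
  have tail: "\<exists>N. \<forall>i\<ge>N. square_integrable M (\<lambda>x. gs (s i) x - g x) \<and> (\<integral>x. (norm (gs (s i) x - g x))\<^sup>2 \<partial>M) \<le> e"
    if e_pos: "e > 0" for e
  proof -
    obtain N where N: "\<And>m n. m \<ge> N \<Longrightarrow> n \<ge> N \<Longrightarrow> (\<integral>x. (norm (gs m x - gs n x))\<^sup>2 \<partial>M) < e"
      using Cauchy[OF e_pos] by blast
    have s_ge: "s j \<ge> N" if "j \<ge> N" for j using that seq_suble[OF s, of j] by linarith
    have lim_shift: "AE x in M. (\<lambda>j. gs (s (j + N)) x) \<longlonglongrightarrow> g x"
      using lim by eventually_elim (rule LIMSEQ_ignore_initial_segment)
    have "(\<integral>x. (norm (gs (s i) x - gs (s (j + N)) x))\<^sup>2 \<partial>M) \<le> e" if "i \<ge> N" for i j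
      using N s_ge that by (intro less_imp_le) simp
    then show ?thesis using L2_distance_le_AE_limit[OF gs gs lim_shift g] by blast
  qed
  obtain i where "square_integrable M (\<lambda>x. gs (s i) x - g x)" using tail[of 1] by auto
  from square_integrable_diff[OF gs[of "s i"] this] have g_si: "square_integrable M g" by simp
  have "(\<lambda>j. \<integral>x. (norm (gs (s j) x - g x))\<^sup>2 \<partial>M) \<longlonglongrightarrow> 0"
  proof (rule LIMSEQ_I)
    fix e :: real assume "e > 0"
    then obtain N where "\<forall>i\<ge>N. (\<integral>x. (norm (gs (s i) x - g x))\<^sup>2 \<partial>M) \<le> e / 2" using tail[of "e / 2"] by auto
    then show "\<exists>N. \<forall>i\<ge>N. norm ((\<integral>x. (norm (gs (s i) x - g x))\<^sup>2 \<partial>M) - 0) < e"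
      using \<open>e > 0\<close> by (intro exI[of _ N]) force
  qed
  from tendsto_real_sqrt[OF this] have "(\<lambda>j. L2_norm M (\<lambda>x. gs (s j) x - g x)) \<longlonglongrightarrow> 0"
    by (simp add: L2_norm_def)
  then show ?thesis using that[OF s g_si lim] by blast
qed

section \<open>Continuously differentiable test functions\<close>

definition C1_gradient :: "('a::euclidean_space \<Rightarrow> real) \<Rightarrow> ('a \<Rightarrow> 'a) \<Rightarrow> bool" where
  "C1_gradient \<phi> G \<longleftrightarrow> (\<forall>x. GDERIV \<phi> x :> G x) \<and> continuous_on UNIV G"

definition test_gradient :: "('a::euclidean_space \<Rightarrow> real) \<Rightarrow> ('a \<Rightarrow> 'a) \<Rightarrow> bool" where
  "test_gradient \<phi> G \<longleftrightarrow> C1_gradient \<phi> G \<and> bounded {x. \<phi> x \<noteq> 0}"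

lemma C1_gradientD:
  assumes "C1_gradient \<phi> G"
  shows "GDERIV \<phi> x :> G x" "continuous_on UNIV G" "continuous_on UNIV \<phi>"
  using assms unfolding C1_gradient_def gderiv_def
  by (auto simp: continuous_on_eq_continuous_within intro: has_derivative_continuous)

lemma test_gradientD:
  assumes "test_gradient \<phi> G"
  shows "C1_gradient \<phi> G" "continuous_on UNIV G" "continuous_on UNIV \<phi>" "bounded {x. \<phi> x \<noteq> 0}"
  using assms C1_gradientD[of \<phi> G] by (simp_all add: test_gradient_def)

lemma GDERIV_locally_constant:
  assumes "GDERIV \<phi> x :> D" "open S" "x \<in> S" "\<And>y. y \<in> S \<Longrightarrow> \<phi> y = c"
  shows "D = 0"
proof -
  have "FDERIV \<phi> x :> (\<lambda>h. 0)"
    by (rule has_derivative_transform_within_open[OF has_derivative_const assms(2,3)]) (simp add: assms(4))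
  then have "(\<lambda>h. h \<bullet> D) = (\<lambda>h. 0)"
    using assms(1) unfolding gderiv_def by (metis has_derivative_unique)
  then show ?thesis by (metis inner_eq_zero_iff)
qed

lemma test_gradient_bounded_support:
  assumes "test_gradient \<phi> G"
  shows "bounded {x. G x \<noteq> 0}"
proof (rule bounded_subset[OF bounded_closure[OF test_gradientD(4)[OF assms]]])
  have "G x = 0" if "x \<in> - closure {x. \<phi> x \<noteq> 0}" for x
  proof (rule GDERIV_locally_constant[OF C1_gradientD(1)[OF test_gradientD(1)[OF assms]] _ that])
    show "\<phi> y = 0" if "y \<in> - closure {x. \<phi> x \<noteq> 0}" for y using that closure_subset[of "{x. \<phi> x \<noteq> 0}"] by blast
  qed auto
  then show "{x. G x \<noteq> 0} \<subseteq> closure {x. \<phi> x \<noteq> 0}" by blast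
qed

lemma C1_gradient_const: "C1_gradient (\<lambda>_. c) (\<lambda>_. 0)"
  by (auto simp: C1_gradient_def GDERIV_const)

lemma C1_gradient_inner: "C1_gradient (\<lambda>x. x \<bullet> e) (\<lambda>_. e)"
  unfolding C1_gradient_def gderiv_def
  by (auto intro!: bounded_linear_imp_has_derivative bounded_linear_inner_left)

lemma C1_gradient_mult:
  assumes "C1_gradient \<phi> G" "C1_gradient \<psi> H"
  shows "C1_gradient (\<lambda>x. \<phi> x * \<psi> x) (\<lambda>x. \<phi> x *\<^sub>R H x + \<psi> x *\<^sub>R G x)"
  unfolding C1_gradient_def
  by (auto intro!: GDERIV_mult continuous_intros C1_gradientD[OF assms(1)] C1_gradientD[OF assms(2)])

lemma test_gradient_mult:
  assumes "test_gradient \<phi> G" "C1_gradient \<psi> H"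
  shows "test_gradient (\<lambda>x. \<phi> x * \<psi> x) (\<lambda>x. \<phi> x *\<^sub>R H x + \<psi> x *\<^sub>R G x)"
  unfolding test_gradient_def
proof
  show "C1_gradient (\<lambda>x. \<phi> x * \<psi> x) (\<lambda>x. \<phi> x *\<^sub>R H x + \<psi> x *\<^sub>R G x)"
    by (rule C1_gradient_mult[OF test_gradientD(1)[OF assms(1)] assms(2)])
  show "bounded {x. \<phi> x * \<psi> x \<noteq> 0}" by (rule bounded_subset[OF test_gradientD(4)[OF assms(1)]]) auto
qed

lemma C1_gradient_prod:
  assumes "finite S" "\<And>i. i \<in> S \<Longrightarrow> \<exists>G. C1_gradient (f i) G"
  shows "\<exists>G. C1_gradient (\<lambda>x. \<Prod>i\<in>S. f i x) G"
  using assms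
proof (induction S rule: finite_induct)
  case empty
  then show ?case using C1_gradient_const by auto
next
  case (insert i S)
  then show ?case using C1_gradient_mult by fastforce
qed

lemma C1_gradient_compose:
  assumes "C1_gradient \<phi> G" "\<And>t. (m has_real_derivative m' t) (at t)" "continuous_on UNIV m'"
  shows "C1_gradient (\<lambda>x. m (\<phi> x)) (\<lambda>x. m' (\<phi> x) *\<^sub>R G x)"
  unfolding C1_gradient_def
proof (intro conjI allI)
  show "GDERIV (\<lambda>x. m (\<phi> x)) x :> m' (\<phi> x) *\<^sub>R G x" for x
    by (rule GDERIV_DERIV_compose[OF C1_gradientD(1)[OF assms(1)] assms(2)])
  show "continuous_on UNIV (\<lambda>x. m' (\<phi> x) *\<^sub>R G x)"
    by (intro continuous_intros C1_gradientD(2)[OF assms(1)]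
        continuous_on_compose2[OF assms(3) C1_gradientD(3)[OF assms(1)]]) auto
qed

lemma C1_gradient_radial:
  fixes m m' :: "real \<Rightarrow> real"
  assumes r0_pos: "r0 > 0" and const: "\<And>r. r < r0 \<Longrightarrow> m r = c"
    and der: "\<And>r. r > 0 \<Longrightarrow> (m has_real_derivative m' r) (at r)"
    and cont: "continuous_on {0<..} m'"
  shows "C1_gradient (\<lambda>x::'a::euclidean_space. m (norm x)) (\<lambda>x. m' (norm x) *\<^sub>R sgn x)"
  unfolding C1_gradient_def
proof (intro conjI allI)
  fix x :: 'a
  have near0: "open (ball (0::'a) r0)" "\<And>y::'a. y \<in> ball 0 r0 \<Longrightarrow> m (norm y) = c"
    using const by auto
  show "GDERIV (\<lambda>x. m (norm x)) x :> m' (norm x) *\<^sub>R sgn x"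
  proof (cases "x = 0")
    case True
    have "FDERIV (\<lambda>x::'a. m (norm x)) 0 :> (\<lambda>h. 0)"
      by (rule has_derivative_transform_within_open[OF has_derivative_const near0(1)])
        (use r0_pos near0(2) in auto)
    then show ?thesis using True by (simp add: gderiv_def)
  next
    case False
    then show ?thesis by (intro GDERIV_DERIV_compose[OF GDERIV_norm der]) auto
  qed
next
  have m'0: "m' r = 0" if "0 < r" "r < r0" for r
  proof -
    have "(m has_real_derivative 0) (at r)"
      by (rule has_field_derivative_transform_within_open[of "\<lambda>_. c" _ _ "{..<r0}"]) (use that const in auto)
    then show ?thesis using DERIV_unique der[OF that(1)] by blast
  qed
  have "continuous_on (ball (0::'a) r0 \<union> -{0}) (\<lambda>x. m' (norm x) *\<^sub>R sgn x)"
  proof (rule continuous_on_open_Un)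
    have "0 = m' (norm x) *\<^sub>R sgn x" if "x \<in> ball (0::'a) r0" for x
      using m'0[of "norm x"] that by (cases "x = 0") auto
    then show "continuous_on (ball (0::'a) r0) (\<lambda>x. m' (norm x) *\<^sub>R sgn x)"
      by (rule continuous_on_eq[OF continuous_on_const])
    show "continuous_on (-{0::'a}) (\<lambda>x. m' (norm x) *\<^sub>R sgn x)"
      by (intro continuous_intros continuous_on_compose2[OF cont]) auto
  qed auto
  moreover have "ball (0::'a) r0 \<union> -{0} = UNIV" using r0_pos by auto
  ultimately show "continuous_on UNIV (\<lambda>x::'a. m' (norm x) *\<^sub>R sgn x)" by simp
qed

lemma integrable_continuous_bounded_support:
  fixes f :: "'a::euclidean_space \<Rightarrow> real"
  assumes "continuous_on UNIV f" "bounded {x. f x \<noteq> 0}"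
  shows "integrable lborel f" "integrable lebesgue f"
proof -
  obtain R where R: "\<And>x. f x \<noteq> 0 \<Longrightarrow> norm x \<le> R" using assms(2) by (auto simp: bounded_iff)
  have "integrable lborel (\<lambda>x. indicator (cball 0 R) x *\<^sub>R f x)"
    by (rule borel_integrable_compact) (auto intro: continuous_on_subset[OF assms(1)])
  moreover have "(\<lambda>x. indicator (cball 0 R) x *\<^sub>R f x) = f"
    using R by (auto simp: indicator_def fun_eq_iff)
  ultimately show "integrable lborel f" by simp
  then show "integrable lebesgue f" by (rule integrable_completionI)
qed

lemma bounded_range_continuous_bounded_support:
  fixes f :: "'a::euclidean_space \<Rightarrow> 'b::real_normed_vector"
  assumes "continuous_on UNIV f" "bounded {x. f x \<noteq> 0}"
  obtains B where "B > 0" "\<And>x. norm (f x) \<le> B"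
proof -
  obtain R where R: "\<And>x. f x \<noteq> 0 \<Longrightarrow> norm x \<le> R" using assms(2) by (auto simp: bounded_iff)
  have "compact (f ` cball 0 R)"
    by (intro compact_continuous_image continuous_on_subset[OF assms(1)]) auto
  then obtain B where B: "B > 0" "\<And>y. y \<in> f ` cball 0 R \<Longrightarrow> norm y \<le> B"
    using compact_imp_bounded bounded_pos by metis
  have "norm (f x) \<le> B" for x using B R[of x] by (cases "f x = 0") auto
  then show ?thesis using that B(1) by blast
qed

lemma test_gradient_bounded:
  assumes "test_gradient \<phi> G"
  obtains B where "B > 0" "\<And>x. norm (\<phi> x) \<le> B" "\<And>x. norm (G x) \<le> B"
proof -
  obtain B1 where B1: "B1 > 0" "\<And>x. norm (G x) \<le> B1"
    using bounded_range_continuous_bounded_support[OF test_gradientD(2)[OF assms] test_gradient_bounded_support[OF assms]]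
    by metis
  obtain B2 where B2: "B2 > 0" "\<And>x. norm (\<phi> x) \<le> B2"
    using bounded_range_continuous_bounded_support[OF test_gradientD(3,4)[OF assms]] by metis
  show ?thesis
    by (rule that[of "max B1 B2"]) (use B1 B2 in \<open>auto simp: le_max_iff_disj less_max_iff_disj\<close>)
qed

lemma square_integrable_continuous_bounded_support:
  fixes f :: "'a::euclidean_space \<Rightarrow> 'b::euclidean_space"
  assumes "continuous_on UNIV f" "bounded {x. f x \<noteq> 0}"
  shows "square_integrable lebesgue f"
  unfolding square_integrable_def using assms
  by (intro conjI borel_measurable_lebesgue_continuous integrable_continuous_bounded_support(2) continuous_intros) auto

lemma C1_gradient_Lipschitz:
  assumes "C1_gradient \<phi> G" "\<And>x. norm (G x) \<le> B"
  shows "\<bar>\<phi> y - \<phi> x\<bar> \<le> B * norm (y - x)"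
proof -
  have "onorm (\<lambda>h. h \<bullet> G z) \<le> B" for z
  proof (rule onorm_le)
    fix h
    have "norm (h \<bullet> G z) \<le> norm h * norm (G z)" by (simp add: Cauchy_Schwarz_ineq2)
    also have "\<dots> \<le> B * norm h" using mult_left_mono[OF assms(2)[of z], of "norm h"] by (simp add: mult.commute)
    finally show "norm (h \<bullet> G z) \<le> B * norm h" .
  qed
  then show ?thesis
    using differentiable_bound[of UNIV \<phi> "\<lambda>x h. h \<bullet> G x" B y x] C1_gradientD(1)[OF assms(1)]
    by (simp add: gderiv_def)
qed

lemma C1_gradient_difference_quotient:
  assumes "C1_gradient \<phi> G" "filterlim t (at 0) F"
  shows "((\<lambda>k. (\<phi> (t k *\<^sub>R e + x) - \<phi> x) / t k) \<longlongrightarrow> e \<bullet> G x) F"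
proof -
  have "((\<lambda>s. s *\<^sub>R e + x) has_derivative (\<lambda>h. h *\<^sub>R e)) (at 0)"
    by (auto intro!: derivative_eq_intros)
  moreover have "(\<phi> has_derivative (\<lambda>h. h \<bullet> G x)) (at (0 *\<^sub>R e + x))"
    using C1_gradientD(1)[OF assms(1)] by (simp add: gderiv_def)
  ultimately have "((\<lambda>s. \<phi> (s *\<^sub>R e + x)) has_derivative (\<lambda>h. (h *\<^sub>R e) \<bullet> G x)) (at 0)"
    by (rule has_derivative_compose)
  then have "((\<lambda>s. \<phi> (s *\<^sub>R e + x)) has_real_derivative e \<bullet> G x) (at 0)"
    by (simp add: has_field_derivative_def mult.commute[of _ "e \<bullet> G x"])
  then have "(\<lambda>h. (\<phi> (h *\<^sub>R e + x) - \<phi> x) / h) \<midarrow>0\<rightarrow> e \<bullet> G x"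
    by (simp add: DERIV_def)
  then show ?thesis by (rule filterlim_compose[OF _ assms(2)])
qed

lemma LIMSEQ_at_0_inverse_Suc: "filterlim (\<lambda>k. 1 / real (Suc k)) (at 0) sequentially"
  unfolding filterlim_at using LIMSEQ_inverse_real_of_nat by (simp add: inverse_eq_divide)

lemma test_gradient_difference_quotient_le:
  assumes \<phi>: "test_gradient \<phi> G" and G: "\<And>x. norm (G x) \<le> B" and B_nonneg: "B \<ge> 0" and R: "\<And>x. \<phi> x \<noteq> 0 \<Longrightarrow> norm x \<le> R"
    and t: "0 < t" "t \<le> 1"
  shows "\<bar>(\<phi> (t *\<^sub>R e + x) - \<phi> x) / t\<bar> \<le> B * norm e * indicator (cball 0 (R + norm e)) x"
proof (cases "norm x \<le> R + norm e")
  case True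
  have "\<bar>\<phi> (t *\<^sub>R e + x) - \<phi> x\<bar> \<le> B * norm e * t"
    using C1_gradient_Lipschitz[OF test_gradientD(1)[OF \<phi>] G, of "t *\<^sub>R e + x" x] t
    by (simp add: mult_ac)
  then show ?thesis using True t(1) by (simp add: divide_le_eq mult_ac)
next
  case False
  have "norm (t *\<^sub>R e) \<le> 1 * norm e" unfolding norm_scaleR using t by (intro mult_right_mono) auto
  moreover have "norm x \<le> norm (t *\<^sub>R e + x) + norm (t *\<^sub>R e)"
    using norm_triangle_ineq4[of "t *\<^sub>R e + x" "t *\<^sub>R e"] by simp
  ultimately have "norm (t *\<^sub>R e + x) > R" using False by linarith
  moreover have "norm x > R" using False norm_ge_zero[of e] by linarith
  ultimately have "\<phi> (t *\<^sub>R e + x) = 0" "\<phi> x = 0" using R by (meson not_le)+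
  then show ?thesis using False by simp
qed

lemma integral_translation_difference_eq_0:
  fixes \<phi> :: "'a::euclidean_space \<Rightarrow> real"
  assumes [simp]: "integrable lborel \<phi>"
  shows "(\<integral>x. \<phi> (v + x) - \<phi> x \<partial>lborel) = 0"
proof -
  have [measurable]: "\<phi> \<in> borel_measurable borel" using borel_measurable_integrable[OF assms] by simp
  have "integrable (distr lborel borel ((+) v)) \<phi>" by (simp add: lborel_distr_plus)
  moreover have "(\<integral>x. \<phi> x \<partial>distr lborel borel ((+) v)) = (\<integral>x. \<phi> x \<partial>lborel)" by (simp add: lborel_distr_plus)
  ultimately show ?thesis by (simp add: integrable_distr_eq integral_distr)
qed

proposition integral_gradient_eq_0:
  assumes \<phi>: "test_gradient \<phi> G"
  shows "(\<integral>x. e \<bullet> G x \<partial>lebesgue) = 0"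
proof -
  define t where "t k = 1 / real (Suc k)" for k
  have t: "t k > 0" "t k \<le> 1" for k by (auto simp: t_def)
  define D where "D k x = (\<phi> (t k *\<^sub>R e + x) - \<phi> x) / t k" for k x
  obtain B where B: "B > 0" "\<And>x. norm (G x) \<le> B" using test_gradient_bounded[OF \<phi>] by metis
  obtain R where R: "\<And>x. \<phi> x \<noteq> 0 \<Longrightarrow> norm x \<le> R" using test_gradientD(4)[OF \<phi>] by (auto simp: bounded_iff)
  have [measurable]: "\<phi> \<in> borel_measurable borel"
    using test_gradientD(3)[OF \<phi>] by (rule borel_measurable_continuous_onI)
  have dominated: "\<bar>D k x\<bar> \<le> B * norm e * indicator (cball 0 (R + norm e)) x" for k x
    unfolding D_def using B(1) by (intro test_gradient_difference_quotient_le[OF \<phi> B(2) _ R t]) simp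
  have "(\<integral>x. D k x \<partial>lborel) = 0" for k
    unfolding D_def integral_divide_zero
    using integral_translation_difference_eq_0[OF integrable_continuous_bounded_support(1)[OF test_gradientD(3,4)[OF \<phi>]]]
    by simp
  moreover have "(\<lambda>k. \<integral>x. D k x \<partial>lborel) \<longlonglongrightarrow> (\<integral>x. e \<bullet> G x \<partial>lborel)"
  proof (rule integral_dominated_convergence)
    show "(\<lambda>x. e \<bullet> G x) \<in> borel_measurable lborel"
      using test_gradientD(2)[OF \<phi>] by (auto intro!: borel_measurable_continuous_onI continuous_intros)
    show "integrable lborel (\<lambda>x::'a. B * norm e * indicator (cball 0 (R + norm e)) x)"
      by (intro integrable_mult_right integrable_real_indicator emeasure_lborel_cball_finite) auto
    show "AE x in lborel. (\<lambda>k. D k x) \<longlonglongrightarrow> e \<bullet> G x"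
      unfolding D_def t_def
      using C1_gradient_difference_quotient[OF test_gradientD(1)[OF \<phi>] LIMSEQ_at_0_inverse_Suc] by simp
  qed (use dominated in \<open>auto simp: D_def\<close>)
  ultimately have "(\<integral>x. e \<bullet> G x \<partial>lborel) = 0" by (simp add: LIMSEQ_const_iff)
  then show ?thesis
    using test_gradientD(2)[OF \<phi>]
    by (subst integral_completion) (auto intro!: borel_measurable_continuous_onI continuous_intros)
qed

section \<open>A smooth step and the fundamental lemma\<close>

definition smooth_step :: "real \<Rightarrow> real" where
  "smooth_step t = 2 * (max 0 t)\<^sup>2 - 4 * (max 0 (t - 1/2))\<^sup>2 + 2 * (max 0 (t - 1))\<^sup>2"

definition smooth_step_deriv :: "real \<Rightarrow> real" where
  "smooth_step_deriv t = 4 * max 0 t - 8 * max 0 (t - 1/2) + 4 * max 0 (t - 1)"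

lemma has_real_derivative_max_0_power2:
  "((\<lambda>t::real. (max 0 t)\<^sup>2) has_real_derivative 2 * max 0 t) (at t)"
proof -
  consider "t < 0" | "t > 0" | "t = 0" by linarith
  then show ?thesis
  proof cases
    case 1
    have "((\<lambda>t::real. (max 0 t)\<^sup>2) has_real_derivative 0) (at t)"
      by (rule has_field_derivative_transform_within_open[of "\<lambda>_. 0" _ _ "{..<0}"]) (use 1 in auto)
    then show ?thesis using 1 by simp
  next
    case 2
    have "((\<lambda>t::real. (max 0 t)\<^sup>2) has_real_derivative 2 * t) (at t)"
      by (rule has_field_derivative_transform_within_open[of "\<lambda>t. t\<^sup>2" _ _ "{0<..}"])
        (use 2 in \<open>auto intro!: derivative_eq_intros\<close>)
    then show ?thesis using 2 by simp
  next
    case 3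
    have "((\<lambda>h::real. (max 0 h)\<^sup>2 / h) \<longlongrightarrow> 0) (at 0)"
    proof (rule Lim_null_comparison)
      show "\<forall>\<^sub>F h::real in at 0. norm ((max 0 h)\<^sup>2 / h) \<le> \<bar>h\<bar>"
        by (rule always_eventually) (auto simp: max_def power2_eq_square)
      show "((\<lambda>h::real. \<bar>h\<bar>) \<longlongrightarrow> 0) (at 0)" by (intro tendsto_eq_intros) auto
    qed
    then show ?thesis using 3 by (simp add: DERIV_def)
  qed
qed

lemma smooth_step_has_real_derivative: "(smooth_step has_real_derivative smooth_step_deriv t) (at t)"
proof -
  have shift: "((\<lambda>t::real. (max 0 (t - c))\<^sup>2) has_real_derivative 2 * max 0 (t - c)) (at t)" for c
    by (rule DERIV_cong[OF DERIV_chain2[OF has_real_derivative_max_0_power2, where Db=1]])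
      (auto intro!: derivative_eq_intros)
  show ?thesis unfolding smooth_step_def[abs_def] smooth_step_deriv_def
    by (rule derivative_eq_intros has_real_derivative_max_0_power2 shift refl | simp)+
qed

lemma smooth_step_affine_has_real_derivative:
  "((\<lambda>t. smooth_step (k * t + c)) has_real_derivative k * smooth_step_deriv (k * t + c)) (at t)"
  by (rule DERIV_cong[OF DERIV_chain2[OF smooth_step_has_real_derivative, where Db=k]])
    (auto intro!: derivative_eq_intros)

lemma continuous_on_smooth_step_deriv [continuous_intros]:
  "continuous_on S f \<Longrightarrow> continuous_on S (\<lambda>x. smooth_step_deriv (f x))"
  unfolding smooth_step_deriv_def by (intro continuous_intros)

lemma continuous_on_smooth_step [continuous_intros]:
  "continuous_on S f \<Longrightarrow> continuous_on S (\<lambda>x. smooth_step (f x))"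
  unfolding smooth_step_def by (intro continuous_intros)

lemma smooth_step_eq_0: "t \<le> 0 \<Longrightarrow> smooth_step t = 0"
  by (simp add: smooth_step_def)

lemma smooth_step_eq_1: "t \<ge> 1 \<Longrightarrow> smooth_step t = 1"
  by (auto simp: smooth_step_def power2_eq_square algebra_simps)

lemma smooth_step_deriv_eq_0: "t \<le> 0 \<or> t \<ge> 1 \<Longrightarrow> smooth_step_deriv t = 0"
  by (auto simp: smooth_step_deriv_def)

lemma smooth_step_deriv_nonneg: "0 \<le> smooth_step_deriv t"
  and smooth_step_deriv_le: "smooth_step_deriv t \<le> 2"
  by (auto simp: smooth_step_deriv_def max_def)

lemma smooth_step_mono: "s \<le> t \<Longrightarrow> smooth_step s \<le> smooth_step t"
  using DERIV_nonneg_imp_nondecreasing smooth_step_has_real_derivative smooth_step_deriv_nonneg by metis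

lemma smooth_step_nonneg: "0 \<le> smooth_step t"
  using smooth_step_mono[of "min t 0" t] by (simp add: smooth_step_eq_0)

lemma smooth_step_le_1: "smooth_step t \<le> 1"
  using smooth_step_mono[of t "max t 1"] by (simp add: smooth_step_eq_1)

lemma smooth_step_pos:
  assumes "t > 0"
  shows "smooth_step t > 0"
proof -
  have "0 < smooth_step (min t (1/2))" using assms by (simp add: smooth_step_def min_def)
  also have "\<dots> \<le> smooth_step t" by (rule smooth_step_mono) simp
  finally show ?thesis .
qed

lemma smooth_step_scaled_tendsto: "(\<lambda>k. smooth_step (real k * t)) \<longlonglongrightarrow> indicator {0<..} t"
proof (cases "t > 0")
  case True
  obtain k0 :: nat where k0: "1 / t < real k0" using reals_Archimedean2 by blast
  have "smooth_step (real k * t) = 1" if "k \<ge> k0" for k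
  proof (rule smooth_step_eq_1)
    have "1 / t < real k" using k0 that by linarith
    then show "1 \<le> real k * t" using True by (simp add: field_simps)
  qed
  then have "\<forall>\<^sub>F k in sequentially. smooth_step (real k * t) = 1"
    unfolding eventually_sequentially by blast
  then show ?thesis using True by (simp add: tendsto_eventually)
next
  case False
  then show ?thesis by (auto simp: smooth_step_eq_0 mult_nonneg_nonpos)
qed

lemma test_gradient_ball_cutoff:
  assumes "R > 0"
  shows "\<exists>G. test_gradient (\<lambda>x::'a::euclidean_space. smooth_step (R + 1 - norm x)) G"
proof -
  have "C1_gradient (\<lambda>x::'a. smooth_step (-1 * norm x + (R + 1)))
      (\<lambda>x. (-1 * smooth_step_deriv (-1 * norm x + (R + 1))) *\<^sub>R sgn x)"
    by (rule C1_gradient_radial[OF assms _ smooth_step_affine_has_real_derivative])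
      (auto simp: smooth_step_eq_1 intro!: continuous_intros)
  moreover have "bounded {x::'a. smooth_step (-1 * norm x + (R + 1)) \<noteq> 0}"
  proof (rule bounded_subset[OF bounded_cball])
    show "{x::'a. smooth_step (-1 * norm x + (R + 1)) \<noteq> 0} \<subseteq> cball 0 (R + 1)"
      using smooth_step_eq_0[of "-1 * norm x + (R + 1)" for x :: 'a] by force
  qed
  ultimately have "\<exists>G. test_gradient (\<lambda>x::'a. smooth_step (-1 * norm x + (R + 1))) G"
    unfolding test_gradient_def by blast
  then show ?thesis by (simp add: algebra_simps)
qed

definition box_bump :: "real \<Rightarrow> 'a::euclidean_space \<Rightarrow> 'a \<Rightarrow> 'a \<Rightarrow> real" where
  "box_bump k a b x = (\<Prod>i\<in>Basis. smooth_step (k * (x \<bullet> i - a \<bullet> i)) * smooth_step (k * (b \<bullet> i - x \<bullet> i)))"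

lemma box_bump_nonneg: "0 \<le> box_bump k a b x" and box_bump_le_1: "box_bump k a b x \<le> 1"
  unfolding box_bump_def
  by (auto intro!: prod_nonneg prod_le_1 mult_nonneg_nonneg mult_le_one
      simp: smooth_step_nonneg smooth_step_le_1)

lemma box_bump_eq_0:
  assumes "k \<ge> 0" "x \<notin> cbox a b"
  shows "box_bump k a b x = 0"
proof -
  obtain i where i: "i \<in> Basis" "x \<bullet> i < a \<bullet> i \<or> b \<bullet> i < x \<bullet> i" using assms(2) by (auto simp: mem_box)
  then have "smooth_step (k * (x \<bullet> i - a \<bullet> i)) * smooth_step (k * (b \<bullet> i - x \<bullet> i)) = 0"
    using assms(1) by (auto simp: smooth_step_eq_0 mult_nonneg_nonpos)
  then show ?thesis unfolding box_bump_def using i(1) by (intro prod_zero) auto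
qed

lemma continuous_on_box_bump: "continuous_on S (box_bump k a b)"
  unfolding box_bump_def by (intro continuous_intros)

lemma test_gradient_box_bump:
  assumes "k \<ge> 0"
  shows "\<exists>G. test_gradient (box_bump k a b) G"
proof -
  have factor: "\<exists>G. C1_gradient (\<lambda>x::'a. smooth_step (k * (x \<bullet> i) + c)) G" for k i c
  proof -
    have "continuous_on UNIV (\<lambda>t. k * smooth_step_deriv (k * t + c))" by (intro continuous_intros)
    from C1_gradient_compose[OF C1_gradient_inner smooth_step_affine_has_real_derivative this]
    show ?thesis by blast
  qed
  have "\<exists>G. C1_gradient (\<lambda>x. smooth_step (k * (x \<bullet> i - a \<bullet> i)) * smooth_step (k * (b \<bullet> i - x \<bullet> i))) G" for i
  proof -
    obtain G H where "C1_gradient (\<lambda>x. smooth_step (k * (x \<bullet> i) + - k * (a \<bullet> i))) G"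
      "C1_gradient (\<lambda>x. smooth_step (- k * (x \<bullet> i) + k * (b \<bullet> i))) H"
      using factor by meson
    from C1_gradient_mult[OF this] show ?thesis by (auto simp: algebra_simps)
  qed
  then have "\<exists>G. C1_gradient (box_bump k a b) G"
    unfolding box_bump_def[abs_def] by (intro C1_gradient_prod) auto
  moreover have "bounded {x. box_bump k a b x \<noteq> 0}"
    using box_bump_eq_0[OF assms] by (intro bounded_subset[OF bounded_cbox[of a b]]) blast
  ultimately show ?thesis by (auto simp: test_gradient_def)
qed

lemma box_bump_tendsto_indicator: "(\<lambda>k. box_bump (real k) a b x) \<longlonglongrightarrow> indicator (box a b) x"
proof -
  have "(\<lambda>k. box_bump (real k) a b x)
      \<longlonglongrightarrow> (\<Prod>i\<in>Basis. indicator {0<..} (x \<bullet> i - a \<bullet> i) * indicator {0<..} (b \<bullet> i - x \<bullet> i))"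
    unfolding box_bump_def by (intro tendsto_prod tendsto_mult smooth_step_scaled_tendsto)
  also have "(\<Prod>i\<in>Basis. indicator {0<..} (x \<bullet> i - a \<bullet> i) * indicator {0<..} (b \<bullet> i - x \<bullet> i))
      = (indicator (box a b) x :: real)"
  proof (cases "x \<in> box a b")
    case True
    then show ?thesis by (auto simp: mem_box)
  next
    case False
    then obtain i where "i \<in> Basis" "\<not> (a \<bullet> i < x \<bullet> i \<and> x \<bullet> i < b \<bullet> i)" by (auto simp: mem_box)
    then show ?thesis using False by (auto intro!: prod_zero bexI[of _ i])
  qed
  finally show ?thesis .
qed

lemma corner_cube_subset_cbox:
  fixes x :: "'a::euclidean_space"
  assumes "x \<in> box a b" "d > 0"
  obtains h where "0 < h" "h < d" "cbox x (x + h *\<^sub>R One) \<subseteq> cbox a b"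
proof -
  obtain r where r: "r > 0" "ball x r \<subseteq> box a b" using assms(1) open_box open_contains_ball by blast
  define h where "h = min d (r / DIM('a)) / 2"
  have h: "0 < h" "h < d" "DIM('a) * h < r" using assms(2) r(1) by (auto simp: h_def min_def field_simps)
  have "cbox x (x + h *\<^sub>R One) \<subseteq> ball x r"
  proof
    fix y assume y: "y \<in> cbox x (x + h *\<^sub>R One)"
    have "norm (y - x) \<le> (\<Sum>i\<in>Basis. \<bar>(y - x) \<bullet> i\<bar>)" by (rule norm_le_l1)
    also have "\<dots> \<le> (\<Sum>i\<in>(Basis::'a set). h)"
      using y by (intro sum_mono) (auto simp: mem_box inner_diff_left inner_add_left)
    finally show "y \<in> ball x r" using h(3) by (simp add: dist_norm norm_minus_commute)
  qed
  then have "cbox x (x + h *\<^sub>R One) \<subseteq> cbox a b" using r(2) box_subset_cbox by blast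
  then show ?thesis by (rule that[OF h(1,2)])
qed

lemma AE_box_zero_if_subbox_integrals_zero:
  fixes f :: "'a::euclidean_space \<Rightarrow> real"
  assumes int: "f integrable_on cbox a b"
    and zero: "\<And>c d. cbox c d \<subseteq> cbox a b \<Longrightarrow> integral (cbox c d) f = 0"
  shows "AE x in lebesgue. x \<in> box a b \<longrightarrow> f x = 0"
proof -
  define F where "F x = (if x \<in> cbox a b then f x else 0)" for x
  have F_int: "F integrable_on cbox c d" for c d
  proof -
    obtain p q where "cbox a b \<inter> cbox c d = cbox p q" using Int_interval[of a b c d] by blast
    then show ?thesis
      unfolding F_def integrable_restrict_Int using Henstock_Kurzweil_Integration.integrable_subinterval[OF int, of p q] by auto
  qed
  obtain N where N: "negligible N" and density: "\<And>x e. x \<notin> N \<Longrightarrow> 0 < e \<Longrightarrow>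
      \<exists>d>0. \<forall>h. 0 < h \<and> h < d \<longrightarrow> norm (integral (cbox x (x + h *\<^sub>R One)) F /\<^sub>R h ^ DIM('a) - F x) < e"
    using integrable_ccontinuous_explicit[OF F_int] by blast
  have "f x = 0" if x: "x \<in> box a b" "x \<notin> N" for x
  proof (rule ccontr)
    assume "f x \<noteq> 0"
    then obtain d where d: "d > 0" "\<And>h. 0 < h \<Longrightarrow> h < d \<Longrightarrow>
        norm (integral (cbox x (x + h *\<^sub>R One)) F /\<^sub>R h ^ DIM('a) - F x) < norm (f x)"
      using density[OF x(2), of "norm (f x)"] by auto
    obtain h where h: "0 < h" "h < d" and sub: "cbox x (x + h *\<^sub>R One) \<subseteq> cbox a b"
      by (rule corner_cube_subset_cbox[OF x(1) d(1)])
    have "integral (cbox x (x + h *\<^sub>R One)) F = integral (cbox x (x + h *\<^sub>R One)) f"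
      using sub by (intro integral_cong) (auto simp: F_def)
    then have "integral (cbox x (x + h *\<^sub>R One)) F = 0" using zero[OF sub] by simp
    moreover have "F x = f x" using x(1) box_subset_cbox by (auto simp: F_def)
    ultimately show False using d(2)[OF h] by simp
  qed
  moreover have "AE x in lebesgue. x \<notin> N" using N by (intro AE_not_in) (simp add: negligible_iff_null_sets)
  ultimately show ?thesis by (auto elim!: eventually_mono)
qed

lemma AE_zero_if_box_integrals_zero:
  fixes f :: "'a::euclidean_space \<Rightarrow> real"
  assumes S: "open S"
    and int: "\<And>a b. cbox a b \<subseteq> S \<Longrightarrow> f integrable_on cbox a b"
    and zero: "\<And>a b. cbox a b \<subseteq> S \<Longrightarrow> integral (cbox a b) f = 0"
  shows "AE x in lebesgue. x \<in> S \<longrightarrow> f x = 0"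
proof -
  let ?B = "{box a b |a b. cbox a b \<subseteq> S}"
  obtain B where B: "B \<subseteq> ?B" "countable B" "\<Union>B = \<Union>?B" by (rule Lindelof[of ?B]) auto
  have "AE x in lebesgue. \<forall>U\<in>B. x \<in> U \<longrightarrow> f x = 0"
  proof (subst AE_ball_countable[OF B(2)], intro ballI)
    fix U assume "U \<in> B"
    then obtain a b where U: "U = box a b" and ab: "cbox a b \<subseteq> S" using B(1) by blast
    show "AE x in lebesgue. x \<in> U \<longrightarrow> f x = 0"
      unfolding U by (rule AE_box_zero_if_subbox_integrals_zero[OF int zero]) (use ab in auto)
  qed
  moreover have "S \<subseteq> \<Union>B" unfolding B(3) by (auto elim!: open_contains_cbox[OF S])
  ultimately show ?thesis by (auto elim!: eventually_mono)
qed

lemma AE_zero_if_box_bump_integrals_zero: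
  fixes f :: "'a::euclidean_space \<Rightarrow> real"
  assumes S: "open S"
    and int: "\<And>a b. cbox a b \<subseteq> S \<Longrightarrow> set_integrable lebesgue (cbox a b) f"
    and zero: "\<And>(k::nat) a b. cbox a b \<subseteq> S \<Longrightarrow> (\<integral>x. f x * box_bump (real k) a b x \<partial>lebesgue) = 0"
  shows "AE x in lebesgue. x \<in> S \<longrightarrow> f x = 0"
proof (rule AE_zero_if_box_integrals_zero[OF S])
  fix a b assume ab: "cbox a b \<subseteq> S"
  define F where "F x = indicator (cbox a b) x * f x" for x
  have F: "integrable lebesgue F" using int[OF ab] by (simp add: set_integrable_def F_def[abs_def])
  have Fm [measurable]: "F \<in> borel_measurable lebesgue" using F by simp
  have bump_m: "box_bump (real k) a b \<in> borel_measurable lebesgue" for k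
    by (rule borel_measurable_lebesgue_continuous[OF continuous_on_box_bump])
  have "(\<lambda>k. \<integral>x. F x * box_bump (real k) a b x \<partial>lebesgue) \<longlonglongrightarrow> (\<integral>x. F x * indicator (box a b) x \<partial>lebesgue)"
  proof (rule integral_dominated_convergence)
    show "integrable lebesgue (\<lambda>x. norm (F x))" using F by simp
    show "AE x in lebesgue. (\<lambda>k. F x * box_bump (real k) a b x) \<longlonglongrightarrow> F x * indicator (box a b) x"
      by (auto intro!: tendsto_mult box_bump_tendsto_indicator)
    show "AE x in lebesgue. norm (F x * box_bump (real k) a b x) \<le> norm (F x)" for k
      by (auto simp: abs_mult box_bump_nonneg intro!: mult_right_le_one_le box_bump_le_1)
    show "(\<lambda>x. F x * indicator (box a b) x) \<in> borel_measurable lebesgue"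
      by (intro borel_measurable_times Fm measurable_completion) auto
  qed (use bump_m in \<open>auto intro!: borel_measurable_times\<close>)
  moreover have "F x * box_bump (real k) a b x = f x * box_bump (real k) a b x" for k x
    using box_bump_eq_0[of "real k" x a b] by (cases "x \<in> cbox a b") (auto simp: F_def)
  ultimately have "(\<integral>x. F x * indicator (box a b) x \<partial>lebesgue) = 0"
    using zero[OF ab] by (simp add: LIMSEQ_const_iff)
  moreover have "AE x in lebesgue. F x * indicator (box a b) x = indicator (cbox a b) x *\<^sub>R f x"
    using negligible_frontier_interval[of a b, unfolded negligible_iff_null_sets, THEN AE_not_in]
    by eventually_elim (auto simp: F_def indicator_def)
  ultimately have "(LINT x:cbox a b|lebesgue. f x) = 0"
    unfolding set_lebesgue_integral_def using lebesgue_integral_cong_AE(2) by metis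
  then show "integral (cbox a b) f = 0" and "f integrable_on cbox a b"
    using set_lebesgue_integral_eq_integral[OF int[OF ab]] by auto
qed

proposition fundamental_lemma_test_gradient:
  fixes z :: "'a::euclidean_space \<Rightarrow> real"
  assumes int: "\<And>\<phi> G. test_gradient \<phi> G \<Longrightarrow> integrable lebesgue (\<lambda>x. z x * \<phi> x)"
    and zero: "\<And>\<phi> G. test_gradient \<phi> G \<Longrightarrow> (\<integral>x. z x * \<phi> x \<partial>lebesgue) = 0"
  shows "AE x in lebesgue. z x = 0"
proof -
  have "set_integrable lebesgue (cbox a b) z" for a b
  proof -
    obtain R where R: "R > 0" "\<And>x. x \<in> cbox a b \<Longrightarrow> norm x \<le> R"
      using bounded_cbox[of a b] unfolding bounded_pos by blast
    obtain G where "test_gradient (\<lambda>x::'a. smooth_step (R + 1 - norm x)) G"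
      using test_gradient_ball_cutoff[OF R(1)] by blast
    from integrable_mult_indicator[OF _ int[OF this], of "cbox a b"]
    have "integrable lebesgue (\<lambda>x. indicator (cbox a b) x *\<^sub>R (z x * smooth_step (R + 1 - norm x)))" by simp
    moreover have "indicator (cbox a b) x *\<^sub>R (z x * smooth_step (R + 1 - norm x)) = indicator (cbox a b) x *\<^sub>R z x" for x
      using R(2)[of x] by (auto simp: indicator_def smooth_step_eq_1)
    ultimately show ?thesis by (simp only: set_integrable_def)
  qed
  moreover have "(\<integral>x. z x * box_bump (real k) a b x \<partial>lebesgue) = 0" for k a b
    using test_gradient_box_bump[of "real k" a b] zero by auto
  ultimately show ?thesis using AE_zero_if_box_bump_integrals_zero[of UNIV z] by auto
qed

lemma integral_smooth_step_deriv_shift: "(\<integral>t. smooth_step_deriv (t - c) \<partial>lebesgue) = 1"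
proof -
  have cont: "continuous_on UNIV (\<lambda>t. smooth_step_deriv (t - c))" by (intro continuous_intros)
  have "(\<integral>t. smooth_step_deriv (t - c) * indicator {c..c + 1} t \<partial>lborel)
      = smooth_step (1 * (c + 1) + (- c)) - smooth_step (1 * c + (- c))"
    by (rule integral_FTC_Icc_nonneg)
      (use cont smooth_step_affine_has_real_derivative[of 1 "- c"] in
        \<open>auto intro: borel_measurable_continuous_onI simp: smooth_step_deriv_nonneg\<close>)
  moreover have "smooth_step_deriv (t - c) * indicator {c..c + 1} t = smooth_step_deriv (t - c)" for t
    using smooth_step_deriv_eq_0[of "t - c"] by (cases "t \<le> c"; cases "t \<ge> c + 1") (auto simp: indicator_def)
  ultimately have "(\<integral>t. smooth_step_deriv (t - c) \<partial>lborel) = 1"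
    by (simp add: smooth_step_eq_0 smooth_step_eq_1)
  then show ?thesis using cont by (subst integral_completion) (auto intro: borel_measurable_continuous_onI)
qed

lemma integrable_continuous_interval_support:
  fixes \<eta> :: "real \<Rightarrow> real"
  assumes "continuous_on UNIV \<eta>" "\<And>s. s \<notin> {\<alpha>..\<beta>} \<Longrightarrow> \<eta> s = 0"
  shows "integrable lebesgue \<eta>"
  by (rule integrable_continuous_bounded_support(2)[OF assms(1) bounded_subset[OF bounded_closed_interval]])
    (use assms(2) in blast)

lemma bounded_continuous_interval_support:
  fixes \<eta> :: "real \<Rightarrow> real"
  assumes "continuous_on UNIV \<eta>" "\<And>s. s \<notin> {\<alpha>..\<beta>} \<Longrightarrow> \<eta> s = 0"
  obtains B where "B > 0" "\<And>s. \<bar>\<eta> s\<bar> \<le> B"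
proof -
  have "{s. \<eta> s \<noteq> 0} \<subseteq> {\<alpha>..\<beta>}" using assms(2) by blast
  then show ?thesis
    using bounded_range_continuous_bounded_support[OF assms(1) bounded_subset[OF bounded_closed_interval]] that
    unfolding real_norm_def by metis
qed

lemma integrable_mult_continuous_interval_support:
  fixes E \<eta> :: "real \<Rightarrow> real"
  assumes E: "set_integrable lebesgue {\<alpha>..\<beta>} E"
    and \<eta>: "continuous_on UNIV \<eta>" "\<And>s. s \<notin> {\<alpha>..\<beta>} \<Longrightarrow> \<eta> s = 0"
  shows "integrable lebesgue (\<lambda>s. E s * \<eta> s)"
proof -
  obtain B where B: "B > 0" "\<And>s. \<bar>\<eta> s\<bar> \<le> B"
    using bounded_continuous_interval_support[OF \<eta>] by metis
  have E_int: "integrable lebesgue (\<lambda>s. indicator {\<alpha>..\<beta>} s * E s)"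
    using E by (simp add: set_integrable_def)
  show ?thesis
  proof (rule Bochner_Integration.integrable_bound)
    show "integrable lebesgue (\<lambda>s. B * (indicator {\<alpha>..\<beta>} s * E s))" using E_int by simp
    have "(\<lambda>s. (indicator {\<alpha>..\<beta>} s * E s) * \<eta> s) \<in> borel_measurable lebesgue"
      by (rule borel_measurable_times[OF borel_measurable_integrable[OF E_int] borel_measurable_lebesgue_continuous[OF \<eta>(1)]])
    moreover have "(indicator {\<alpha>..\<beta>} s * E s) * \<eta> s = E s * \<eta> s" for s
      using \<eta>(2)[of s] by (auto simp: indicator_def)
    ultimately show "(\<lambda>s. E s * \<eta> s) \<in> borel_measurable lebesgue" by simp
    have "norm (E s * \<eta> s) \<le> norm (B * (indicator {\<alpha>..\<beta>} s * E s))" for s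
      using \<eta>(2)[of s] B(1) mult_left_mono[OF B(2)[of s], of "\<bar>E s\<bar>"]
      by (cases "s \<in> {\<alpha>..\<beta>}") (auto simp: abs_mult mult.commute)
    then show "AE s in lebesgue. norm (E s * \<eta> s) \<le> norm (B * (indicator {\<alpha>..\<beta>} s * E s))" by simp
  qed
qed

text \<open>Subtracting a multiple of a bump of integral 1 turns any test function into one with mean zero.\<close>

lemma mean_zero_orthogonal_imp_orthogonal:
  fixes E :: "real \<Rightarrow> real"
  assumes int: "\<And>\<alpha> \<beta>. a < \<alpha> \<Longrightarrow> set_integrable lebesgue {\<alpha>..\<beta>} E"
    and zero: "\<And>\<eta> \<alpha> \<beta>. a < \<alpha> \<Longrightarrow> continuous_on UNIV \<eta> \<Longrightarrow> (\<And>s. s \<notin> {\<alpha>..\<beta>} \<Longrightarrow> \<eta> s = 0) \<Longrightarrow>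
      (\<integral>s. \<eta> s \<partial>lebesgue) = 0 \<Longrightarrow> (\<integral>s. E s * \<eta> s \<partial>lebesgue) = 0"
    and p: "a < \<alpha>" "continuous_on UNIV p" "\<And>s. s \<notin> {\<alpha>..\<beta>} \<Longrightarrow> p s = 0"
    and q: "a < \<gamma>" "continuous_on UNIV q" "\<And>s. s \<notin> {\<gamma>..\<delta>} \<Longrightarrow> q s = 0" "(\<integral>s. q s \<partial>lebesgue) = 1"
  shows "(\<integral>s. (E s - (\<integral>s. E s * q s \<partial>lebesgue)) * p s \<partial>lebesgue) = 0"
proof -
  define I where "I = (\<integral>s. p s \<partial>lebesgue)"
  have p_int: "integrable lebesgue p" and Ep_int: "integrable lebesgue (\<lambda>s. E s * p s)"
    and q_int: "integrable lebesgue q" and Eq_int: "integrable lebesgue (\<lambda>s. E s * q s)"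
    using integrable_continuous_interval_support[OF p(2,3)] integrable_continuous_interval_support[OF q(2,3)]
      integrable_mult_continuous_interval_support[OF int[OF p(1)] p(2,3)]
      integrable_mult_continuous_interval_support[OF int[OF q(1)] q(2,3)] by blast+
  have "(\<integral>s. E s * (p s - I * q s) \<partial>lebesgue) = 0"
  proof (rule zero[of "min \<alpha> \<gamma>" _ "max \<beta> \<delta>"])
    show "(\<integral>s. p s - I * q s \<partial>lebesgue) = 0" using p_int q_int q(4) by (simp add: I_def)
    show "p s - I * q s = 0" if "s \<notin> {min \<alpha> \<gamma>..max \<beta> \<delta>}" for s
    proof -
      have "s \<notin> {\<alpha>..\<beta>}" "s \<notin> {\<gamma>..\<delta>}" using that by auto
      then show ?thesis by (simp add: p(3) q(3))
    qed
  qed (use p(1) q(1) in \<open>auto intro!: continuous_intros p(2) q(2)\<close>)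
  moreover have "E s * (p s - I * q s) = E s * p s - I * (E s * q s)" for s by (simp add: algebra_simps)
  ultimately have "(\<integral>s. E s * p s \<partial>lebesgue) = I * (\<integral>s. E s * q s \<partial>lebesgue)" using Ep_int Eq_int by simp
  then show ?thesis using Ep_int p_int by (simp add: I_def left_diff_distrib)
qed

proposition du_Bois_Reymond:
  fixes E :: "real \<Rightarrow> real"
  assumes int: "\<And>\<alpha> \<beta>. a < \<alpha> \<Longrightarrow> set_integrable lebesgue {\<alpha>..\<beta>} E"
    and zero: "\<And>\<eta> \<alpha> \<beta>. a < \<alpha> \<Longrightarrow> continuous_on UNIV \<eta> \<Longrightarrow> (\<And>s. s \<notin> {\<alpha>..\<beta>} \<Longrightarrow> \<eta> s = 0) \<Longrightarrow>
      (\<integral>s. \<eta> s \<partial>lebesgue) = 0 \<Longrightarrow> (\<integral>s. E s * \<eta> s \<partial>lebesgue) = 0"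
  shows "\<exists>c. AE s in lebesgue. a < s \<longrightarrow> E s = c"
proof -
  let ?q = "\<lambda>t. smooth_step_deriv (t - (a + 1))"
  have q: "continuous_on UNIV ?q" "\<And>t. t \<notin> {a + 1..a + 2} \<Longrightarrow> ?q t = 0"
    by (auto intro!: continuous_intros smooth_step_deriv_eq_0)
  define c where "c = (\<integral>s. E s * ?q s \<partial>lebesgue)"
  have "AE s in lebesgue. s \<in> {a<..} \<longrightarrow> E s - c = 0"
  proof (rule AE_zero_if_box_bump_integrals_zero)
    fix k :: nat and \<alpha> \<beta> :: real assume sub: "cbox \<alpha> \<beta> \<subseteq> {a<..}"
    show "set_integrable lebesgue (cbox \<alpha> \<beta>) (\<lambda>s. E s - c)"
    proof (cases "\<alpha> \<le> \<beta>")
      case True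
      then have "a < \<alpha>" using sub by auto
      moreover have "set_integrable lebesgue {\<alpha>..\<beta>} (\<lambda>s. c)"
        unfolding set_integrable_def by (intro integrable_scaleR_left integrable_real_indicator) (auto simp: emeasure_lborel_Icc_eq)
      ultimately show ?thesis using int by (auto intro!: set_integral_diff)
    qed (auto simp: set_integrable_def)
    show "(\<integral>s. (E s - c) * box_bump (real k) \<alpha> \<beta> s \<partial>lebesgue) = 0"
    proof (cases "\<alpha> \<le> \<beta>")
      case True
      then have "a < \<alpha>" using sub by auto
      show ?thesis
        unfolding c_def
      proof (rule mean_zero_orthogonal_imp_orthogonal[where \<gamma>="a + 1" and \<delta>="a + 2" and \<beta>=\<beta>, OF int _ \<open>a < \<alpha>\<close> continuous_on_box_bump])
        show "(\<integral>s. E s * \<eta> s \<partial>lebesgue) = 0" if "a < \<alpha>" "continuous_on UNIV \<eta>" "\<And>s. s \<notin> {\<alpha>..\<beta>} \<Longrightarrow> \<eta> s = 0"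
          "(\<integral>s. \<eta> s \<partial>lebesgue) = 0" for \<eta> \<alpha> \<beta> by (rule zero[OF that])
        show "box_bump (real k) \<alpha> \<beta> s = 0" if "s \<notin> {\<alpha>..\<beta>}" for s using that by (intro box_bump_eq_0) auto
      qed (use q integral_smooth_step_deriv_shift in auto)
    qed (simp add: box_bump_eq_0)
  qed auto
  then show ?thesis by (intro exI[of _ c]) (auto elim!: eventually_mono)
qed

section \<open>Weak gradients\<close>

lemma GDERIV_imp_frechet_derivative_axis:
  fixes \<phi> :: "real^'n \<Rightarrow> real"
  assumes "GDERIV \<phi> x :> D"
  shows "frechet_derivative \<phi> (at x) (axis i 1) = D $ i"
  using frechet_derivative_at[OF assms[unfolded gderiv_def]] by (metis inner_axis' mult_1 inner_real_def)

lemma test_gradient_imp_test_fun: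
  fixes \<phi> :: "real^'n \<Rightarrow> real"
  assumes "test_gradient \<phi> G"
  shows "test_fun \<phi>"
  unfolding test_fun_def
proof (intro conjI allI)
  note grad = C1_gradientD(1)[OF test_gradientD(1)[OF assms]]
  show "\<phi> differentiable at x" for x using grad unfolding gderiv_def by (rule differentiableI)
  show "continuous_on UNIV (\<lambda>x. frechet_derivative \<phi> (at x) (axis i 1))" for i
    unfolding GDERIV_imp_frechet_derivative_axis[OF grad]
    using test_gradientD(2)[OF assms] by (intro continuous_intros)
  have "compact (closure {x. \<phi> x \<noteq> 0})" using test_gradientD(4)[OF assms] by (simp add: compact_closure)
  moreover have "\<phi> x = 0" if "x \<notin> closure {x. \<phi> x \<noteq> 0}" for x using that closure_subset[of "{x. \<phi> x \<noteq> 0}"] by blast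
  ultimately show "\<exists>C. compact C \<and> (\<forall>x. x \<notin> C \<longrightarrow> \<phi> x = 0)" by blast
qed

lemma test_fun_imp_test_gradient:
  fixes \<phi> :: "real^'n \<Rightarrow> real"
  assumes "test_fun \<phi>"
  obtains G where "test_gradient \<phi> G"
proof
  define G where "G x = (\<chi> i. frechet_derivative \<phi> (at x) (axis i 1))" for x
  have "GDERIV \<phi> x :> G x" for x
  proof -
    let ?D = "frechet_derivative \<phi> (at x)"
    have deriv: "(\<phi> has_derivative ?D) (at x)"
      using assms unfolding test_fun_def using frechet_derivative_works by blast
    then have linear: "linear ?D" by (rule has_derivative_linear)
    have "?D h = h \<bullet> G x" for h
    proof -
      have "?D h = ?D (\<Sum>i\<in>UNIV. (h$i) *\<^sub>R axis i 1)"
        using basis_expansion[of h] by (simp add: scalar_mult_eq_scaleR)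
      also have "\<dots> = (\<Sum>i\<in>UNIV. h$i * ?D (axis i 1))"
        by (simp add: linear_sum[OF linear] linear_cmul[OF linear])
      finally show ?thesis by (simp add: G_def inner_vec_def)
    qed
    then show ?thesis using deriv unfolding gderiv_def by presburger
  qed
  moreover have "continuous_on UNIV G"
    unfolding G_def using assms by (auto simp: test_fun_def intro!: continuous_intros)
  moreover have "bounded {x. \<phi> x \<noteq> 0}"
    using assms compact_imp_bounded bounded_subset unfolding test_fun_def by (metis (mono_tags) mem_Collect_eq subsetI)
  ultimately show "test_gradient \<phi> G" by (simp add: test_gradient_def C1_gradient_def)
qed

lemma weak_gradI:
  fixes u :: "real^'n \<Rightarrow> real"
  assumes "g \<in> borel_measurable lebesgue"
    and "\<And>i \<phi> G. test_gradient \<phi> G \<Longrightarrow> integrable lebesgue (\<lambda>x. u x * G x $ i)"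
    and "\<And>i \<phi> G. test_gradient \<phi> G \<Longrightarrow> integrable lebesgue (\<lambda>x. g x $ i * \<phi> x)"
    and "\<And>i \<phi> G. test_gradient \<phi> G \<Longrightarrow> (\<integral>x. u x * G x $ i \<partial>lebesgue) = - (\<integral>x. g x $ i * \<phi> x \<partial>lebesgue)"
  shows "weak_grad u g"
  unfolding weak_grad_def
proof (intro conjI assms(1) allI impI)
  fix i and \<phi> :: "real^'n \<Rightarrow> real" assume "test_fun \<phi>"
  then obtain G where G: "test_gradient \<phi> G" by (rule test_fun_imp_test_gradient)
  have partial: "frechet_derivative \<phi> (at x) (axis i 1) = G x $ i" for x
    by (rule GDERIV_imp_frechet_derivative_axis[OF C1_gradientD(1)[OF test_gradientD(1)[OF G]]])
  show "integrable lebesgue (\<lambda>x. u x * frechet_derivative \<phi> (at x) (axis i 1))"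
    and "integrable lebesgue (\<lambda>x. g x $ i * \<phi> x)"
    and "(\<integral>x. u x * frechet_derivative \<phi> (at x) (axis i 1) \<partial>lebesgue) = - (\<integral>x. g x $ i * \<phi> x \<partial>lebesgue)"
    unfolding partial using assms(2-4)[OF G] by auto
qed

lemma weak_gradD:
  assumes "weak_grad u g" "test_gradient \<phi> G"
  shows "integrable lebesgue (\<lambda>x. u x * G x $ i)"
    and "integrable lebesgue (\<lambda>x. g x $ i * \<phi> x)"
    and "(\<integral>x. u x * G x $ i \<partial>lebesgue) = - (\<integral>x. g x $ i * \<phi> x \<partial>lebesgue)"
  using assms(1)[unfolded weak_grad_def, THEN conjunct2, rule_format,
      OF test_gradient_imp_test_fun[OF assms(2)], where i=i]
  unfolding GDERIV_imp_frechet_derivative_axis[OF C1_gradientD(1)[OF test_gradientD(1)[OF assms(2)]]]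
  by simp_all

lemma weak_grad_measurable: "weak_grad u g \<Longrightarrow> g \<in> borel_measurable lebesgue"
  by (simp add: weak_grad_def)

lemma C1_gradient_imp_weak_grad:
  fixes \<phi> :: "real^'n \<Rightarrow> real"
  assumes \<phi>: "C1_gradient \<phi> G"
  shows "weak_grad \<phi> G"
proof (rule weak_gradI)
  show "G \<in> borel_measurable lebesgue" using C1_gradientD(2)[OF \<phi>] by (rule borel_measurable_lebesgue_continuous)
  fix i and \<psi> :: "real^'n \<Rightarrow> real" and H assume \<psi>: "test_gradient \<psi> H"
  show \<phi>H: "integrable lebesgue (\<lambda>x. \<phi> x * H x $ i)"
  proof (rule integrable_continuous_bounded_support(2))
    show "continuous_on UNIV (\<lambda>x. \<phi> x * H x $ i)"
      using C1_gradientD(3)[OF \<phi>] test_gradientD(2)[OF \<psi>] by (intro continuous_intros)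
    show "bounded {x. \<phi> x * H x $ i \<noteq> 0}"
      by (rule bounded_subset[OF test_gradient_bounded_support[OF \<psi>]]) auto
  qed
  show G\<psi>: "integrable lebesgue (\<lambda>x. G x $ i * \<psi> x)"
  proof (rule integrable_continuous_bounded_support(2))
    show "continuous_on UNIV (\<lambda>x. G x $ i * \<psi> x)"
      using C1_gradientD(2)[OF \<phi>] test_gradientD(3)[OF \<psi>] by (intro continuous_intros)
    show "bounded {x. G x $ i * \<psi> x \<noteq> 0}"
      by (rule bounded_subset[OF test_gradientD(4)[OF \<psi>]]) auto
  qed
  have "(\<integral>x. axis i 1 \<bullet> (\<psi> x *\<^sub>R G x + \<phi> x *\<^sub>R H x) \<partial>lebesgue) = 0"
    by (rule integral_gradient_eq_0[OF test_gradient_mult[OF \<psi> \<phi>]])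
  then have "(\<integral>x. G x $ i * \<psi> x \<partial>lebesgue) + (\<integral>x. \<phi> x * H x $ i \<partial>lebesgue) = 0"
    using \<phi>H G\<psi> by (simp add: inner_axis' mult.commute[of "\<psi> _"])
  then show "(\<integral>x. \<phi> x * H x $ i \<partial>lebesgue) = - (\<integral>x. G x $ i * \<psi> x \<partial>lebesgue)" by linarith
qed

lemma weak_grad_add_scaleR:
  fixes u h :: "real^'n \<Rightarrow> real"
  assumes "weak_grad u g" "weak_grad h k"
  shows "weak_grad (\<lambda>x. u x + c * h x) (\<lambda>x. g x + c *\<^sub>R k x)"
proof (rule weak_gradI)
  show "(\<lambda>x. g x + c *\<^sub>R k x) \<in> borel_measurable lebesgue"
    using assms[THEN weak_grad_measurable] by auto
  fix i :: 'n and \<phi> :: "real^'n \<Rightarrow> real" and G assume \<phi>: "test_gradient \<phi> G"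
  have split: "(u x + c * h x) * G x $ i = u x * G x $ i + c * (h x * G x $ i)"
    "(g x + c *\<^sub>R k x) $ i * \<phi> x = g x $ i * \<phi> x + c * (k x $ i * \<phi> x)" for x
    by (simp_all add: algebra_simps)
  note [simp] = weak_gradD[OF assms(1) \<phi>] weak_gradD(1,2)[OF assms(2) \<phi>]
  show "integrable lebesgue (\<lambda>x. (u x + c * h x) * G x $ i)"
    "integrable lebesgue (\<lambda>x. (g x + c *\<^sub>R k x) $ i * \<phi> x)"
    "(\<integral>x. (u x + c * h x) * G x $ i \<partial>lebesgue) = - (\<integral>x. (g x + c *\<^sub>R k x) $ i * \<phi> x \<partial>lebesgue)"
    unfolding split using weak_gradD(3)[OF assms(2) \<phi>, of i] by simp_all
qed

proposition weak_grad_unique: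
  assumes "weak_grad u g" "weak_grad u h"
  shows "AE x in lebesgue. g x = h x"
proof -
  have "AE x in lebesgue. g x $ i - h x $ i = 0" for i
  proof (rule fundamental_lemma_test_gradient)
    fix \<phi> :: "real^'a \<Rightarrow> real" and G assume \<phi>: "test_gradient \<phi> G"
    note g = weak_gradD[OF assms(1) \<phi>, where i=i] and h = weak_gradD[OF assms(2) \<phi>, where i=i]
    show "integrable lebesgue (\<lambda>x. (g x $ i - h x $ i) * \<phi> x)"
      using g(2) h(2) by (simp add: left_diff_distrib)
    show "(\<integral>x. (g x $ i - h x $ i) * \<phi> x \<partial>lebesgue) = 0"
      using g h by (simp add: left_diff_distrib)
  qed
  then have "AE x in lebesgue. \<forall>i. g x $ i = h x $ i" by (simp add: AE_all_countable)
  then show ?thesis by (simp add: vec_eq_iff)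
qed

section \<open>Integration of radial functions\<close>

lemma AE_norm_neq: "AE x::'a::euclidean_space in lebesgue. norm x \<noteq> r"
proof -
  have "sphere (0::'a) r \<in> null_sets lebesgue" using negligible_sphere negligible_iff_null_sets by blast
  then have "AE x::'a in lebesgue. x \<notin> sphere 0 r" by (rule AE_not_in)
  then show ?thesis by simp
qed

lemma AE_neq_0: "AE x::'a::euclidean_space in lebesgue. x \<noteq> 0"
  using AE_norm_neq[of 0] by simp

lemma borel_measurable_radial:
  fixes V :: "real \<Rightarrow> real"
  assumes "continuous_on {0<..} V"
  shows "(\<lambda>x::'a::euclidean_space. V (norm x)) \<in> borel_measurable borel"
proof (rule borel_measurable_continuous_countable_exceptions[of "{0}"])
  show "continuous_on (- {0::'a}) (\<lambda>x. V (norm x))"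
    by (rule continuous_on_compose2[OF assms]) (auto intro!: continuous_intros)
qed auto

definition unit_sphere_area :: "nat \<Rightarrow> real" where
  "unit_sphere_area n = real n * unit_ball_vol (real n)"

definition radial_density :: "nat \<Rightarrow> real \<Rightarrow> real" where
  "radial_density n r = indicator {0..} r * (unit_sphere_area n * r ^ (n - 1))"

lemma unit_sphere_area_pos: "n > 0 \<Longrightarrow> unit_sphere_area n > 0"
  by (simp add: unit_sphere_area_def)

lemma unit_sphere_area_nonneg: "unit_sphere_area n \<ge> 0"
  by (simp add: unit_sphere_area_def)

lemma radial_density_nonneg: "radial_density n r \<ge> 0"
  by (auto simp: radial_density_def indicator_def unit_sphere_area_nonneg)

lemma radial_density_measurable [measurable]: "radial_density n \<in> borel_measurable borel"
  unfolding radial_density_def[abs_def] by measurable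

lemma nn_integral_radial_density_atMost:
  assumes "n > 0"
  shows "(\<integral>\<^sup>+s. ennreal (radial_density n s) * indicator {..r} s \<partial>lborel)
    = (if r < 0 then 0 else ennreal (unit_ball_vol (real n) * r ^ n))"
proof -
  have "(\<integral>\<^sup>+s. ennreal (radial_density n s) * indicator {..r} s \<partial>lborel)
      = (\<integral>\<^sup>+s. ennreal (unit_sphere_area n * s ^ (n - 1)) * indicator {0..r} s \<partial>lborel)"
    by (intro nn_integral_cong) (auto simp: indicator_def radial_density_def)
  also have "\<dots> = (if r < 0 then 0 else ennreal (unit_ball_vol (real n) * r ^ n))"
  proof (cases "r < 0")
    case False
    have "(\<integral>\<^sup>+s. ennreal (unit_sphere_area n * s ^ (n - 1)) * indicator {0..r} s \<partial>lborel)
        = ennreal (unit_ball_vol (real n) * r ^ n - unit_ball_vol (real n) * 0 ^ n)"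
    proof (rule nn_integral_FTC_Icc)
      show "((\<lambda>r. unit_ball_vol (real n) * r ^ n) has_real_derivative unit_sphere_area n * s ^ (n - 1)) (at s)" for s
        by (auto intro!: derivative_eq_intros simp: unit_sphere_area_def)
    qed (use False unit_sphere_area_nonneg in auto)
    then show ?thesis using False assms by simp
  qed simp
  finally show ?thesis .
qed

proposition distr_norm_lborel:
  "distr lborel borel (norm :: 'a::euclidean_space \<Rightarrow> real) =
    density lborel (\<lambda>r. ennreal (radial_density DIM('a) r))" (is "?M = ?D")
proof (rule measure_eqI_generator_eq)
  show "Int_stable (range (\<lambda>a::real. {..a}))"
    by (auto simp: Int_stable_def)
  show "sets ?M = sigma_sets UNIV (range (\<lambda>a::real. {..a}))"
    "sets ?D = sigma_sets UNIV (range (\<lambda>a::real. {..a}))"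
    by (auto simp: borel_eq_atMost)
  show "(\<Union>i::nat. {..real i}) = UNIV" by (auto intro: real_arch_simple)
  have ball: "emeasure ?M {..r} = (if r < 0 then 0 else ennreal (unit_ball_vol (real DIM('a)) * r ^ DIM('a)))" for r
  proof -
    have "emeasure ?M {..r} = emeasure lborel (cball (0::'a) r)"
      by (subst emeasure_distr) (auto intro!: arg_cong2[where f=emeasure])
    then show ?thesis by (auto simp: emeasure_cball)
  qed
  then show "emeasure ?M {..real i} \<noteq> \<infinity>" for i :: nat by simp
  fix X assume "X \<in> range (\<lambda>a::real. {..a})"
  then obtain r where X: "X = {..r}" by blast
  have "emeasure ?D X = (\<integral>\<^sup>+s. ennreal (radial_density DIM('a) s) * indicator {..r} s \<partial>lborel)"
    unfolding X by (rule emeasure_density) auto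
  then show "emeasure ?M X = emeasure ?D X" by (simp add: X ball nn_integral_radial_density_atMost)
qed auto

lemma nn_integral_radial:
  fixes p :: "real \<Rightarrow> ennreal"
  assumes [measurable]: "p \<in> borel_measurable borel"
  shows "(\<integral>\<^sup>+x. p (norm (x::'a::euclidean_space)) \<partial>lborel)
    = (\<integral>\<^sup>+r. ennreal (radial_density DIM('a) r) * p r \<partial>lborel)"
proof -
  have "(\<integral>\<^sup>+x. p (norm (x::'a)) \<partial>lborel) = (\<integral>\<^sup>+r. p r \<partial>distr lborel borel (norm :: 'a \<Rightarrow> real))"
    by (rule nn_integral_distr[symmetric]) auto
  then show ?thesis by (simp add: distr_norm_lborel nn_integral_density)
qed

lemma integrable_radial_iff:
  fixes p :: "real \<Rightarrow> real"
  assumes [measurable]: "p \<in> borel_measurable borel"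
  shows "integrable lborel (\<lambda>x::'a::euclidean_space. p (norm x))
    \<longleftrightarrow> integrable lborel (\<lambda>r. radial_density DIM('a) r * p r)"
proof -
  have "integrable lborel (\<lambda>x::'a. p (norm x)) \<longleftrightarrow> integrable (distr lborel borel (norm :: 'a \<Rightarrow> real)) p"
    by (rule integrable_distr_eq[symmetric]) auto
  then show ?thesis by (simp add: distr_norm_lborel integrable_density radial_density_nonneg)
qed

lemma integral_radial:
  fixes p :: "real \<Rightarrow> real"
  assumes [measurable]: "p \<in> borel_measurable borel"
  shows "(\<integral>x. p (norm (x::'a::euclidean_space)) \<partial>lborel) = (\<integral>r. radial_density DIM('a) r * p r \<partial>lborel)"
proof -
  have "(\<integral>x. p (norm (x::'a)) \<partial>lborel) = (\<integral>r. p r \<partial>distr lborel borel (norm :: 'a \<Rightarrow> real))"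
    by (rule integral_distr[symmetric]) auto
  then show ?thesis by (simp add: distr_norm_lborel integral_density radial_density_nonneg)
qed

lemma AE_radial:
  assumes "AE s in lebesgue. 0 < s \<longrightarrow> P s"
  shows "AE x::'a::euclidean_space in lebesgue. x \<noteq> 0 \<longrightarrow> P (norm x)"
proof -
  have "AE s in lborel. 0 < s \<longrightarrow> P s" using assms by (simp add: AE_completion_iff)
  then obtain N where N: "N \<in> null_sets lborel" "{s. \<not> (0 < s \<longrightarrow> P s)} \<subseteq> N"
    by (auto simp: eventually_ae_filter)
  have "AE s in distr lborel borel (norm :: 'a \<Rightarrow> real). s \<notin> N"
    unfolding distr_norm_lborel using AE_not_in[OF N(1)] by (subst AE_density) auto
  then have "AE x::'a in lborel. norm x \<notin> N"
    using N(1) by (subst (asm) AE_distr_iff) auto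
  then have "AE x::'a in lebesgue. norm x \<notin> N" by (rule AE_completion)
  then show ?thesis
  proof eventually_elim
    case (elim x)
    then show ?case using N(2) by (cases "x = 0") (auto dest!: subsetD[of _ _ "norm x"])
  qed
qed

lemma nn_integral_norm_powr:
  assumes [measurable]: "A \<in> sets borel"
  shows "(\<integral>\<^sup>+x. ennreal (indicator A (norm (x::'a::euclidean_space)) * norm x powr e) \<partial>lborel)
    = ennreal (unit_sphere_area DIM('a)) *
      (\<integral>\<^sup>+s. ennreal (indicator (A \<inter> {0..}) s * s powr (e + real DIM('a) - 1)) \<partial>lborel)"
proof -
  have weight: "radial_density DIM('a) s * (indicator A s * s powr e)
      = unit_sphere_area DIM('a) * (indicator (A \<inter> {0..}) s * s powr (e + real DIM('a) - 1))" for s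
  proof (cases "s > 0")
    case True
    then have "s ^ (DIM('a) - 1) * s powr e = s powr (real (DIM('a) - 1)) * s powr e"
      by (subst powr_realpow) auto
    also have "\<dots> = s powr (e + real DIM('a) - 1)" by (simp add: powr_add[symmetric] of_nat_diff algebra_simps)
    finally show ?thesis using True by (simp add: radial_density_def indicator_def)
  qed (auto simp: radial_density_def indicator_def)
  have "(\<integral>\<^sup>+x. ennreal (indicator A (norm (x::'a)) * norm x powr e) \<partial>lborel)
      = (\<integral>\<^sup>+s. ennreal (radial_density DIM('a) s) * ennreal (indicator A s * s powr e) \<partial>lborel)"
    by (rule nn_integral_radial) measurable
  also have "\<dots> = (\<integral>\<^sup>+s. ennreal (unit_sphere_area DIM('a)) *
      ennreal (indicator (A \<inter> {0..}) s * s powr (e + real DIM('a) - 1)) \<partial>lborel)"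
    by (simp add: ennreal_mult[symmetric] radial_density_nonneg unit_sphere_area_nonneg weight)
  also have "\<dots> = ennreal (unit_sphere_area DIM('a)) *
      (\<integral>\<^sup>+s. ennreal (indicator (A \<inter> {0..}) s * s powr (e + real DIM('a) - 1)) \<partial>lborel)"
    by (rule nn_integral_cmult) measurable
  finally show ?thesis .
qed

lemma nn_integral_norm_powr_outside:
  assumes e: "e < - real DIM('a::euclidean_space)" and r_pos: "r > 0"
  shows "(\<integral>\<^sup>+x. ennreal (indicator {r<..} (norm (x::'a)) * norm x powr e) \<partial>lborel)
    = ennreal (unit_sphere_area DIM('a) / - (e + real DIM('a)) * r powr (e + real DIM('a)))"
proof -
  let ?e = "e + real DIM('a) - 1"
  have "(\<integral>\<^sup>+s. ennreal (indicator ({r<..} \<inter> {0..}) s * s powr ?e) \<partial>lborel)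
      = (\<integral>\<^sup>+s. ennreal (indicator {r..} s * s powr ?e) \<partial>lborel)"
    by (rule nn_integral_cong_AE) (use AE_lborel_singleton[of r] r_pos in \<open>auto simp: indicator_def elim!: eventually_mono\<close>)
  also have "\<dots> = ennreal (- (r powr (?e + 1)) / (?e + 1))"
    by (rule nn_integral_has_integral_lebesgue[OF _ has_integral_powr_to_inf]) (use e r_pos in auto)
  also have "- (r powr (?e + 1)) / (?e + 1) = r powr (e + real DIM('a)) / - (e + real DIM('a))"
    by (simp only: diff_add_cancel minus_divide_left[symmetric] minus_divide_right)
  finally have "(\<integral>\<^sup>+s. ennreal (indicator ({r<..} \<inter> {0..}) s * s powr ?e) \<partial>lborel)
      = ennreal (r powr (e + real DIM('a)) / - (e + real DIM('a)))" .
  then show ?thesis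
    using e by (subst nn_integral_norm_powr)
      (auto simp: ennreal_mult[symmetric] unit_sphere_area_nonneg divide_nonneg_neg divide_nonpos_neg)
qed

lemma nn_integral_norm_powr_inside:
  assumes e: "e > - real DIM('a::euclidean_space)" and r_nonneg: "r \<ge> 0"
  shows "(\<integral>\<^sup>+x. ennreal (indicator {..r} (norm (x::'a)) * norm x powr e) \<partial>lborel)
    = ennreal (unit_sphere_area DIM('a) / (e + real DIM('a)) * r powr (e + real DIM('a)))"
proof -
  let ?e = "e + real DIM('a) - 1"
  have "{..r} \<inter> {0..} = {0..r}" by auto
  then have "(\<integral>\<^sup>+s. ennreal (indicator ({..r} \<inter> {0..}) s * s powr ?e) \<partial>lborel) = ennreal (r powr (?e + 1) / (?e + 1))"
    by (simp only:) (rule nn_integral_has_integral_lebesgue[OF _ has_integral_powr_from_0]; use e r_nonneg in auto)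
  then show ?thesis
    using e by (subst nn_integral_norm_powr) (auto simp: ennreal_mult[symmetric] unit_sphere_area_nonneg)
qed

lemma has_bochner_integral_norm_powr_outside:
  assumes e: "e < - real DIM('a::euclidean_space)" and r_pos: "r > 0"
  shows "has_bochner_integral lebesgue (\<lambda>x::'a. indicator {r<..} (norm x) * norm x powr e)
    (unit_sphere_area DIM('a) / - (e + real DIM('a)) * r powr (e + real DIM('a)))"
proof -
  have "has_bochner_integral lborel (\<lambda>x::'a. indicator {r<..} (norm x) * norm x powr e)
      (unit_sphere_area DIM('a) / - (e + real DIM('a)) * r powr (e + real DIM('a)))"
    by (rule has_bochner_integral_nn_integral[OF _ _ _ nn_integral_norm_powr_outside[OF assms]])
      (use e in \<open>auto intro!: mult_nonneg_nonneg divide_nonneg_neg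
        simp: divide_nonpos_pos divide_nonneg_nonneg unit_sphere_area_nonneg\<close>)
  then show ?thesis
    by (simp add: has_bochner_integral_iff integrable_completionI integral_completion)
qed

lemma indicator_greaterThanAtMost_mult:
  fixes t p :: real
  assumes "r \<le> s"
  shows "indicator {r<..s} t * p = indicator {r<..} t * p - indicator {s<..} t * p"
  using assms by (auto simp: indicator_def)

lemma has_bochner_integral_norm_powr_shell:
  assumes e: "e < - real DIM('a::euclidean_space)" and r: "0 < r" "r \<le> s"
  shows "has_bochner_integral lebesgue (\<lambda>x::'a. indicator {r<..s} (norm x) * norm x powr e)
    (unit_sphere_area DIM('a) / - (e + real DIM('a)) * (r powr (e + real DIM('a)) - s powr (e + real DIM('a))))"
  unfolding indicator_greaterThanAtMost_mult[OF r(2)] right_diff_distrib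
  using r by (intro has_bochner_integral_diff has_bochner_integral_norm_powr_outside[OF e]) auto

lemma integrable_norm_powr_inside:
  assumes e: "e > - real DIM('a::euclidean_space)"
  shows "integrable lebesgue (\<lambda>x::'a. indicator {..r} (norm x) * norm x powr e)"
proof (rule integrable_completionI, cases "r \<ge> 0")
  case True
  show "integrable lborel (\<lambda>x::'a. indicator {..r} (norm x) * norm x powr e)"
    by (rule integrableI_nonneg) (auto simp: nn_integral_norm_powr_inside[OF e True])
next
  case False
  then have "indicator {..r} (norm x) = (0::real)" for x :: 'a
    using norm_ge_zero[of x] by (auto simp: indicator_def simp del: norm_ge_zero)
  then show "integrable lborel (\<lambda>x::'a. indicator {..r} (norm x) * norm x powr e)" by simp
qed

lemma null_sets_distr_norm:
  assumes "A \<in> sets borel" "negligible {x::'a::euclidean_space. norm x \<in> A}"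
  shows "A \<in> null_sets (distr lborel borel (norm :: 'a \<Rightarrow> real))"
proof -
  have "{x::'a. norm x \<in> A} \<in> sets lborel"
    using assms(1) measurable_sets[of norm "borel :: 'a measure" borel A] by (auto simp: vimage_def)
  then have "emeasure lborel {x::'a. norm x \<in> A} = 0"
    using assms(2) by (simp add: negligible_iff_null_sets null_sets_completion_iff null_setsD1)
  moreover have "emeasure (distr lborel borel (norm :: 'a \<Rightarrow> real)) A = emeasure lborel {x::'a. norm x \<in> A}"
    using assms(1) by (subst emeasure_distr) (auto intro!: arg_cong2[where f=emeasure])
  ultimately show ?thesis using assms(1) by (auto intro: null_setsI)
qed

text \<open>The norm maps closed sets to \<open>F\<^sub>\<sigma>\<close> sets; this pushes measurability of a preimage under the norm
  down to the line.\<close>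

lemma norm_vimage_inner_borel:
  assumes A: "{x::'a::euclidean_space. norm x \<in> A} \<in> sets lebesgue"
  obtains B where "B \<in> sets borel" "B \<subseteq> A" "negligible {x::'a. norm x \<in> A - B}"
proof -
  obtain C T where CT: "fsigma C" "T \<in> null_sets lebesgue" "C \<union> T = {x::'a. norm x \<in> A}" "disjnt C T"
    by (rule lebesgue_set_almost_fsigma[OF A])
  obtain F :: "nat \<Rightarrow> 'a set" where F: "\<And>n. closed (F n)" "C = (\<Union>n. F n)"
    using CT(1) unfolding fsigma.simps by auto
  have image: "norm ` C = (\<Union>n. \<Union>k. norm ` (F n \<inter> cball 0 (real k)))"
  proof -
    have "F n = (\<Union>k. F n \<inter> cball 0 (real k))" for n by (auto intro: real_arch_simple)
    then show ?thesis using F(2) by (metis (no_types, lifting) SUP_cong image_UN)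
  qed
  show ?thesis
  proof
    have "closed (norm ` (F n \<inter> cball 0 (real k)))" for n k
      by (intro compact_imp_closed compact_continuous_image continuous_intros closed_Int_compact F compact_cball)
    then show "norm ` C \<in> sets borel" unfolding image by (intro sets.countable_UN' borel_closed) auto
    show "norm ` C \<subseteq> A" using CT(3) by auto
    have "{x::'a. norm x \<in> A - norm ` C} \<subseteq> T" using CT(3) by auto
    then show "negligible {x::'a. norm x \<in> A - norm ` C}"
      using CT(2) negligible_subset negligible_iff_null_sets by blast
  qed
qed

lemma norm_vimage_lebesgue_imp_sets_completion:
  assumes A: "{x::'a::euclidean_space. norm x \<in> A} \<in> sets lebesgue"
  shows "A \<in> sets (completion (distr lborel borel (norm :: 'a \<Rightarrow> real)))" (is "_ \<in> sets (completion ?M)")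
proof -
  obtain B where B: "B \<in> sets borel" "B \<subseteq> A" "negligible {x::'a. norm x \<in> A - B}"
    using norm_vimage_inner_borel[OF A] by blast
  have "{x::'a. norm x \<in> - A} = UNIV - {x. norm x \<in> A}" by auto
  then have "{x::'a. norm x \<in> - A} \<in> sets lebesgue" using sets.compl_sets[OF A] by simp
  then obtain C where C: "C \<in> sets borel" "C \<subseteq> - A" "negligible {x::'a. norm x \<in> - A - C}"
    using norm_vimage_inner_borel by blast
  have "negligible {x::'a. norm x \<in> - C - B}"
    by (rule negligible_subset[OF negligible_Un[OF B(3) C(3)]]) auto
  then have "- C - B \<in> null_sets ?M"
    using B(1) C(1) by (intro null_sets_distr_norm) auto
  then show ?thesis
    using B(1,2) C(2) by (intro sets_completionI[of A B "A - B" "- C - B"]) auto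
qed

proposition radial_function_borel_profile:
  fixes u :: "'a::euclidean_space \<Rightarrow> real"
  assumes u: "u \<in> borel_measurable lebesgue" and v: "AE x in lebesgue. u x = v (norm x)"
  obtains w where "w \<in> borel_measurable borel" "AE x in lebesgue. u x = w (norm x)"
proof -
  define M where "M = distr lborel borel (norm :: 'a \<Rightarrow> real)"
  have M: "sets M = sets borel" "space M = UNIV" by (auto simp: M_def)
  have "(\<lambda>x. v (norm x)) \<in> borel_measurable (lebesgue :: 'a measure)" by (rule borel_measurable_AE[OF u v])
  then have "{x::'a. norm x \<in> {r. y < v r}} \<in> sets lebesgue" for y
    using borel_measurable_less[OF borel_measurable_const, of "\<lambda>x::'a. v (norm x)" lebesgue y] by simp
  then have "{r. y < v r} \<in> sets (completion M)" for y
    unfolding M_def by (rule norm_vimage_lebesgue_imp_sets_completion)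
  then have "v \<in> borel_measurable (completion M)"
    by (intro borel_measurableI_greater) (simp add: M(2))
  then obtain w where w: "w \<in> borel_measurable M" "AE r in M. v r = w r"
    using completion_ex_borel_measurable_real by blast
  obtain N where N: "N \<in> null_sets M" "{r. v r \<noteq> w r} \<subseteq> N" using w(2) by (auto simp: eventually_ae_filter M)
  have "AE r in M. r \<notin> N" using N(1) by (rule AE_not_in)
  then have "AE x::'a in lborel. norm x \<notin> N"
    unfolding M_def using N(1) by (subst (asm) AE_distr_iff) (auto simp: M)
  then have "AE x::'a in lebesgue. norm x \<notin> N" by (rule AE_completion)
  with v have "AE x in lebesgue. u x = w (norm x)" by eventually_elim (use N(2) in auto)
  moreover have "w \<in> borel_measurable borel" using w(1) by (simp add: measurable_cong_sets[OF M(1)])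
  ultimately show ?thesis using that by blast
qed

section \<open>Flux and profile of a square-integrable field\<close>

text \<open>The field \<open>x / |x| ^ n\<close> is divergence free away from the origin, so the profile of a radial
  function is recovered from its gradient by integrating the flux.\<close>

definition flux :: "('a::euclidean_space \<Rightarrow> 'a) \<Rightarrow> 'a \<Rightarrow> real" where
  "flux g x = (g x \<bullet> x) / norm x ^ DIM('a)"

definition profile :: "('a::euclidean_space \<Rightarrow> 'a) \<Rightarrow> real \<Rightarrow> real" where
  "profile g r = - (\<integral>x. indicator {r<..} (norm x) * flux g x \<partial>lebesgue) / unit_sphere_area DIM('a)"

definition profile_const :: "nat \<Rightarrow> real" where
  "profile_const n = 1 / sqrt (unit_sphere_area n * (real n - 2))"

lemma profile_const_nonneg: "n \<ge> 3 \<Longrightarrow> profile_const n \<ge> 0"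
  by (simp add: profile_const_def unit_sphere_area_nonneg)

lemma flux_measurable:
  fixes g :: "'a::euclidean_space \<Rightarrow> 'a"
  assumes "g \<in> borel_measurable lebesgue"
  shows "flux g \<in> borel_measurable lebesgue"
proof -
  have "(\<lambda>x::'a. x) \<in> borel_measurable lebesgue" "(\<lambda>x::'a. norm x) \<in> borel_measurable lebesgue"
    by (auto intro!: measurable_completion)
  then show ?thesis unfolding flux_def[abs_def]
    using assms by (intro borel_measurable_divide borel_measurable_inner borel_measurable_power)
qed

lemma abs_flux_le: "\<bar>flux g x\<bar> \<le> norm (g x) * norm x powr (1 - real DIM('a))" for g :: "'a::euclidean_space \<Rightarrow> 'a"
proof (cases "x = 0")
  case False
  have "\<bar>flux g x\<bar> \<le> norm (g x) * norm x / norm x ^ DIM('a)"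
    using Cauchy_Schwarz_ineq2[of "g x" x] by (simp add: flux_def abs_divide divide_right_mono)
  also have "\<dots> = norm (g x) * (norm x / norm x ^ DIM('a))" by simp
  also have "norm x / norm x ^ DIM('a) = norm x powr (1 - real DIM('a))"
    using False by (simp add: powr_diff powr_realpow)
  finally show ?thesis .
qed (simp add: flux_def)

lemma flux_integral_bound:
  fixes g :: "'a::euclidean_space \<Rightarrow> 'a"
  assumes g: "square_integrable lebesgue g" and A: "A \<in> sets borel"
    and I: "has_bochner_integral lebesgue (\<lambda>x::'a. indicator A (norm x) * norm x powr (2 - 2 * real DIM('a))) I"
  shows "integrable lebesgue (\<lambda>x. indicator A (norm x) * flux g x)"
    and "\<bar>\<integral>x. indicator A (norm x) * flux g x \<partial>lebesgue\<bar> \<le> L2_norm lebesgue g * sqrt I"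
proof -
  define h where "h x = (indicator A (norm x) * norm x powr (1 - real DIM('a)) :: real)" for x :: 'a
  have h_power2: "(norm (h x))\<^sup>2 = indicator A (norm x) * norm x powr (2 - 2 * real DIM('a))" for x
    by (auto simp: h_def indicator_def power2_eq_square powr_add[symmetric])
  have "h \<in> borel_measurable lebesgue" unfolding h_def using A by (intro measurable_completion) auto
  then have h: "square_integrable lebesgue h"
    using I unfolding square_integrable_def h_power2 by (simp add: has_bochner_integral_iff)
  have h_norm: "L2_norm lebesgue h = sqrt I"
    using I unfolding L2_norm_def h_power2 by (simp add: has_bochner_integral_iff)
  have meas: "(\<lambda>x. indicator A (norm x) * flux g x) \<in> borel_measurable lebesgue"
    by (intro borel_measurable_times borel_measurable_lebesgue_indicator_norm[OF A]
        flux_measurable square_integrableD(1)[OF g])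
  have bound: "AE x in lebesgue. \<bar>indicator A (norm x) * flux g x\<bar> \<le> norm (g x) * norm (h x)"
    by (rule AE_I2) (use abs_flux_le[of g] in \<open>auto simp: h_def indicator_def abs_mult\<close>)
  show "integrable lebesgue (\<lambda>x. indicator A (norm x) * flux g x)"
    and "\<bar>\<integral>x. indicator A (norm x) * flux g x \<partial>lebesgue\<bar> \<le> L2_norm lebesgue g * sqrt I"
    using integrable_if_le_norm_mult_norm[OF g h meas bound] h_norm by simp_all
qed

lemma sqrt_unit_sphere_area_eq_profile_const:
  "c * sqrt (unit_sphere_area n / (real n - 2) * t) / unit_sphere_area n = profile_const n * c * sqrt t"
proof -
  define m where "m = real n - 2"
  have "sqrt (unit_sphere_area n) / unit_sphere_area n = 1 / sqrt (unit_sphere_area n)"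
    by (simp add: sqrt_divide_self_eq unit_sphere_area_nonneg inverse_eq_divide)
  then have "c * (sqrt (unit_sphere_area n) / unit_sphere_area n) * (sqrt t / sqrt m) = profile_const n * c * sqrt t"
    by (simp add: profile_const_def m_def real_sqrt_mult)
  then show ?thesis by (simp add: m_def real_sqrt_mult real_sqrt_divide mult_ac)
qed

context
  fixes g :: "'a::euclidean_space \<Rightarrow> 'a"
  assumes dim: "DIM('a) \<ge> 3" and g: "square_integrable lebesgue g"
begin

lemma flux_outside_integrable:
  assumes "r > 0"
  shows "integrable lebesgue (\<lambda>x. indicator {r<..} (norm x) * flux g x)"
  by (rule flux_integral_bound(1)[OF g _ has_bochner_integral_norm_powr_outside]) (use dim assms in auto)

lemma profile_bound:
  assumes r_pos: "r > 0"
  shows "\<bar>profile g r\<bar> \<le> profile_const DIM('a) * L2_norm lebesgue g * sqrt (r powr (2 - real DIM('a)))"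
proof -
  have "\<bar>\<integral>x. indicator {r<..} (norm x) * flux g x \<partial>lebesgue\<bar>
      \<le> L2_norm lebesgue g * sqrt (unit_sphere_area DIM('a) / (real DIM('a) - 2) * r powr (2 - real DIM('a)))"
    using flux_integral_bound(2)[OF g _ has_bochner_integral_norm_powr_outside[where e="2 - 2 * real DIM('a)", OF _ r_pos]] dim
    by simp
  from divide_right_mono[OF this unit_sphere_area_nonneg[of "DIM('a)"]] show ?thesis
    unfolding sqrt_unit_sphere_area_eq_profile_const
    using unit_sphere_area_nonneg[of "DIM('a)"] by (simp add: profile_def abs_divide)
qed

lemma profile_diff_bound:
  assumes "r > 0" "s > 0"
  shows "\<bar>profile g s - profile g r\<bar> \<le> profile_const DIM('a) * L2_norm lebesgue g *
    sqrt \<bar>s powr (2 - real DIM('a)) - r powr (2 - real DIM('a))\<bar>"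
  using assms
proof (induction r s rule: linorder_wlog)
  case (le r s)
  let ?\<tau> = "\<lambda>r. r powr (2 - real DIM('a))" and ?\<Phi> = "\<lambda>A. \<integral>x. indicator A (norm x) * flux g x \<partial>lebesgue"
  have "?\<Phi> {r<..s} = ?\<Phi> {r<..} - ?\<Phi> {s<..}"
    unfolding indicator_greaterThanAtMost_mult[OF le(1)] using le by (intro Bochner_Integration.integral_diff flux_outside_integrable)
  then have "\<bar>profile g s - profile g r\<bar> = \<bar>?\<Phi> {r<..s}\<bar> / unit_sphere_area DIM('a)"
    using unit_sphere_area_nonneg[of "DIM('a)"]
    by (simp add: profile_def diff_divide_distrib[symmetric] abs_divide)
  also have "\<bar>?\<Phi> {r<..s}\<bar> \<le> L2_norm lebesgue g * sqrt (unit_sphere_area DIM('a) / (real DIM('a) - 2) * (?\<tau> r - ?\<tau> s))"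
    using flux_integral_bound(2)[OF g _ has_bochner_integral_norm_powr_shell[of "2 - 2 * real DIM('a)" r s]] dim le
    by simp
  from divide_right_mono[OF this unit_sphere_area_nonneg[of "DIM('a)"]]
  have "\<bar>?\<Phi> {r<..s}\<bar> / unit_sphere_area DIM('a) \<le> profile_const DIM('a) * L2_norm lebesgue g * sqrt (?\<tau> r - ?\<tau> s)"
    unfolding sqrt_unit_sphere_area_eq_profile_const .
  also have "?\<tau> r - ?\<tau> s = \<bar>?\<tau> s - ?\<tau> r\<bar>"
    using le dim powr_mono2'[of "2 - real DIM('a)" r s] by simp
  finally show ?case .
next
  case (sym r s)
  then show ?case by (simp add: abs_minus_commute)
qed

lemma continuous_on_profile: "continuous_on {0<..} (profile g)"
  unfolding continuous_on
proof
  let ?b = "\<lambda>r s. profile_const DIM('a) * L2_norm lebesgue g * sqrt \<bar>s powr (2 - real DIM('a)) - r powr (2 - real DIM('a))\<bar>"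
  fix r :: real assume r: "r \<in> {0<..}"
  have "((\<lambda>s. profile g s - profile g r) \<longlongrightarrow> 0) (at r within {0<..})"
  proof (rule Lim_null_comparison)
    show "\<forall>\<^sub>F s in at r within {0<..}. norm (profile g s - profile g r) \<le> ?b r s"
      using profile_diff_bound r by (auto simp: eventually_at_filter)
    have "(?b r \<longlongrightarrow> ?b r r) (at r within {0<..})" using r by (intro tendsto_intros) auto
    then show "(?b r \<longlongrightarrow> 0) (at r within {0<..})" by simp
  qed
  then show "(profile g \<longlongrightarrow> profile g r) (at r within {0<..})" by (simp add: LIM_zero_iff)
qed

lemma profile_norm_measurable: "(\<lambda>x::'a. profile g (norm x)) \<in> borel_measurable borel"
  by (rule borel_measurable_radial[OF continuous_on_profile])

end

lemma profile_cong_AE: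
  fixes g h :: "'a::euclidean_space \<Rightarrow> 'a"
  assumes "AE x in lebesgue. g x = h x"
  shows "profile g = profile h"
proof
  fix r
  have "AE x in lebesgue. indicator {r<..} (norm x) * flux g x = indicator {r<..} (norm x) * flux h x"
    using assms by eventually_elim (simp add: flux_def)
  then show "profile g r = profile h r" unfolding profile_def by (simp only: lebesgue_integral_cong_AE(2))
qed

lemma convergent_if_equicontinuous_on_Rats:
  fixes f :: "nat \<Rightarrow> real \<Rightarrow> real"
  assumes conv: "\<And>q. q \<in> \<rat> \<Longrightarrow> a < q \<Longrightarrow> convergent (\<lambda>k. f k q)"
    and equicont: "\<And>e. e > 0 \<Longrightarrow> \<exists>d>0. \<forall>q. r < q \<and> q < r + d \<longrightarrow> (\<forall>k. \<bar>f k q - f k r\<bar> < e)"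
    and r: "a < r"
  shows "convergent (\<lambda>k. f k r)"
proof (rule Cauchy_convergent, rule metric_CauchyI)
  fix e :: real assume e_pos: "e > 0"
  obtain d where d: "d > 0" "\<And>q k. r < q \<Longrightarrow> q < r + d \<Longrightarrow> \<bar>f k q - f k r\<bar> < e / 3"
    using equicont[of "e / 3"] e_pos by auto
  obtain q where q: "q \<in> \<rat>" "r < q" "q < r + d" using Rats_dense_in_real[of r "r + d"] d(1) by auto
  then have "Cauchy (\<lambda>k. f k q)" using r by (intro convergent_Cauchy conv) auto
  from metric_CauchyD[OF this, of "e / 3"] obtain N where N: "\<And>i j. i \<ge> N \<Longrightarrow> j \<ge> N \<Longrightarrow> dist (f i q) (f j q) < e / 3"
    using e_pos by auto
  have "dist (f i r) (f j r) < e" if "i \<ge> N" "j \<ge> N" for i j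
    using N[OF that] d(2)[OF q(2,3), of i] d(2)[OF q(2,3), of j] unfolding dist_real_def by linarith
  then show "\<exists>N. \<forall>i\<ge>N. \<forall>j\<ge>N. dist (f i r) (f j r) < e" by blast
qed

proposition profile_convergent_subsequence:
  fixes gs :: "nat \<Rightarrow> 'a::euclidean_space \<Rightarrow> 'a"
  assumes dim: "DIM('a) \<ge> 3" and gs: "\<And>k. square_integrable lebesgue (gs k)"
    and M: "\<And>k. L2_norm lebesgue (gs k) \<le> M"
  obtains s :: "nat \<Rightarrow> nat" where "strict_mono s" "\<And>r. r > 0 \<Longrightarrow> convergent (\<lambda>j. profile (gs (s j)) r)"
proof -
  let ?\<tau> = "\<lambda>r. r powr (2 - real DIM('a))"
  define D where "D = profile_const DIM('a) * M"
  have D: "profile_const DIM('a) * L2_norm lebesgue (gs k) \<le> D" for k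
    unfolding D_def using profile_const_nonneg[OF dim] M by (intro mult_left_mono) auto
  have bound: "\<bar>profile (gs k) r\<bar> \<le> D * sqrt (?\<tau> r)" if "r > 0" for k r
    using profile_bound[OF dim gs[of k] that] mult_right_mono[OF D[of k], of "sqrt (?\<tau> r)"] by auto
  have modulus: "\<bar>profile (gs k) q - profile (gs k) r\<bar> \<le> D * sqrt \<bar>?\<tau> q - ?\<tau> r\<bar>" if "r > 0" "q > 0" for k r q
    using profile_diff_bound[OF dim gs[of k] that] mult_right_mono[OF D[of k], of "sqrt \<bar>?\<tau> q - ?\<tau> r\<bar>"] by auto
  have "countable (\<rat> \<inter> {0::real<..})" using countable_rat by (rule countable_subset[rotated]) auto
  moreover have "norm (profile (gs k) q / sqrt (?\<tau> q)) \<le> D" if "q \<in> \<rat> \<inter> {0<..}" for k q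
    using bound[of q k] that by (simp add: divide_le_eq)
  ultimately obtain s :: "nat \<Rightarrow> nat" where s: "strict_mono s"
    and s_conv: "\<And>q. q \<in> \<rat> \<inter> {0<..} \<Longrightarrow> \<exists>l. (\<lambda>j. profile (gs (s j)) q / sqrt (?\<tau> q)) \<longlonglongrightarrow> l"
    by (rule function_convergent_subsequence[where f="\<lambda>k q. profile (gs k) q / sqrt (?\<tau> q)" and M=D]) auto
  have rational: "convergent (\<lambda>j. profile (gs (s j)) q)" if q: "q \<in> \<rat>" "0 < q" for q
  proof -
    obtain l where "(\<lambda>j. profile (gs (s j)) q / sqrt (?\<tau> q)) \<longlonglongrightarrow> l" using s_conv[of q] q by auto
    from tendsto_mult_right[OF this, of "sqrt (?\<tau> q)"] show ?thesis using q by (auto simp: convergent_def)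
  qed
  have "convergent (\<lambda>j. profile (gs (s j)) r)" if r_pos: "r > 0" for r
  proof (rule convergent_if_equicontinuous_on_Rats[where a=0, OF rational _ r_pos])
    fix e :: real assume "e > 0"
    have "((\<lambda>q. D * sqrt \<bar>?\<tau> q - ?\<tau> r\<bar>) \<longlongrightarrow> D * sqrt \<bar>?\<tau> r - ?\<tau> r\<bar>) (at r)"
      using r_pos by (intro tendsto_intros) auto
    then have "\<forall>\<^sub>F q in at r. D * sqrt \<bar>?\<tau> q - ?\<tau> r\<bar> < e"
      using \<open>e > 0\<close> by (intro order_tendstoD(2)) auto
    then obtain d where d: "d > 0" "\<And>q. q \<noteq> r \<Longrightarrow> \<bar>q - r\<bar> < d \<Longrightarrow> D * sqrt \<bar>?\<tau> q - ?\<tau> r\<bar> < e"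
      by (auto simp: eventually_at dist_real_def)
    have "\<bar>profile (gs k) q - profile (gs k) r\<bar> < e" if "r < q" "q < r + d" for q k
      using modulus[OF r_pos, of q k] d(2)[of q] r_pos that by auto
    then show "\<exists>d>0. \<forall>q. r < q \<and> q < r + d \<longrightarrow> (\<forall>j. \<bar>profile (gs (s j)) q - profile (gs (s j)) r\<bar> < e)"
      using d(1) by blast
  qed
  then show ?thesis using that s by blast
qed

section \<open>The radial representation formula\<close>

lemma integral_mean_zero_interval_support:
  fixes \<eta> :: "real \<Rightarrow> real"
  assumes \<alpha>_pos: "0 < \<alpha>" and cont: "continuous_on UNIV \<eta>" and supp: "\<And>s. s \<notin> {\<alpha>..\<beta>} \<Longrightarrow> \<eta> s = 0"
    and zero: "integral {0..\<beta>} \<eta> = 0"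
  shows "r < \<alpha> \<Longrightarrow> integral {0..r} \<eta> = 0" and "r > \<beta> \<Longrightarrow> integral {0..r} \<eta> = 0"
proof -
  have vanish: "integral {a..b} \<eta> = 0" if "\<And>s. s \<in> {a<..<b} \<Longrightarrow> s \<notin> {\<alpha>..\<beta>}" for a b
  proof -
    have "integral {a..b} \<eta> = integral {a..b} (\<lambda>_. 0)"
      by (rule integral_spike[of "{a, b}"]) (use that supp in auto)
    then show ?thesis by simp
  qed
  show "integral {0..r} \<eta> = 0" if "r < \<alpha>" using that by (intro vanish) auto
  show "integral {0..r} \<eta> = 0" if r: "r > \<beta>"
  proof (cases "\<beta> \<ge> 0")
    case True
    have "\<eta> integrable_on {0..r}" using cont by (intro integrable_continuous_real continuous_on_subset[OF cont]) auto
    then have "integral {0..\<beta>} \<eta> + integral {\<beta>..r} \<eta> = integral {0..r} \<eta>"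
      using True r by (intro Henstock_Kurzweil_Integration.integral_combine) auto
    then show ?thesis using zero vanish[of \<beta> r] by simp
  next
    case False
    then show ?thesis using \<alpha>_pos by (intro vanish) auto
  qed
qed

lemma integral_from_0_has_real_derivative:
  fixes \<eta> :: "real \<Rightarrow> real"
  assumes "continuous_on UNIV \<eta>" "r > 0"
  shows "((\<lambda>r. integral {0..r} \<eta>) has_real_derivative \<eta> r) (at r)"
proof -
  have "((\<lambda>r. integral {0..r} \<eta>) has_real_derivative \<eta> r) (at r within {0..r+1})"
    by (rule integral_has_real_derivative) (use assms continuous_on_subset[OF assms(1)] in auto)
  moreover have "at r within {0..r+1} = at r" by (rule at_within_interior) (use assms(2) in auto)
  ultimately show ?thesis by simp
qed

lemma test_gradient_component_radial:
  fixes m m' :: "real \<Rightarrow> real"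
  assumes r0: "r0 > 0" "\<And>r. r < r0 \<Longrightarrow> m r = 0" and R: "\<And>r. r > R \<Longrightarrow> m r = 0"
    and der: "\<And>r. r > 0 \<Longrightarrow> (m has_real_derivative m' r) (at r)" and cont: "continuous_on {0<..} m'"
  shows "test_gradient (\<lambda>x::real^'n. m (norm x) * (x \<bullet> axis i 1))
    (\<lambda>x. m (norm x) *\<^sub>R axis i 1 + (x \<bullet> axis i 1) *\<^sub>R (m' (norm x) *\<^sub>R sgn x))"
proof (rule test_gradient_mult[OF _ C1_gradient_inner])
  have "{x::real^'n. m (norm x) \<noteq> 0} \<subseteq> cball 0 R" using R by (force simp: not_le)
  then have "bounded {x::real^'n. m (norm x) \<noteq> 0}" by (rule bounded_subset[OF bounded_cball])
  moreover have "C1_gradient (\<lambda>x::real^'n. m (norm x)) (\<lambda>x. m' (norm x) *\<^sub>R sgn x)"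
    by (rule C1_gradient_radial[OF r0 der cont])
  ultimately show "test_gradient (\<lambda>x::real^'n. m (norm x)) (\<lambda>x. m' (norm x) *\<^sub>R sgn x)"
    by (simp add: test_gradient_def)
qed

lemma weak_grad_radial_field:
  fixes u :: "real^'n \<Rightarrow> real"
  assumes wg: "weak_grad u g"
    and m: "r0 > 0" "\<And>r. r < r0 \<Longrightarrow> m r = 0" "\<And>r. r > R \<Longrightarrow> m r = 0"
      "\<And>r. r > 0 \<Longrightarrow> (m has_real_derivative m' r) (at r)" "continuous_on {0<..} m'"
  shows "(\<integral>x. u x * (real CARD('n) * m (norm x) + norm x * m' (norm x)) \<partial>lebesgue)
    = - (\<integral>x. (g x \<bullet> x) * m (norm x) \<partial>lebesgue)"
proof -
  let ?G = "\<lambda>i x. m (norm x) *\<^sub>R axis i 1 + (x \<bullet> axis i 1) *\<^sub>R (m' (norm x) *\<^sub>R sgn x) :: real^'n"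
  note by_parts = weak_gradD[OF wg test_gradient_component_radial[OF m], where i=i for i]
  have divergence: "(\<Sum>i\<in>UNIV. ?G i x $ i) = real CARD('n) * m (norm x) + norm x * m' (norm x)" for x
  proof -
    have "(\<Sum>i\<in>UNIV. ?G i x $ i) = (\<Sum>i\<in>UNIV. m (norm x) + m' (norm x) * (x $ i * sgn x $ i))"
      by (simp add: inner_axis mult_ac)
    also have "\<dots> = real CARD('n) * m (norm x) + m' (norm x) * (x \<bullet> sgn x)"
      by (simp add: sum.distrib inner_vec_def sum_distrib_left)
    also have "x \<bullet> sgn x = norm x" by (cases "x = 0") (simp_all add: sgn_div_norm power2_norm_eq_inner[symmetric] power2_eq_square)
    finally show ?thesis by simp
  qed
  have "(\<integral>x. u x * (real CARD('n) * m (norm x) + norm x * m' (norm x)) \<partial>lebesgue)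
      = (\<integral>x. (\<Sum>i\<in>UNIV. u x * ?G i x $ i) \<partial>lebesgue)"
    by (simp only: divergence[symmetric] sum_distrib_left)
  also have "\<dots> = (\<Sum>i\<in>UNIV. \<integral>x. u x * ?G i x $ i \<partial>lebesgue)"
    by (rule Bochner_Integration.integral_sum) (rule by_parts(1))
  also have "\<dots> = - (\<Sum>i\<in>UNIV. \<integral>x. g x $ i * (m (norm x) * (x \<bullet> axis i 1)) \<partial>lebesgue)"
    by (simp only: by_parts(3) sum_negf)
  also have "(\<Sum>i\<in>UNIV. \<integral>x. g x $ i * (m (norm x) * (x \<bullet> axis i 1)) \<partial>lebesgue)
      = (\<integral>x. (\<Sum>i\<in>UNIV. g x $ i * (m (norm x) * (x \<bullet> axis i 1))) \<partial>lebesgue)"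
    by (rule Bochner_Integration.integral_sum[symmetric]) (rule by_parts(2))
  also have "\<dots> = (\<integral>x. (g x \<bullet> x) * m (norm x) \<partial>lebesgue)"
    by (simp add: inner_axis inner_vec_def[of "g _"] sum_distrib_left mult_ac)
  finally show ?thesis .
qed

lemma quotient_power_has_real_derivative:
  fixes r :: real
  assumes "(\<psi> has_real_derivative \<psi>') (at r)" "r > 0" "n > 0"
  shows "((\<lambda>r. \<psi> r / r ^ n) has_real_derivative \<psi>' / r ^ n - real n * \<psi> r / r ^ (n + 1)) (at r)"
proof -
  have power_n: "r ^ n = r * r ^ (n - 1)" using assms(3) by (simp add: power_eq_if)
  have "((\<lambda>r. \<psi> r / r ^ n) has_real_derivative (\<psi>' * r ^ n - \<psi> r * (real n * r ^ (n - 1))) / (r ^ n * r ^ n)) (at r)"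
    using assms by (intro DERIV_divide) (auto intro!: derivative_eq_intros)
  also have "(\<psi>' * r ^ n - \<psi> r * (real n * r ^ (n - 1))) / (r ^ n * r ^ n) = \<psi>' / r ^ n - real n * \<psi> r / r ^ (n + 1)"
    using assms(2) by (simp add: divide_simps) (simp add: power_n algebra_simps)
  finally show ?thesis .
qed

lemma weak_grad_flux_identity:
  fixes u :: "real^'n \<Rightarrow> real"
  assumes wg: "weak_grad u g" and \<alpha>_pos: "0 < \<alpha>" and cont: "continuous_on UNIV \<eta>"
    and supp: "\<And>s. s \<notin> {\<alpha>..\<beta>} \<Longrightarrow> \<eta> s = 0" and zero: "integral {0..\<beta>} \<eta> = 0"
  shows "(\<integral>x. u x * (\<eta> (norm x) / norm x ^ (CARD('n) - 1)) \<partial>lebesgue)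
      = - (\<integral>x. flux g x * integral {0..norm x} \<eta> \<partial>lebesgue)"
proof -
  let ?n = "CARD('n)"
  define \<psi> where "\<psi> r = integral {0..r} \<eta>" for r
  have \<psi>_eq_0: "r < \<alpha> \<Longrightarrow> \<psi> r = 0" "r > \<beta> \<Longrightarrow> \<psi> r = 0" for r
    unfolding \<psi>_def using integral_mean_zero_interval_support[OF \<alpha>_pos cont supp zero] by blast+
  have \<psi>_deriv: "(\<psi> has_real_derivative \<eta> r) (at r)" if "r > 0" for r
    using integral_from_0_has_real_derivative[OF cont that] unfolding \<psi>_def .
  define m where "m r = \<psi> r / r ^ ?n" for r
  define m' where "m' r = \<eta> r / r ^ ?n - real ?n * \<psi> r / r ^ (?n + 1)" for r
  have m_deriv: "(m has_real_derivative m' r) (at r)" if "r > 0" for r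
    unfolding m_def[abs_def] m'_def by (rule quotient_power_has_real_derivative[OF \<psi>_deriv[OF that] that]) simp
  have "continuous_on {0<..} \<psi>"
    using \<psi>_deriv by (intro continuous_at_imp_continuous_on) (auto intro: DERIV_isCont)
  then have m'_cont: "continuous_on {0<..} m'"
    unfolding m'_def by (intro continuous_intros continuous_on_subset[OF cont]) auto
  have divergence: "real ?n * m r + r * m' r = \<eta> r / r ^ (?n - 1)" if "r \<ge> 0" for r
  proof (cases "r = 0")
    case True
    then show ?thesis using \<alpha>_pos \<psi>_eq_0(1) supp[of 0] by (simp add: m_def)
  next
    case False
    have "r ^ ?n = r * r ^ (?n - 1)" by (simp add: power_eq_if)
    then show ?thesis using False unfolding m_def m'_def by (simp add: divide_simps)
  qed
  have "(\<integral>x. u x * (\<eta> (norm x) / norm x ^ (?n - 1)) \<partial>lebesgue)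
      = (\<integral>x. u x * (real ?n * m (norm x) + norm x * m' (norm x)) \<partial>lebesgue)"
    by (simp only: divergence[OF norm_ge_zero])
  also have "\<dots> = - (\<integral>x. (g x \<bullet> x) * m (norm x) \<partial>lebesgue)"
    by (rule weak_grad_radial_field[OF wg \<alpha>_pos _ _ m_deriv m'_cont, where R=\<beta>]) (auto simp: m_def dest: \<psi>_eq_0)
  also have "\<dots> = - (\<integral>x. flux g x * integral {0..norm x} \<eta> \<partial>lebesgue)"
    by (simp add: flux_def m_def \<psi>_def)
  finally show ?thesis .
qed

lemma integrable_mult_lborel_pair:
  fixes f :: "'a::euclidean_space \<Rightarrow> real" and h :: "'b::euclidean_space \<Rightarrow> real"
  assumes "integrable lborel f" "integrable lborel h"
  shows "integrable (lborel \<Otimes>\<^sub>M lborel) (\<lambda>(x, y). f x * h y)"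
proof (rule lborel_pair.Fubini_integrable)
  have [measurable]: "f \<in> borel_measurable borel" "h \<in> borel_measurable borel" using assms by simp_all
  show "(\<lambda>(x, y). f x * h y) \<in> borel_measurable (lborel \<Otimes>\<^sub>M lborel)" by measurable
qed (use assms in \<open>auto simp: abs_mult\<close>)

lemma integral_indicator_atLeastLess_continuous:
  fixes \<eta> :: "real \<Rightarrow> real"
  assumes "continuous_on UNIV \<eta>" "\<And>s. s < 0 \<Longrightarrow> \<eta> s = 0"
  shows "(\<integral>s. indicator {s<..} r * \<eta> s \<partial>lborel) = integral {0..r} \<eta>"
proof -
  have "set_integrable lborel {0..r} \<eta>"
    unfolding set_integrable_def
    by (rule borel_integrable_compact) (auto intro: continuous_on_subset[OF assms(1)])
  from set_borel_integral_eq_integral(2)[OF this]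
  have "(\<integral>s. indicator {0..r} s * \<eta> s \<partial>lborel) = integral {0..r} \<eta>"
    by (simp add: set_lebesgue_integral_def)
  moreover have "(\<integral>s. indicator {s<..} r * \<eta> s \<partial>lborel) = (\<integral>s. indicator {0..r} s * \<eta> s \<partial>lborel)"
  proof (rule integral_cong_AE)
    have [measurable]: "\<eta> \<in> borel_measurable borel" using assms(1) by (rule borel_measurable_continuous_onI)
    have "(\<lambda>s. indicator {s<..} r * \<eta> s) = (\<lambda>s. indicator {..<r} s * \<eta> s)" by (auto simp: indicator_def)
    then show "(\<lambda>s. indicator {s<..} r * \<eta> s) \<in> borel_measurable lborel" by simp
    show "(\<lambda>s. indicator {0..r} s * \<eta> s) \<in> borel_measurable lborel" by measurable
    show "AE s in lborel. indicator {s<..} r * \<eta> s = indicator {0..r} s * \<eta> s"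
      using AE_lborel_singleton[of r] by eventually_elim (use assms(2) in \<open>auto simp: indicator_def not_le\<close>)
  qed
  ultimately show ?thesis by simp
qed

lemma flux_Fubini_borel:
  fixes g :: "'a::euclidean_space \<Rightarrow> 'a"
  assumes dim: "DIM('a) \<ge> 3" and g: "square_integrable lebesgue g" and [measurable]: "g \<in> borel_measurable borel"
    and \<alpha>_pos: "0 < \<alpha>" and cont: "continuous_on UNIV \<eta>" and supp: "\<And>s. s \<notin> {\<alpha>..\<beta>} \<Longrightarrow> \<eta> s = 0"
  shows "integrable lborel (\<lambda>s. profile g s * \<eta> s)"
    and "(\<integral>x. flux g x * integral {0..norm x} \<eta> \<partial>lborel)
      = - unit_sphere_area DIM('a) * (\<integral>s. profile g s * \<eta> s \<partial>lborel)"
proof -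
  have [measurable]: "\<eta> \<in> borel_measurable borel" using cont by (rule borel_measurable_continuous_onI)
  have [measurable]: "flux g \<in> borel_measurable borel" unfolding flux_def[abs_def] by measurable
  have \<eta>_int: "integrable lborel \<eta>"
    by (rule integrable_continuous_bounded_support(1)[OF cont bounded_subset[OF bounded_closed_interval[of \<alpha> \<beta>]]])
      (use supp in blast)
  define f where "f x s = indicator {s<..} (norm x) * flux g x * \<eta> s" for x :: 'a and s :: real
  have "{p::'a \<times> real. snd p < norm (fst p)} \<in> sets (borel \<Otimes>\<^sub>M borel)"
    by (subst borel_prod) (intro borel_open open_Collect_less continuous_intros)
  then have "(\<lambda>p::'a \<times> real. indicator {p. snd p < norm (fst p)} p * flux g (fst p) * \<eta> (snd p))
      \<in> borel_measurable (lborel \<Otimes>\<^sub>M lborel)"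
    by measurable
  moreover have "case_prod f = (\<lambda>p. indicator {p. snd p < norm (fst p)} p * flux g (fst p) * \<eta> (snd p))"
    by (auto simp: f_def fun_eq_iff indicator_def)
  ultimately have f_meas: "case_prod f \<in> borel_measurable (lborel \<Otimes>\<^sub>M lborel)" by simp
  have "(\<lambda>x. indicator {\<alpha>/2<..} (norm x) * flux g x) \<in> borel_measurable lborel" by measurable
  then have "integrable lborel (\<lambda>x. indicator {\<alpha>/2<..} (norm x) * flux g x)"
    using flux_outside_integrable[OF dim g, of "\<alpha>/2"] \<alpha>_pos by (simp add: integrable_completion)
  from integrable_mult_lborel_pair[OF this \<eta>_int]
  have f_int: "integrable (lborel \<Otimes>\<^sub>M lborel) (case_prod f)"
    by (rule Bochner_Integration.integrable_bound[OF _ f_meas])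
      (use supp \<alpha>_pos in \<open>auto simp: f_def abs_mult indicator_def not_le\<close>)
  have inner_x: "(\<integral>x. f x s \<partial>lborel) = - unit_sphere_area DIM('a) * (profile g s * \<eta> s)" for s
    using unit_sphere_area_pos[of "DIM('a)"]
    by (simp add: f_def profile_def integral_completion field_simps)
  have inner_s: "(\<integral>s. f x s \<partial>lborel) = flux g x * integral {0..norm x} \<eta>" for x
    using integral_indicator_atLeastLess_continuous[OF cont, of "norm x"] supp \<alpha>_pos
    by (simp add: f_def mult.assoc mult.left_commute[of _ "flux g x"])
  show "integrable lborel (\<lambda>s. profile g s * \<eta> s)"
    using lborel_pair.integrable_snd[OF f_int] unit_sphere_area_pos[of "DIM('a)"] by (simp add: inner_x)
  show "(\<integral>x. flux g x * integral {0..norm x} \<eta> \<partial>lborel)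
      = - unit_sphere_area DIM('a) * (\<integral>s. profile g s * \<eta> s \<partial>lborel)"
    using lborel_pair.Fubini_integral[OF f_int] by (simp add: inner_x inner_s)
qed

lemma flux_Fubini:
  fixes g :: "'a::euclidean_space \<Rightarrow> 'a"
  assumes dim: "DIM('a) \<ge> 3" and g: "square_integrable lebesgue g"
    and \<alpha>_pos: "0 < \<alpha>" and cont: "continuous_on UNIV \<eta>" and supp: "\<And>s. s \<notin> {\<alpha>..\<beta>} \<Longrightarrow> \<eta> s = 0"
  shows "(\<integral>x. flux g x * integral {0..norm x} \<eta> \<partial>lebesgue)
    = - unit_sphere_area DIM('a) * (\<integral>s. profile g s * \<eta> s \<partial>lebesgue)"
proof -
  obtain h where h: "h \<in> borel_measurable borel" "AE x in lebesgue. g x = h x"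
    "square_integrable lebesgue h" "L2_norm lebesgue h = L2_norm lebesgue g"
    by (rule square_integrable_borel_representative[OF g])
  have [measurable]: "h \<in> borel_measurable borel" "\<eta> \<in> borel_measurable borel"
    using h(1) cont by (auto intro: borel_measurable_continuous_onI)
  have profile_eq: "profile g = profile h" by (rule profile_cong_AE[OF h(2)])
  have "(\<integral>x. flux g x * integral {0..norm x} \<eta> \<partial>lebesgue) = (\<integral>x. flux h x * integral {0..norm x} \<eta> \<partial>lebesgue)"
    by (rule lebesgue_integral_cong_AE(2)) (use h(2) in eventually_elim, simp add: flux_def)
  also have "\<dots> = (\<integral>x. flux h x * integral {0..norm x} \<eta> \<partial>lborel)"
  proof (rule integral_completion)
    have "continuous_on {0<..} (\<lambda>r. integral {0..r} \<eta>)"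
      using integral_from_0_has_real_derivative[OF cont]
      by (intro continuous_at_imp_continuous_on) (auto intro: DERIV_isCont)
    then have [measurable]: "(\<lambda>x::'a. integral {0..norm x} \<eta>) \<in> borel_measurable borel"
      by (rule borel_measurable_radial)
    show "(\<lambda>x. flux h x * integral {0..norm x} \<eta>) \<in> borel_measurable lborel"
      unfolding flux_def by measurable
  qed
  also have "\<dots> = - unit_sphere_area DIM('a) * (\<integral>s. profile h s * \<eta> s \<partial>lborel)"
    by (rule flux_Fubini_borel(2)[OF dim h(3,1) \<alpha>_pos cont supp])
  also have "(\<integral>s. profile h s * \<eta> s \<partial>lborel) = (\<integral>s. profile h s * \<eta> s \<partial>lebesgue)"
    using flux_Fubini_borel(1)[OF dim h(3,1) \<alpha>_pos cont supp] by (simp add: integral_completion)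
  finally show ?thesis by (simp only: profile_eq)
qed

lemma integrable_indicator_atMost_norm_if_powr_integrable:
  fixes u :: "'a::euclidean_space \<Rightarrow> real"
  assumes u: "u \<in> borel_measurable lebesgue" and p: "p \<ge> 1" "integrable lebesgue (\<lambda>x. \<bar>u x\<bar> powr p)"
  shows "integrable lebesgue (\<lambda>x. indicator {..R} (norm x) * u x)"
proof (rule Bochner_Integration.integrable_bound)
  have "integrable lebesgue (\<lambda>x::'a. indicator (cball 0 R) x :: real)"
    using emeasure_lborel_cball_finite[of "0::'a" R] by (intro integrable_real_indicator) auto
  then show "integrable lebesgue (\<lambda>x. indicator (cball 0 R) x + \<bar>u x\<bar> powr p)" using p(2) by auto
  show "(\<lambda>x. indicator {..R} (norm x) * u x) \<in> borel_measurable lebesgue"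
    by (intro borel_measurable_times borel_measurable_lebesgue_indicator_norm u) auto
  have "\<bar>t\<bar> \<le> 1 + \<bar>t\<bar> powr p" for t :: real
    using powr_mono[OF p(1), of "\<bar>t\<bar>"] by (cases "\<bar>t\<bar> \<le> 1") (auto simp: add_increasing2)
  then show "AE x in lebesgue. norm (indicator {..R} (norm x) * u x) \<le> norm (indicator (cball 0 R) x + \<bar>u x\<bar> powr p)"
    by (auto simp: indicator_def)
qed

lemma integrable_mult_radial_bounded:
  fixes u :: "'a::euclidean_space \<Rightarrow> real"
  assumes loc: "integrable lebesgue (\<lambda>x. indicator {..\<beta>} (norm x) * u x)"
    and q: "q \<in> borel_measurable borel" "\<And>r. r \<ge> 0 \<Longrightarrow> \<bar>q r\<bar> \<le> C" "\<And>r. r > \<beta> \<Longrightarrow> q r = 0"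
  shows "integrable lebesgue (\<lambda>x. u x * q (norm x))"
proof (rule Bochner_Integration.integrable_bound)
  show "integrable lebesgue (\<lambda>x. C * (indicator {..\<beta>} (norm x) * u x))" using loc by (rule integrable_mult_right)
  note [measurable] = q(1)
  have supported: "(indicator {..\<beta>} (norm x) * u x) * q (norm x) = u x * q (norm x)" for x
    using q(3)[of "norm x"] by (auto simp: indicator_def)
  have "(\<lambda>x. (indicator {..\<beta>} (norm x) * u x) * q (norm x)) \<in> borel_measurable lebesgue"
    by (rule borel_measurable_times[OF borel_measurable_integrable[OF loc]]) (intro measurable_completion, measurable)
  then show "(\<lambda>x. u x * q (norm x)) \<in> borel_measurable lebesgue" by (simp only: supported)
  show "AE x in lebesgue. norm (u x * q (norm x)) \<le> norm (C * (indicator {..\<beta>} (norm x) * u x))"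
  proof (rule AE_I2)
    fix x
    have "\<bar>indicator {..\<beta>} (norm x) * u x\<bar> * \<bar>q (norm x)\<bar> \<le> \<bar>indicator {..\<beta>} (norm x) * u x\<bar> * \<bar>C\<bar>"
      by (intro mult_left_mono order_trans[OF q(2) abs_ge_self]) auto
    then show "norm (u x * q (norm x)) \<le> norm (C * (indicator {..\<beta>} (norm x) * u x))"
      unfolding supported[symmetric] by (simp add: abs_mult mult.commute)
  qed
qed

lemma radial_profile_integral_identity:
  fixes u :: "'a::euclidean_space \<Rightarrow> real"
  assumes loc: "\<And>R. integrable lebesgue (\<lambda>x. indicator {..R} (norm x) * u x)"
    and w: "w \<in> borel_measurable borel" "AE x in lebesgue. u x = w (norm x)"
    and \<alpha>_pos: "0 < \<alpha>" and \<eta>: "\<eta> \<in> borel_measurable borel" "\<And>s. \<bar>\<eta> s\<bar> \<le> B" "\<And>s. s \<notin> {\<alpha>..\<beta>} \<Longrightarrow> \<eta> s = 0"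
  shows "integrable lebesgue (\<lambda>s. w s * \<eta> s)"
    and "(\<integral>x. u x * (\<eta> (norm x) / norm x ^ (DIM('a) - 1)) \<partial>lebesgue)
      = unit_sphere_area DIM('a) * (\<integral>s. w s * \<eta> s \<partial>lebesgue)"
proof -
  note [measurable] = w(1) \<eta>(1)
  define q where "q s = \<eta> s / s ^ (DIM('a) - 1)" for s
  have [measurable]: "q \<in> borel_measurable borel" unfolding q_def[abs_def] by measurable
  have density: "radial_density DIM('a) s * (w s * q s) = unit_sphere_area DIM('a) * (w s * \<eta> s)" for s
    using \<eta>(3)[of s] \<alpha>_pos by (cases "s > 0") (auto simp: q_def radial_density_def)
  have q_le: "\<bar>q s\<bar> \<le> B / \<alpha> ^ (DIM('a) - 1)" if "s \<ge> 0" for s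
  proof (cases "s < \<alpha>")
    case True
    have "B \<ge> 0" using \<eta>(2)[of 0] by linarith
    then show ?thesis using True \<eta>(3)[of s] \<alpha>_pos by (simp add: q_def)
  next
    case False
    then have "\<alpha> ^ (DIM('a) - 1) \<le> s ^ (DIM('a) - 1)" using \<alpha>_pos by (intro power_mono) auto
    then show ?thesis unfolding q_def abs_divide using \<eta>(2)[of s] \<alpha>_pos by (intro frac_le) auto
  qed
  have uq_int: "integrable lebesgue (\<lambda>x. u x * q (norm x))"
    by (rule integrable_mult_radial_bounded[where \<beta>=\<beta>, OF loc _ q_le]) (use \<eta>(3) in \<open>auto simp: q_def\<close>)
  have AE_eq: "AE x in lebesgue. u x * q (norm x) = w (norm x) * q (norm x)"
    using w(2) by eventually_elim simp
  have wq_meas: "(\<lambda>x::'a. w (norm x) * q (norm x)) \<in> borel_measurable lborel" by measurable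
  have "integrable lborel (\<lambda>x::'a. w (norm x) * q (norm x))"
    using uq_int lebesgue_integral_cong_AE(1)[OF AE_eq] integrable_completion[OF wq_meas] by simp
  then have w\<eta>_int: "integrable lborel (\<lambda>s. w s * \<eta> s)"
    using integrable_radial_iff[of "\<lambda>s. w s * q s", where 'a='a] unit_sphere_area_pos[of "DIM('a)"] by (simp add: density)
  then show "integrable lebesgue (\<lambda>s. w s * \<eta> s)" by (rule integrable_completionI)
  have "(\<integral>x. u x * q (norm x) \<partial>lebesgue) = (\<integral>x. w (norm (x::'a)) * q (norm x) \<partial>lborel)"
    using lebesgue_integral_cong_AE(2)[OF AE_eq] integral_completion[OF wq_meas] by simp
  also have "\<dots> = unit_sphere_area DIM('a) * (\<integral>s. w s * \<eta> s \<partial>lborel)"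
    using integral_radial[of "\<lambda>s. w s * q s", where 'a='a] by (simp add: density)
  finally show "(\<integral>x. u x * (\<eta> (norm x) / norm x ^ (DIM('a) - 1)) \<partial>lebesgue)
      = unit_sphere_area DIM('a) * (\<integral>s. w s * \<eta> s \<partial>lebesgue)"
    using w\<eta>_int by (simp add: q_def integral_completion)
qed

lemma integral_eq_lebesgue_integral_interval_support:
  fixes \<eta> :: "real \<Rightarrow> real"
  assumes "0 < \<alpha>" "continuous_on UNIV \<eta>" "\<And>s. s \<notin> {\<alpha>..\<beta>} \<Longrightarrow> \<eta> s = 0"
  shows "integral {0..\<beta>} \<eta> = (\<integral>s. \<eta> s \<partial>lebesgue)"
proof -
  have "set_integrable lebesgue {0..\<beta>} \<eta>"
    unfolding set_integrable_def
    by (intro integrable_completionI borel_integrable_compact continuous_on_subset[OF assms(2)]) auto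
  from set_lebesgue_integral_eq_integral(2)[OF this]
  have "integral {0..\<beta>} \<eta> = (\<integral>s. indicator {0..\<beta>} s * \<eta> s \<partial>lebesgue)" by (simp add: set_lebesgue_integral_def)
  moreover have "indicator {0..\<beta>} s * \<eta> s = \<eta> s" for s
    using assms(1) assms(3)[of s] by (cases "s \<in> {\<alpha>..\<beta>}") auto
  ultimately show ?thesis by simp
qed

lemma radial_representation_up_to_const:
  fixes u :: "real^'n \<Rightarrow> real"
  assumes dim: "CARD('n) \<ge> 3" and wg: "weak_grad u g" and g: "square_integrable lebesgue g"
    and loc: "\<And>R. integrable lebesgue (\<lambda>x. indicator {..R} (norm x) * u x)"
    and w: "w \<in> borel_measurable borel" "AE x in lebesgue. u x = w (norm x)"
  obtains c where "AE x in lebesgue. u x = profile g (norm x) + c"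
proof -
  have dim': "DIM(real^'n) \<ge> 3" using dim by simp
  have w_int: "set_integrable lebesgue {\<alpha>..\<beta>} w" if "0 < \<alpha>" for \<alpha> \<beta>
    using radial_profile_integral_identity(1)[OF loc w that, of "indicator {\<alpha>..\<beta>}" 1 \<beta>]
    by (simp add: set_integrable_def indicator_def mult.commute)
  have profile_int: "set_integrable lebesgue {\<alpha>..\<beta>} (profile g)" if "0 < \<alpha>" for \<alpha> \<beta>
    unfolding set_integrable_def using that
    by (intro integrable_completionI borel_integrable_compact continuous_on_subset[OF continuous_on_profile[OF dim' g]]) auto
  have "\<exists>c. AE s in lebesgue. 0 < s \<longrightarrow> w s - profile g s = c"
  proof (rule du_Bois_Reymond)
    show "set_integrable lebesgue {\<alpha>..\<beta>} (\<lambda>s. w s - profile g s)" if "0 < \<alpha>" for \<alpha> \<beta>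
      using w_int[OF that] profile_int[OF that] by (rule set_integral_diff)
    fix \<eta> :: "real \<Rightarrow> real" and \<alpha> \<beta>
    assume \<alpha>_pos: "0 < \<alpha>" and \<eta>: "continuous_on UNIV \<eta>" "\<And>s. s \<notin> {\<alpha>..\<beta>} \<Longrightarrow> \<eta> s = (0::real)" and zero: "(\<integral>s. \<eta> s \<partial>lebesgue) = 0"
    obtain B where B: "\<And>s. \<bar>\<eta> s\<bar> \<le> B" using bounded_continuous_interval_support[OF \<eta>] by metis
    have \<eta>_meas: "\<eta> \<in> borel_measurable borel" using \<eta>(1) by (rule borel_measurable_continuous_onI)
    have "unit_sphere_area CARD('n) * (\<integral>s. w s * \<eta> s \<partial>lebesgue)
        = - (\<integral>x. flux g x * integral {0..norm x} \<eta> \<partial>lebesgue)"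
      using radial_profile_integral_identity(2)[OF loc w \<alpha>_pos \<eta>_meas, of B \<beta>] B \<eta>(2)
        weak_grad_flux_identity[OF wg \<alpha>_pos \<eta>] integral_eq_lebesgue_integral_interval_support[OF \<alpha>_pos \<eta>] zero by simp
    also have "\<dots> = unit_sphere_area CARD('n) * (\<integral>s. profile g s * \<eta> s \<partial>lebesgue)"
      using flux_Fubini[OF dim' g \<alpha>_pos \<eta>] by simp
    finally have "(\<integral>s. w s * \<eta> s \<partial>lebesgue) = (\<integral>s. profile g s * \<eta> s \<partial>lebesgue)"
      using unit_sphere_area_pos[of "CARD('n)"] by simp
    then show "(\<integral>s. (w s - profile g s) * \<eta> s \<partial>lebesgue) = 0"
      using integrable_mult_continuous_interval_support[OF w_int[OF \<alpha>_pos] \<eta>]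
        integrable_mult_continuous_interval_support[OF profile_int[OF \<alpha>_pos] \<eta>]
      by (simp add: left_diff_distrib)
  qed
  then obtain c where "AE s in lebesgue. 0 < s \<longrightarrow> w s - profile g s = c" by blast
  then have "AE x::real^'n in lebesgue. x \<noteq> 0 \<longrightarrow> w (norm x) - profile g (norm x) = c" by (rule AE_radial)
  then have "AE x in lebesgue. u x = profile g (norm x) + c"
    using w(2) AE_neq_0 by eventually_elim auto
  then show ?thesis by (rule that)
qed

lemma not_integrable_if_bounded_below_outside_ball:
  fixes f :: "'a::euclidean_space \<Rightarrow> real"
  assumes \<delta>_pos: "\<delta> > 0" and f: "AE x in lebesgue. norm x > R \<longrightarrow> \<delta> \<le> \<bar>f x\<bar>"
  shows "\<not> integrable lebesgue f"
proof
  assume f_int: "integrable lebesgue f"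
  let ?B = "cball (0::'a) R"
  have "integrable lebesgue (\<lambda>x. \<delta> * indicator (- ?B) x)"
  proof (rule Bochner_Integration.integrable_bound[OF f_int])
    show "(\<lambda>x. \<delta> * indicator (- ?B) x) \<in> borel_measurable lebesgue"
      by (intro measurable_completion) measurable
    show "AE x in lebesgue. norm (\<delta> * indicator (- ?B) x) \<le> norm (f x)"
      using f by eventually_elim (use \<delta>_pos in \<open>auto simp: indicator_def\<close>)
  qed
  then have "emeasure lebesgue (- ?B) < \<infinity>" using \<delta>_pos by (simp add: integrable_indicator_iff)
  moreover have "emeasure lebesgue ?B < \<infinity>"
    using emeasure_lborel_cball_finite[of "0::'a" R] by simp
  moreover have "emeasure lebesgue (- ?B) + emeasure lebesgue ?B = emeasure lebesgue (UNIV::'a set)"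
    by (subst plus_emeasure) (auto intro!: arg_cong2[where f=emeasure])
  ultimately show False by (auto simp: ennreal_add_eq_top)
qed

lemma profile_tendsto_0:
  fixes g :: "'a::euclidean_space \<Rightarrow> 'a"
  assumes dim: "DIM('a) \<ge> 3" and g: "square_integrable lebesgue g"
  shows "(profile g \<longlongrightarrow> 0) at_top"
proof (rule Lim_null_comparison)
  let ?b = "\<lambda>r. profile_const DIM('a) * L2_norm lebesgue g * sqrt (r powr (2 - real DIM('a)))"
  show "\<forall>\<^sub>F r in at_top. norm (profile g r) \<le> ?b r"
    using eventually_gt_at_top[of 0] by eventually_elim (use profile_bound[OF dim g] in simp)
  have "((\<lambda>r. r powr (2 - real DIM('a))) \<longlongrightarrow> 0) at_top"
    using dim by (intro tendsto_neg_powr filterlim_ident) auto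
  then have "(?b \<longlongrightarrow> profile_const DIM('a) * L2_norm lebesgue g * sqrt 0) at_top" by (intro tendsto_intros)
  then show "(?b \<longlongrightarrow> 0) at_top" by simp
qed

theorem radial_representation:
  fixes u :: "real^'n \<Rightarrow> real"
  assumes dim: "CARD('n) \<ge> 3" and u: "D12 u" "radial u" and wg: "weak_grad u g" and g: "square_integrable lebesgue g"
  shows "AE x in lebesgue. u x = profile g (norm x)"
proof -
  let ?p = "2 * real CARD('n) / (real CARD('n) - 2)"
  have u_meas: "u \<in> borel_measurable lebesgue" and u_powr: "integrable lebesgue (\<lambda>x. \<bar>u x\<bar> powr ?p)"
    using u(1) by (simp_all add: D12_def)
  obtain v where "AE x in lebesgue. u x = v (norm x)" using u(2) by (auto simp: radial_def)
  then obtain w where w: "w \<in> borel_measurable borel" "AE x in lebesgue. u x = w (norm x)"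
    using radial_function_borel_profile[OF u_meas] by blast
  have "?p \<ge> 1" using dim by (simp add: field_simps)
  then have loc: "integrable lebesgue (\<lambda>x. indicator {..R} (norm x) * u x)" for R
    by (rule integrable_indicator_atMost_norm_if_powr_integrable[OF u_meas _ u_powr])
  obtain c where c: "AE x in lebesgue. u x = profile g (norm x) + c"
    by (rule radial_representation_up_to_const[OF dim wg g loc w])
  have "c = 0"
  proof (rule ccontr)
    assume "c \<noteq> 0"
    have "(profile g \<longlongrightarrow> 0) at_top" using dim by (intro profile_tendsto_0 g) simp
    from tendstoD[OF this, of "\<bar>c\<bar> / 2"] obtain R where R: "\<And>r. r \<ge> R \<Longrightarrow> \<bar>profile g r\<bar> < \<bar>c\<bar> / 2"
      using \<open>c \<noteq> 0\<close> by (auto simp: eventually_at_top_linorder)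
    have "AE x in lebesgue. norm x > R \<longrightarrow> (\<bar>c\<bar> / 2) powr ?p \<le> \<bar>\<bar>u x\<bar> powr ?p\<bar>"
      using c
    proof eventually_elim
      case (elim x)
      have "\<bar>c\<bar> / 2 \<le> \<bar>u x\<bar>" if "norm x > R" using R[of "norm x"] elim that by linarith
      then show ?case using dim by (auto intro!: powr_mono2)
    qed
    from not_integrable_if_bounded_below_outside_ball[OF _ this] show False using u_powr \<open>c \<noteq> 0\<close> by simp
  qed
  then show ?thesis using c by simp
qed

section \<open>Hardy's inequality\<close>

lemma profile_power2_le:
  fixes g :: "'a::euclidean_space \<Rightarrow> 'a"
  assumes dim: "DIM('a) \<ge> 3" and g: "square_integrable lebesgue g" and [measurable]: "g \<in> borel_measurable borel"
    and r_pos: "r > 0"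
  shows "ennreal ((unit_sphere_area DIM('a) * profile g r)\<^sup>2)
    \<le> (\<integral>\<^sup>+y. indicator {r<..} (norm y) * ennreal ((norm (g y))\<^sup>2 * norm y powr (2 * s)) \<partial>lborel)
      * (\<integral>\<^sup>+y. ennreal (indicator {r<..} (norm (y::'a)) * norm y powr (2 * (1 - real DIM('a) - s))) \<partial>lborel)"
proof -
  let ?\<sigma> = "unit_sphere_area DIM('a)"
  let ?a = "\<lambda>y. ennreal (indicator {r<..} (norm y) * (norm (g y) * norm y powr s))"
  let ?b = "\<lambda>y::'a. ennreal (indicator {r<..} (norm y) * norm y powr (1 - real DIM('a) - s))"
  have powr_power2: "(t powr e)\<^sup>2 = t powr (2 * e)" for t e :: real
    by (simp add: power2_eq_square powr_add[symmetric])
  have flux_meas: "(\<lambda>x. indicator {r<..} (norm x) * flux g x) \<in> borel_measurable lborel"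
    unfolding flux_def by measurable
  have "ennreal \<bar>?\<sigma> * profile g r\<bar> \<le> ennreal (\<integral>x. \<bar>indicator {r<..} (norm x) * flux g x\<bar> \<partial>lborel)"
    using unit_sphere_area_pos[of "DIM('a)"] flux_meas by (simp add: profile_def integral_completion ennreal_leI)
  also have "\<dots> = (\<integral>\<^sup>+x. ennreal \<bar>indicator {r<..} (norm x) * flux g x\<bar> \<partial>lborel)"
    using flux_outside_integrable[OF dim g r_pos] flux_meas
    by (intro nn_integral_eq_integral[symmetric]) (auto simp: integrable_completion)
  also have "\<dots> \<le> (\<integral>\<^sup>+y. ?a y * ?b y \<partial>lborel)"
  proof (rule nn_integral_mono)
    fix y :: 'a
    have "norm y powr (1 - real DIM('a)) = norm y powr s * norm y powr (1 - real DIM('a) - s)"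
      by (simp add: powr_add[symmetric])
    then show "ennreal \<bar>indicator {r<..} (norm y) * flux g y\<bar> \<le> ?a y * ?b y"
      using abs_flux_le[of g y]
      by (auto simp: indicator_def ennreal_mult[symmetric] mult.assoc intro!: ennreal_leI)
  qed
  finally have "(ennreal \<bar>?\<sigma> * profile g r\<bar>)\<^sup>2 \<le> (\<integral>\<^sup>+y. ?a y * ?b y \<partial>lborel)\<^sup>2" by (rule power_mono) simp
  also have "\<dots> \<le> (\<integral>\<^sup>+y. (?a y)\<^sup>2 \<partial>lborel) * (\<integral>\<^sup>+y. (?b y)\<^sup>2 \<partial>lborel)"
    by (rule Cauchy_Schwarz_nn_integral) measurable
  also have "(\<integral>\<^sup>+y. (?a y)\<^sup>2 \<partial>lborel) = (\<integral>\<^sup>+y. indicator {r<..} (norm y) * ennreal ((norm (g y))\<^sup>2 * norm y powr (2 * s)) \<partial>lborel)"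
    by (intro nn_integral_cong) (auto simp: indicator_def ennreal_power power_mult_distrib powr_power2)
  also have "(\<integral>\<^sup>+y. (?b y)\<^sup>2 \<partial>lborel)
      = (\<integral>\<^sup>+y. ennreal (indicator {r<..} (norm (y::'a)) * norm y powr (2 * (1 - real DIM('a) - s))) \<partial>lborel)"
    by (intro nn_integral_cong) (auto simp: indicator_def ennreal_power powr_power2)
  finally show ?thesis by (simp add: ennreal_power)
qed

text \<open>The exponent \<open>s = -(n-2)/4\<close> makes both integrals of the subsequent application of Tonelli's theorem
  converge.\<close>

lemma profile_weighted_bound:
  fixes g :: "'a::euclidean_space \<Rightarrow> 'a"
  defines "m \<equiv> real DIM('a) - 2"
  assumes dim: "DIM('a) \<ge> 3" and g: "square_integrable lebesgue g" "g \<in> borel_measurable borel" and r_pos: "r > 0"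
  shows "ennreal ((profile g r)\<^sup>2 / r\<^sup>2) \<le> ennreal (2 / (unit_sphere_area DIM('a) * m) * r powr (- m/2 - 2)) *
    (\<integral>\<^sup>+y. indicator {r<..} (norm y) * ennreal ((norm (g y))\<^sup>2 * norm y powr (- m/2)) \<partial>lborel)"
proof -
  let ?\<sigma> = "unit_sphere_area DIM('a)"
  have m: "m > 0" "real DIM('a) = m + 2" using dim by (simp_all add: m_def)
  have \<sigma>_pos: "?\<sigma> > 0" by (rule unit_sphere_area_pos) simp
  define A where "A = (\<integral>\<^sup>+y. indicator {r<..} (norm y) * ennreal ((norm (g y))\<^sup>2 * norm y powr (- m/2)) \<partial>lborel)"
  have exponents: "2 * (- m/4) = - m/2" "2 * (1 - real DIM('a) - - m/4) = - m/2 - real DIM('a)"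
    by (simp_all add: m(2) field_simps)
  have weight_integral: "(\<integral>\<^sup>+y. ennreal (indicator {r<..} (norm (y::'a)) * norm y powr (- m/2 - real DIM('a))) \<partial>lborel)
      = ennreal (?\<sigma> * 2 / m * r powr (- m/2))"
    using m(1) by (subst nn_integral_norm_powr_outside[OF _ r_pos]) (auto simp: field_simps)
  have "ennreal ((?\<sigma> * profile g r)\<^sup>2) \<le> A * ennreal (?\<sigma> * 2 / m * r powr (- m/2))"
    using profile_power2_le[OF dim g r_pos, of "- m/4"] unfolding exponents weight_integral A_def .
  from mult_left_mono[OF this, of "ennreal (1 / (?\<sigma>\<^sup>2 * r\<^sup>2))"]
  have "ennreal (1 / (?\<sigma>\<^sup>2 * r\<^sup>2)) * ennreal ((?\<sigma> * profile g r)\<^sup>2)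
      \<le> (ennreal (1 / (?\<sigma>\<^sup>2 * r\<^sup>2)) * ennreal (?\<sigma> * 2 / m * r powr (- m/2))) * A" by (simp add: mult_ac)
  also have "ennreal (1 / (?\<sigma>\<^sup>2 * r\<^sup>2)) * ennreal (?\<sigma> * 2 / m * r powr (- m/2))
      = ennreal (2 / (?\<sigma> * m) * r powr (- m/2 - 2))"
  proof -
    have "r powr (- m/2 - 2) = r powr (- m/2) / r\<^sup>2" using r_pos by (simp add: powr_diff)
    then show ?thesis
      using \<sigma>_pos m r_pos by (subst ennreal_mult[symmetric]) (auto simp: field_simps power2_eq_square)
  qed
  also have "ennreal (1 / (?\<sigma>\<^sup>2 * r\<^sup>2)) * ennreal ((?\<sigma> * profile g r)\<^sup>2) = ennreal ((profile g r)\<^sup>2 / r\<^sup>2)"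
    using \<sigma>_pos r_pos by (subst ennreal_mult[symmetric]) (auto simp: field_simps)
  finally show ?thesis by (simp add: A_def)
qed

lemma nn_integral_norm_less_swap:
  fixes a G :: "'a::euclidean_space \<Rightarrow> ennreal"
  assumes [measurable]: "a \<in> borel_measurable borel" "G \<in> borel_measurable borel"
  shows "(\<integral>\<^sup>+x. a x * (\<integral>\<^sup>+y. indicator {norm x<..} (norm y) * G y \<partial>lborel) \<partial>lborel)
    = (\<integral>\<^sup>+y. G y * (\<integral>\<^sup>+x. indicator {..<norm y} (norm x) * a x \<partial>lborel) \<partial>lborel)"
proof -
  define F where "F x y = a x * (indicator {norm x<..} (norm y) * G y)" for x y
  have "{p::'a \<times> 'a. norm (fst p) < norm (snd p)} \<in> sets (borel \<Otimes>\<^sub>M borel)"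
    by (subst borel_prod) (intro borel_open open_Collect_less continuous_intros)
  then have "(\<lambda>p. a (fst p) * (indicator {p::'a \<times> 'a. norm (fst p) < norm (snd p)} p * G (snd p)))
      \<in> borel_measurable (lborel \<Otimes>\<^sub>M lborel)"
    by measurable
  moreover have "case_prod F = (\<lambda>p. a (fst p) * (indicator {p::'a \<times> 'a. norm (fst p) < norm (snd p)} p * G (snd p)))"
    by (auto simp: F_def fun_eq_iff indicator_def)
  ultimately have F_meas: "case_prod F \<in> borel_measurable (lborel \<Otimes>\<^sub>M lborel)" by simp
  have "(\<integral>\<^sup>+x. a x * (\<integral>\<^sup>+y. indicator {norm x<..} (norm y) * G y \<partial>lborel) \<partial>lborel) = (\<integral>\<^sup>+x. (\<integral>\<^sup>+y. F x y \<partial>lborel) \<partial>lborel)"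
    unfolding F_def by (intro nn_integral_cong nn_integral_cmult[symmetric]) measurable
  also have "\<dots> = (\<integral>\<^sup>+y. (\<integral>\<^sup>+x. F x y \<partial>lborel) \<partial>lborel)" by (rule lborel_pair.Fubini'[symmetric, OF F_meas])
  also have "\<dots> = (\<integral>\<^sup>+y. (\<integral>\<^sup>+x. G y * (indicator {..<norm y} (norm x) * a x) \<partial>lborel) \<partial>lborel)"
    by (intro nn_integral_cong) (auto simp: F_def indicator_def mult_ac)
  also have "\<dots> = (\<integral>\<^sup>+y. G y * (\<integral>\<^sup>+x. indicator {..<norm y} (norm x) * a x \<partial>lborel) \<partial>lborel)"
    by (intro nn_integral_cong nn_integral_cmult) measurable
  finally show ?thesis .
qed

lemma Hardy_nn_integral_borel:
  fixes g :: "'a::euclidean_space \<Rightarrow> 'a"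
  assumes dim: "DIM('a) \<ge> 3" and g: "square_integrable lebesgue g" and g_borel [measurable]: "g \<in> borel_measurable borel"
  shows "(\<integral>\<^sup>+x. ennreal ((profile g (norm x))\<^sup>2 / (norm (x::'a))\<^sup>2) \<partial>lborel)
    \<le> ennreal (4 / (real DIM('a) - 2)\<^sup>2 * (L2_norm lebesgue g)\<^sup>2)"
proof -
  let ?\<sigma> = "unit_sphere_area DIM('a)"
  define m where "m = real DIM('a) - 2"
  have m: "m > 0" "real DIM('a) = m + 2" using dim by (auto simp: m_def)
  have \<sigma>_pos: "?\<sigma> > 0" by (rule unit_sphere_area_pos) simp
  let ?a = "\<lambda>x::'a. ennreal (2 / (?\<sigma> * m) * norm x powr (- m/2 - 2))"
  let ?G = "\<lambda>y. ennreal ((norm (g y))\<^sup>2 * norm y powr (- m/2))"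
  have inner: "?G y * (\<integral>\<^sup>+x. indicator {..<norm y} (norm x) * ?a x \<partial>lborel) \<le> ennreal (4 / m\<^sup>2) * ennreal ((norm (g y))\<^sup>2)" for y
  proof -
    have "(\<integral>\<^sup>+x. indicator {..<norm y} (norm x) * ?a x \<partial>lborel)
        \<le> (\<integral>\<^sup>+x. ennreal (2 / (?\<sigma> * m)) * ennreal (indicator {..norm y} (norm (x::'a)) * norm x powr (- m/2 - 2)) \<partial>lborel)"
      using \<sigma>_pos m by (intro nn_integral_mono) (auto simp: indicator_def ennreal_mult[symmetric])
    also have "\<dots> = ennreal (2 / (?\<sigma> * m)) * ennreal (?\<sigma> * 2 / m * norm y powr (m/2))"
      using m by (subst nn_integral_cmult, measurable, subst nn_integral_norm_powr_inside) (auto simp: field_simps)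
    also have "\<dots> = ennreal (4 / m\<^sup>2 * norm y powr (m/2))"
      using \<sigma>_pos m by (subst ennreal_mult[symmetric]) (auto simp: field_simps power2_eq_square)
    finally have "?G y * (\<integral>\<^sup>+x. indicator {..<norm y} (norm x) * ?a x \<partial>lborel) \<le> ?G y * ennreal (4 / m\<^sup>2 * norm y powr (m/2))"
      by (rule mult_left_mono) simp
    also have "\<dots> = ennreal (4 / m\<^sup>2 * ((norm (g y))\<^sup>2 * (norm y powr (- m/2) * norm y powr (m/2))))"
      by (subst ennreal_mult[symmetric]) (auto simp: mult_ac)
    also have "\<dots> \<le> ennreal (4 / m\<^sup>2 * ((norm (g y))\<^sup>2 * 1))"
      by (intro ennreal_leI mult_left_mono) (cases "y = 0"; simp add: powr_add[symmetric])+
    finally show ?thesis by (simp add: ennreal_mult[symmetric])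
  qed
  have "(\<integral>\<^sup>+x. ennreal ((profile g (norm x))\<^sup>2 / (norm (x::'a))\<^sup>2) \<partial>lborel)
      \<le> (\<integral>\<^sup>+x. ?a x * (\<integral>\<^sup>+y. indicator {norm x<..} (norm y) * ?G y \<partial>lborel) \<partial>lborel)"
    using profile_weighted_bound[OF dim g g_borel]
    by (intro nn_integral_mono_AE eventually_mono[OF AE_lborel_singleton[of 0]]) (simp add: m_def)
  also have "\<dots> = (\<integral>\<^sup>+y. ?G y * (\<integral>\<^sup>+x. indicator {..<norm y} (norm x) * ?a x \<partial>lborel) \<partial>lborel)"
    by (rule nn_integral_norm_less_swap) measurable
  also have "\<dots> \<le> (\<integral>\<^sup>+y. ennreal (4 / m\<^sup>2) * ennreal ((norm (g y))\<^sup>2) \<partial>lborel)"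
    by (rule nn_integral_mono) (rule inner)
  also have "\<dots> = ennreal (4 / m\<^sup>2) * (\<integral>\<^sup>+y. ennreal ((norm (g y))\<^sup>2) \<partial>lebesgue)"
    by (simp add: nn_integral_cmult nn_integral_completion)
  also have "\<dots> = ennreal (4 / m\<^sup>2 * (L2_norm lebesgue g)\<^sup>2)"
    using square_integrableD(2)[OF g] by (simp add: nn_integral_eq_integral L2_norm_power2 ennreal_mult[symmetric])
  finally show ?thesis by (simp add: m_def)
qed

theorem Hardy_profile:
  fixes g :: "'a::euclidean_space \<Rightarrow> 'a"
  assumes dim: "DIM('a) \<ge> 3" and g: "square_integrable lebesgue g"
  shows "integrable lebesgue (\<lambda>x::'a. (profile g (norm x))\<^sup>2 / (norm x)\<^sup>2)"
    and "(\<integral>x. (profile g (norm x))\<^sup>2 / (norm (x::'a))\<^sup>2 \<partial>lebesgue) \<le> 4 / (real DIM('a) - 2)\<^sup>2 * (L2_norm lebesgue g)\<^sup>2"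
proof -
  obtain h where h: "h \<in> borel_measurable borel" "AE x in lebesgue. g x = h x"
    "square_integrable lebesgue h" "L2_norm lebesgue h = L2_norm lebesgue g"
    by (rule square_integrable_borel_representative[OF g])
  have bound: "(\<integral>\<^sup>+x. ennreal ((profile g (norm x))\<^sup>2 / (norm (x::'a))\<^sup>2) \<partial>lborel)
      \<le> ennreal (4 / (real DIM('a) - 2)\<^sup>2 * (L2_norm lebesgue g)\<^sup>2)"
    using Hardy_nn_integral_borel[OF dim h(3,1)] profile_cong_AE[OF h(2)] h(4) by simp
  have [measurable]: "(\<lambda>x::'a. profile g (norm x)) \<in> borel_measurable borel"
    by (rule profile_norm_measurable[OF dim g])
  have int: "integrable lborel (\<lambda>x::'a. (profile g (norm x))\<^sup>2 / (norm x)\<^sup>2)"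
    by (rule integrableI_nonneg) (use bound in \<open>auto intro: le_less_trans\<close>)
  then show "integrable lebesgue (\<lambda>x::'a. (profile g (norm x))\<^sup>2 / (norm x)\<^sup>2)"
    by (rule integrable_completionI)
  show "(\<integral>x. (profile g (norm x))\<^sup>2 / (norm (x::'a))\<^sup>2 \<partial>lebesgue) \<le> 4 / (real DIM('a) - 2)\<^sup>2 * (L2_norm lebesgue g)\<^sup>2"
    using bound int by (simp add: nn_integral_eq_integral integral_completion)
qed

section \<open>The positive part of a radial function\<close>

lemma lebesgue_measure_shell_le:
  assumes "\<alpha> \<ge> 0" "0 \<le> d" "d \<le> 1"
  shows "integrable lebesgue (\<lambda>x::'a::euclidean_space. indicator {\<alpha>..\<alpha>+d} (norm x) :: real)"
    and "(\<integral>x. indicator {\<alpha>..\<alpha>+d} (norm (x::'a)) \<partial>lebesgue) \<le> unit_sphere_area DIM('a) * (\<alpha> + 1) ^ (DIM('a) - 1) * d"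
proof -
  let ?p = "indicator {\<alpha>..\<alpha>+d} :: real \<Rightarrow> real" and ?c = "unit_sphere_area DIM('a) * (\<alpha> + 1) ^ (DIM('a) - 1)"
  have weight_le: "radial_density DIM('a) s * ?p s \<le> ?c * ?p s" for s
  proof (cases "s \<in> {\<alpha>..\<alpha>+d}")
    case True
    then have "s ^ (DIM('a) - 1) \<le> (\<alpha> + 1) ^ (DIM('a) - 1)" using assms by (intro power_mono) auto
    then show ?thesis using True assms
      by (auto simp: radial_density_def unit_sphere_area_nonneg intro!: mult_left_mono)
  qed simp
  have c_int: "integrable lborel (\<lambda>s. ?c * ?p s)"
    by (intro integrable_mult_right integrable_real_indicator) (auto simp: emeasure_lborel_Icc_eq)
  have weight_int: "integrable lborel (\<lambda>s. radial_density DIM('a) s * ?p s)"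
    by (rule Bochner_Integration.integrable_bound[OF c_int])
      (use weight_le in \<open>auto simp: radial_density_nonneg intro!: AE_I2 order_trans[OF _ abs_ge_self]\<close>)
  then have shell_int: "integrable lborel (\<lambda>x::'a. ?p (norm x))"
    by (subst integrable_radial_iff) auto
  then show "integrable lebesgue (\<lambda>x::'a. ?p (norm x))" by (rule integrable_completionI)
  have "(\<integral>x. ?p (norm (x::'a)) \<partial>lebesgue) = (\<integral>s. radial_density DIM('a) s * ?p s \<partial>lborel)"
    using shell_int by (simp add: integral_completion integral_radial)
  also have "\<dots> \<le> (\<integral>s. ?c * ?p s \<partial>lborel)" by (rule integral_mono[OF weight_int c_int weight_le])
  also have "\<dots> = ?c * d" using assms by simp
  finally show "(\<integral>x. ?p (norm (x::'a)) \<partial>lebesgue) \<le> ?c * d" .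
qed

definition radial_cutoff :: "real \<Rightarrow> real \<Rightarrow> 'a::real_normed_vector \<Rightarrow> real" where
  "radial_cutoff k \<alpha> x = smooth_step (k * (norm x - \<alpha>))"

definition radial_cutoff_slope :: "real \<Rightarrow> real \<Rightarrow> 'a::real_normed_vector \<Rightarrow> real" where
  "radial_cutoff_slope k \<alpha> x = k * smooth_step_deriv (k * (norm x - \<alpha>))"

lemma C1_gradient_radial_cutoff:
  assumes "k \<ge> 0" "\<alpha> > 0"
  shows "C1_gradient (radial_cutoff k \<alpha>) (\<lambda>x::'a::euclidean_space. radial_cutoff_slope k \<alpha> x *\<^sub>R sgn x)"
proof -
  have "C1_gradient (\<lambda>x::'a. smooth_step (k * norm x + - (k * \<alpha>)))
      (\<lambda>x. (k * smooth_step_deriv (k * norm x + - (k * \<alpha>))) *\<^sub>R sgn x)"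
  proof (rule C1_gradient_radial[OF assms(2) _ smooth_step_affine_has_real_derivative])
    show "smooth_step (k * r + - (k * \<alpha>)) = 0" if "r < \<alpha>" for r
      using mult_left_mono[of r \<alpha> k] that assms(1) by (intro smooth_step_eq_0) simp
  qed (intro continuous_intros)
  then show ?thesis by (simp add: radial_cutoff_def[abs_def] radial_cutoff_slope_def right_diff_distrib)
qed

lemma radial_cutoff_mult_norm_le: "norm (radial_cutoff k \<alpha> x * h) \<le> norm (h::real)"
  by (simp add: radial_cutoff_def abs_mult smooth_step_nonneg smooth_step_le_1 mult_left_le_one_le)

lemma radial_cutoff_mult_integrable:
  fixes h :: "'a::euclidean_space \<Rightarrow> real"
  assumes "integrable lebesgue h"
  shows "integrable lebesgue (\<lambda>x. radial_cutoff k \<alpha> x * h x)"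
proof (rule Bochner_Integration.integrable_bound[OF assms])
  have "(radial_cutoff k \<alpha> :: 'a \<Rightarrow> real) \<in> borel_measurable lebesgue"
    unfolding radial_cutoff_def[abs_def] by (intro borel_measurable_lebesgue_continuous continuous_intros)
  then show "(\<lambda>x. radial_cutoff k \<alpha> x * h x) \<in> borel_measurable lebesgue" using assms by simp
qed (simp add: radial_cutoff_mult_norm_le del: real_norm_def)

lemma radial_cutoff_integral_tendsto:
  fixes h :: "'a::euclidean_space \<Rightarrow> real"
  assumes h: "integrable lebesgue h"
  shows "(\<lambda>k. \<integral>x. radial_cutoff (real (Suc k)) \<alpha> x * h x \<partial>lebesgue) \<longlonglongrightarrow> (\<integral>x. indicator {\<alpha><..} (norm x) * h x \<partial>lebesgue)"
proof (rule integral_dominated_convergence)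
  show "integrable lebesgue (\<lambda>x. norm (h x))" using h by simp
  have "(\<lambda>k. radial_cutoff (real (Suc k)) \<alpha> x) \<longlonglongrightarrow> indicator {\<alpha><..} (norm x)" for x :: 'a
    using LIMSEQ_Suc[OF smooth_step_scaled_tendsto[of "norm x - \<alpha>"]] by (simp add: radial_cutoff_def indicator_def)
  then show "AE x in lebesgue. (\<lambda>k. radial_cutoff (real (Suc k)) \<alpha> x * h x) \<longlonglongrightarrow> indicator {\<alpha><..} (norm x) * h x"
    by (intro AE_I2 tendsto_mult tendsto_const)
  show "(\<lambda>x. indicator {\<alpha><..} (norm x) * h x) \<in> borel_measurable lebesgue"
    using integrable_indicator_norm_mult[OF h, of "{\<alpha><..}"] by simp
  show "AE x in lebesgue. norm (radial_cutoff (real (Suc k)) \<alpha> x * h x) \<le> norm (h x)" for k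
    by (intro AE_I2 radial_cutoff_mult_norm_le)
qed (intro borel_measurable_integrable radial_cutoff_mult_integrable h)

lemma abs_radial_cutoff_slope_le:
  assumes "k > 0"
  shows "\<bar>radial_cutoff_slope k \<alpha> x\<bar> \<le> 2 * k * indicator {\<alpha>..\<alpha> + 1/k} (norm x)"
proof (cases "norm x \<in> {\<alpha>..\<alpha> + 1/k}")
  case True
  then show ?thesis
    using assms smooth_step_deriv_le by (simp add: radial_cutoff_slope_def abs_mult smooth_step_deriv_nonneg)
next
  case False
  then have "k * (norm x - \<alpha>) \<le> 0 \<or> k * (norm x - \<alpha>) \<ge> 1"
    using assms by (auto simp: mult_le_0_iff field_simps)
  then show ?thesis using False by (simp add: radial_cutoff_slope_def smooth_step_deriv_eq_0)
qed

lemma integral_radial_cutoff_slope_le: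
  fixes p :: "'a::euclidean_space \<Rightarrow> real"
  assumes \<alpha>_nonneg: "\<alpha> \<ge> 0" and k: "k \<ge> 1" and c_nonneg: "c \<ge> 0"
    and p_int: "integrable lebesgue (\<lambda>x. p x * radial_cutoff_slope k \<alpha> x)"
    and p_le: "AE x in lebesgue. norm x \<in> {\<alpha>..\<alpha> + 1/k} \<longrightarrow> \<bar>p x\<bar> \<le> c"
  shows "\<bar>\<integral>x. p x * radial_cutoff_slope k \<alpha> x \<partial>lebesgue\<bar> \<le> 2 * c * (unit_sphere_area DIM('a) * (\<alpha> + 1) ^ (DIM('a) - 1))"
proof -
  have k_inv: "0 \<le> 1/k" "1/k \<le> 1" using k by (auto simp: field_simps)
  let ?I = "\<lambda>x::'a. indicator {\<alpha>..\<alpha> + 1/k} (norm x) :: real"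
  note shell = lebesgue_measure_shell_le[OF \<alpha>_nonneg k_inv, where 'a='a]
  have "AE x in lebesgue. \<bar>p x * radial_cutoff_slope k \<alpha> x\<bar> \<le> c * (2 * k * ?I x)"
    using p_le
  proof eventually_elim
    case (elim x)
    have "\<bar>radial_cutoff_slope k \<alpha> x\<bar> \<le> 2 * k * ?I x" using k by (intro abs_radial_cutoff_slope_le) simp
    then show ?case
      using elim c_nonneg k by (cases "norm x \<in> {\<alpha>..\<alpha> + 1/k}") (auto simp: abs_mult intro!: mult_mono)
  qed
  then have "(\<integral>x. \<bar>p x * radial_cutoff_slope k \<alpha> x\<bar> \<partial>lebesgue) \<le> (\<integral>x. c * (2 * k * ?I x) \<partial>lebesgue)"
    using p_int shell(1) by (intro integral_mono_AE) auto
  also have "\<dots> \<le> 2 * c * k * (unit_sphere_area DIM('a) * (\<alpha> + 1) ^ (DIM('a) - 1) * (1/k))"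
    using k c_nonneg mult_left_mono[OF shell(2), of "2 * c * k"] by (simp add: mult_ac)
  also have "\<dots> = 2 * c * (unit_sphere_area DIM('a) * (\<alpha> + 1) ^ (DIM('a) - 1))" using k by simp
  finally show ?thesis by (rule order_trans[OF integral_abs_bound])
qed

text \<open>Cutting off at a zero of the profile produces no surface term: the cutoff has slope \<open>k\<close> on a shell
  of width \<open>1/k\<close>, on which the function is small.\<close>

lemma integral_radial_cutoff_slope_tendsto_0:
  fixes p :: "'a::euclidean_space \<Rightarrow> real"
  assumes \<alpha>_pos: "\<alpha> > 0" and v: "isCont v \<alpha>" "v \<alpha> = 0" and b_nonneg: "b \<ge> 0"
    and p_le: "AE x in lebesgue. \<bar>p x\<bar> \<le> b * \<bar>v (norm x)\<bar>"
    and p_int: "\<And>k. integrable lebesgue (\<lambda>x. p x * radial_cutoff_slope (real (Suc k)) \<alpha> x)"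
  shows "(\<lambda>k. \<integral>x. p x * radial_cutoff_slope (real (Suc k)) \<alpha> x \<partial>lebesgue) \<longlonglongrightarrow> 0"
    (is "?M \<longlonglongrightarrow> 0")
proof (rule LIMSEQ_I)
  fix e :: real assume e_pos: "e > 0"
  define c where "c = 2 * (b + 1) * (unit_sphere_area DIM('a) * (\<alpha> + 1) ^ (DIM('a) - 1))"
  have c_pos: "c > 0" using b_nonneg \<alpha>_pos unit_sphere_area_pos[of "DIM('a)"] by (simp add: c_def)
  define \<epsilon> where "\<epsilon> = e / (2 * c)"
  have \<epsilon>_pos: "\<epsilon> > 0" using e_pos c_pos by (simp add: \<epsilon>_def)
  obtain \<delta> where \<delta>: "\<delta> > 0" "\<And>r. \<bar>r - \<alpha>\<bar> < \<delta> \<Longrightarrow> \<bar>v r\<bar> < \<epsilon>"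
    using v \<epsilon>_pos unfolding continuous_at_eps_delta dist_real_def by fastforce
  obtain k0 :: nat where k0: "1 / \<delta> < real k0" using reals_Archimedean2 by blast
  have "norm (?M k - 0) < e" if k: "k \<ge> k0" for k
  proof -
    have "1 / \<delta> < real (Suc k)" using k k0 by simp
    then have width: "1 / real (Suc k) < \<delta>" using \<delta>(1) by (simp add: field_simps)
    have "AE x in lebesgue. norm x \<in> {\<alpha>..\<alpha> + 1 / real (Suc k)} \<longrightarrow> \<bar>p x\<bar> \<le> (b + 1) * \<epsilon>"
      using p_le
    proof eventually_elim
      case (elim x)
      show ?case
      proof
        assume "norm x \<in> {\<alpha>..\<alpha> + 1 / real (Suc k)}"
        then have "\<bar>v (norm x)\<bar> \<le> \<epsilon>" using width by (intro less_imp_le[OF \<delta>(2)]) auto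
        then have "b * \<bar>v (norm x)\<bar> \<le> (b + 1) * \<epsilon>" using b_nonneg by (intro mult_mono) auto
        with elim show "\<bar>p x\<bar> \<le> (b + 1) * \<epsilon>" by linarith
      qed
    qed
    then have "\<bar>?M k\<bar> \<le> 2 * ((b + 1) * \<epsilon>) * (unit_sphere_area DIM('a) * (\<alpha> + 1) ^ (DIM('a) - 1))"
      using \<alpha>_pos b_nonneg \<epsilon>_pos by (intro integral_radial_cutoff_slope_le p_int) auto
    also have "\<dots> = \<epsilon> * c" by (simp add: c_def)
    also have "\<dots> < e" using e_pos c_pos by (simp add: \<epsilon>_def)
    finally show ?thesis by simp
  qed
  then show "\<exists>k0. \<forall>k\<ge>k0. norm (?M k - 0) < e" by blast
qed

lemma weak_grad_outside_zero:
  fixes u :: "real^'n \<Rightarrow> real"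
  assumes wg: "weak_grad u g"
    and cont: "continuous_on {0<..} v" and uv: "AE x in lebesgue. u x = v (norm x)"
    and \<alpha>: "\<alpha> > 0" "v \<alpha> = 0" and \<phi>: "test_gradient \<phi> G"
  shows "(\<integral>x. indicator {\<alpha><..} (norm x) * (u x * G x $ i) \<partial>lebesgue)
    = - (\<integral>x. indicator {\<alpha><..} (norm x) * (g x $ i * \<phi> x) \<partial>lebesgue)"
proof -
  let ?\<eta> = "\<lambda>k. radial_cutoff (real (Suc k)) \<alpha>" and ?d = "\<lambda>k. radial_cutoff_slope (real (Suc k)) \<alpha>"
  note uncut = weak_gradD[OF wg \<phi>, where i=i]
  have cut_test: "test_gradient (\<lambda>x. \<phi> x * ?\<eta> k x) (\<lambda>x. \<phi> x *\<^sub>R (?d k x *\<^sub>R sgn x) + ?\<eta> k x *\<^sub>R G x)" for k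
    using \<alpha>(1) by (intro test_gradient_mult[OF \<phi> C1_gradient_radial_cutoff]) simp_all
  note cut = weak_gradD[OF wg cut_test, where i=i]
  define p where "p x = u x * (\<phi> x * sgn x $ i)" for x
  have split: "u x * (\<phi> x *\<^sub>R (?d k x *\<^sub>R sgn x) + ?\<eta> k x *\<^sub>R G x) $ i = ?\<eta> k x * (u x * G x $ i) + p x * ?d k x" for k x
    by (simp add: p_def algebra_simps)
  have p_int: "integrable lebesgue (\<lambda>x. p x * ?d k x)" for k
    using Bochner_Integration.integrable_diff[OF cut(1)[of k, unfolded split] radial_cutoff_mult_integrable[OF uncut(1), of "real (Suc k)" \<alpha>]] by simp
  have identity: "(\<integral>x. ?\<eta> k x * (u x * G x $ i) \<partial>lebesgue) + (\<integral>x. p x * ?d k x \<partial>lebesgue)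
      = - (\<integral>x. ?\<eta> k x * (g x $ i * \<phi> x) \<partial>lebesgue)" for k
    using cut(3)[of k, unfolded split] radial_cutoff_mult_integrable[OF uncut(1), of "real (Suc k)" \<alpha>] p_int[of k] by (simp add: mult_ac)
  obtain B where B: "B > 0" "\<And>x. norm (\<phi> x) \<le> B" using test_gradient_bounded[OF \<phi>] by metis
  have p_le: "AE x in lebesgue. \<bar>p x\<bar> \<le> B * \<bar>v (norm x)\<bar>"
    using uv
  proof eventually_elim
    case (elim x)
    have "\<bar>sgn x $ i\<bar> \<le> 1" using component_le_norm_cart[of "sgn x" i] norm_sgn[of x] by (simp split: if_splits)
    then have "\<bar>v (norm x)\<bar> * (\<bar>\<phi> x\<bar> * \<bar>sgn x $ i\<bar>) \<le> \<bar>v (norm x)\<bar> * (B * 1)"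
      using B by (intro mult_left_mono mult_mono) auto
    then show ?case using elim by (simp add: p_def abs_mult mult.commute)
  qed
  have v: "isCont v \<alpha>" using cont \<alpha>(1) by (simp add: continuous_on_eq_continuous_at)
  have "(\<lambda>k. \<integral>x. p x * ?d k x \<partial>lebesgue) \<longlonglongrightarrow> 0"
    using p_int less_imp_le[OF B(1)]
    by (intro integral_radial_cutoff_slope_tendsto_0[OF \<alpha>(1) v \<alpha>(2) _ p_le])
  from tendsto_add[OF radial_cutoff_integral_tendsto[OF uncut(1), of \<alpha>] this]
  have "(\<lambda>k. - (\<integral>x. ?\<eta> k x * (g x $ i * \<phi> x) \<partial>lebesgue)) \<longlonglongrightarrow> (\<integral>x. indicator {\<alpha><..} (norm x) * (u x * G x $ i) \<partial>lebesgue)"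
    unfolding identity by simp
  from LIMSEQ_unique[OF this tendsto_minus[OF radial_cutoff_integral_tendsto[OF uncut(2)]]] show ?thesis .
qed

lemma open_interval_bounded_below_cases:
  fixes C :: "real set"
  assumes "open C" "connected C" "C \<noteq> {}" "bdd_below C"
  obtains a where "C = {a<..}" | a b where "C = {a<..<b}" "a < b"
proof -
  have "\<not> {..<b} \<subseteq> C" for b
  proof
    assume "{..<b} \<subseteq> C"
    then have below: "min m b - 1 \<in> C" for m by auto
    obtain m where "\<forall>x\<in>C. m \<le> x" using assms(4) by (auto simp: bdd_below_def)
    then have "m \<le> min m b - 1" using below by blast
    then show False by linarith
  qed
  moreover have "{..<b} \<subseteq> UNIV" "{..<b} \<subseteq> {..b}" for b :: real by auto
  moreover obtain a b where "C = {} \<or> C = UNIV \<or> C = {..<b} \<or> C = {..b} \<or> C = {a<..} \<or> C = {a..} \<or>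
      C = {a<..<b} \<or> C = {a<..b} \<or> C = {a..<b} \<or> C = {a..b}"
    using interval_cases[of C] assms(2) by (meson connected_iff_interval)
  ultimately have "C = {a<..} \<or> C = {a..} \<or> C = {a<..<b} \<or> C = {a<..b} \<or> C = {a..<b} \<or> C = {a..b}"
    using assms(3) by (metis order_refl)
  then have "interior C = {a<..} \<or> interior C = {a<..<b}"
    by (elim disjE) (simp_all add: interior_open)
  then have "C = {a<..} \<or> C = {a<..<b}" using assms(1) by (simp add: interior_open)
  then show ?thesis using that assms(3) by (metis greaterThanLessThan_empty_iff not_less)
qed

lemma zero_at_component_boundary:
  fixes v :: "real \<Rightarrow> real"
  assumes C: "C \<in> components {r. r > 0 \<and> v r > 0}" and s: "s > 0" "isCont v s" "s \<in> closure C" "s \<notin> C"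
  shows "v s = 0"
proof -
  have sub: "C \<subseteq> {r. r > 0 \<and> v r > 0}" using C in_components_subset by blast
  obtain x where x: "\<And>n. x n \<in> C" "x \<longlonglongrightarrow> s" using s(3) unfolding closure_sequential by blast
  have "(\<lambda>n. v (x n)) \<longlonglongrightarrow> v s" using s(2) x(2) by (rule isCont_tendsto_compose)
  then have "0 \<le> v s" using x(1) sub by (intro LIMSEQ_le_const) (force intro: less_imp_le)+
  moreover have "\<not> v s > 0"
  proof
    assume "v s > 0"
    have "connected (insert s C)"
      by (rule connected_intermediate_closure[of C]) (use C in_components_connected s(3) closure_subset in auto)
    moreover have "C \<inter> insert s C \<noteq> {}" using C in_components_nonempty by blast
    ultimately have "insert s C \<subseteq> C"
      using components_maximal[OF C, of "insert s C"] sub s(1) \<open>v s > 0\<close> by auto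
    then show False using s(4) by blast
  qed
  ultimately show ?thesis by simp
qed

lemma set_integral_zero_disjoint_UN:
  fixes f :: "'a \<Rightarrow> real"
  assumes I: "countable I" "disjoint_family_on B I" "\<And>i. i \<in> I \<Longrightarrow> B i \<in> sets M"
    and f: "set_integrable M (\<Union>i\<in>I. B i) f" and zero: "\<And>i. i \<in> I \<Longrightarrow> (\<integral>x\<in>B i. f x \<partial>M) = 0"
  shows "(\<integral>x\<in>(\<Union>i\<in>I. B i). f x \<partial>M) = 0"
proof -
  define A where "A n = (\<Union>i\<in>{i\<in>I. to_nat_on I i = n}. B i)" for n
  have A_cases: "A n = {} \<or> (\<exists>i\<in>I. A n = B i)" for n
  proof (cases "\<exists>i\<in>I. to_nat_on I i = n")
    case True
    then obtain i where i: "i \<in> I" "to_nat_on I i = n" by blast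
    then have "{i\<in>I. to_nat_on I i = n} = {i}" using I(1) by auto
    then show ?thesis using i(1) by (auto simp: A_def)
  qed (auto simp: A_def)
  have A_UN: "(\<Union>i\<in>I. B i) = (\<Union>n. A n)" unfolding A_def by blast
  have "(\<integral>x\<in>(\<Union>n. A n). f x \<partial>M) = (\<Sum>n. (\<integral>x\<in>A n. f x \<partial>M))"
  proof (rule lebesgue_integral_countable_add)
    show "A n \<in> sets M" for n using A_cases[of n] I(3) by auto
    show "A m \<inter> A n = {}" if "m \<noteq> n" for m n
    proof -
      have "B i \<inter> B j = {}" if "i \<in> I" "j \<in> I" "i \<noteq> j" for i j
        using I(2) that by (simp add: disjoint_family_on_def)
      then show ?thesis using that unfolding A_def by blast
    qed
    show "set_integrable M (\<Union>n. A n) f" using f by (simp only: A_UN)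
  qed
  moreover have "(\<integral>x\<in>A n. f x \<partial>M) = 0" for n
    using A_cases[of n] zero by (auto simp: set_lebesgue_integral_def)
  ultimately show ?thesis by (simp add: A_UN)
qed

lemma integral_over_components_eq_0:
  fixes h :: "'a::euclidean_space \<Rightarrow> real"
  assumes S: "open S" and h: "integrable lebesgue h"
    and zero: "\<And>C. C \<in> components S \<Longrightarrow> (\<integral>x. indicator C (norm x) * h x \<partial>lebesgue) = 0"
  shows "(\<integral>x. indicator S (norm x) * h x \<partial>lebesgue) = 0"
proof -
  have countable: "countable (components S)"
  proof (rule countable_disjoint_open_subsets)
    show "open C" if "C \<in> components S" for C using that S open_components by blast
    show "pairwise disjnt (components S)"
      using pairwise_disjoint_components[of S] by (simp add: pairwise_def disjnt_def)
  qed
  let ?B = "\<lambda>C. {x::'a. norm x \<in> C}"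
  have indicator_B: "indicator (?B C) x *\<^sub>R h x = indicator C (norm x) * h x" for C x
    by (simp add: indicator_def)
  have union: "(\<Union>C\<in>components S. ?B C) = ?B S" using Union_components[of S] by blast
  have "(\<integral>x\<in>(\<Union>C\<in>components S. ?B C). h x \<partial>lebesgue) = 0"
  proof (rule set_integral_zero_disjoint_UN[OF countable])
    show "disjoint_family_on ?B (components S)"
      using components_nonoverlap unfolding disjoint_family_on_def by fastforce
    fix C assume C: "C \<in> components S"
    have "open C" using C S open_components by blast
    then have "open (norm -` C :: 'a set)" by (intro open_vimage continuous_intros)
    then have "open (?B C)" by (simp add: vimage_def)
    then show "?B C \<in> sets lebesgue" by auto
    show "(\<integral>x\<in>?B C. h x \<partial>lebesgue) = 0"
      unfolding set_lebesgue_integral_def indicator_B by (rule zero[OF C])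
  next
    show "set_integrable lebesgue (\<Union>C\<in>components S. ?B C) h"
      unfolding union set_integrable_def indicator_B using S h by (intro integrable_indicator_norm_mult) auto
  qed
  then show ?thesis unfolding union set_lebesgue_integral_def indicator_B .
qed

lemma open_positive_set:
  fixes v :: "real \<Rightarrow> real"
  assumes "continuous_on {0<..} v"
  shows "open {r. r > 0 \<and> v r > 0}"
proof -
  have "open ({0<..} \<inter> v -` {0<..})" using assms by (intro continuous_open_preimage) auto
  moreover have "{0<..} \<inter> v -` {0<..} = {r. r > 0 \<and> v r > 0}" by auto
  ultimately show ?thesis by metis
qed

lemma positive_component_cases:
  fixes v :: "real \<Rightarrow> real"
  assumes cont: "continuous_on {0<..} v" and C: "C \<in> components {r. r > 0 \<and> v r > 0}"
  obtains a where "C = {a<..}" "a = 0 \<or> a > 0 \<and> v a = 0"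
    | a b where "C = {a<..<b}" "a < b" "a = 0 \<or> a > 0 \<and> v a = 0" "b > 0 \<and> v b = 0"
proof -
  have C_sub: "C \<subseteq> {0<..}" using in_components_subset[OF C] by auto
  have C_open: "open C" using open_positive_set[OF cont] C open_components by blast
  have boundary: "v s = 0" if "s > 0" "s \<in> closure C" "s \<notin> C" for s
    using zero_at_component_boundary[OF C that(1) _ that(2,3)] cont that(1) by (simp add: continuous_on_eq_continuous_at)
  have "bdd_below C" using C_sub by (intro bdd_belowI[of _ 0]) auto
  with C_open in_components_connected[OF C] in_components_nonempty[OF C] show ?thesis
  proof (cases rule: open_interval_bounded_below_cases)
    case (1 a)
    then have "a \<ge> 0" using C_sub by auto
    then have "a = 0 \<or> a > 0 \<and> v a = 0" using boundary[of a] 1 by (cases "a = 0") auto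
    then show ?thesis using that(1) 1 by blast
  next
    case (2 a b)
    have "a \<ge> 0"
    proof (rule ccontr)
      assume "\<not> a \<ge> 0"
      then obtain x where "a < x" "x < min b 0" using dense[of a "min b 0"] \<open>a < b\<close> by auto
      then show False using C_sub 2(1) by auto
    qed
    then have "a = 0 \<or> a > 0 \<and> v a = 0" "b > 0 \<and> v b = 0"
      using boundary[of a] boundary[of b] 2 by (cases "a = 0"; auto)+
    then show ?thesis using that(2) 2 by blast
  qed
qed

lemma weak_grad_on_half_line:
  fixes u :: "real^'n \<Rightarrow> real"
  assumes wg: "weak_grad u g"
    and cont: "continuous_on {0<..} v" and uv: "AE x in lebesgue. u x = v (norm x)"
    and \<phi>: "test_gradient \<phi> G" and \<alpha>: "\<alpha> = 0 \<or> \<alpha> > 0 \<and> v \<alpha> = 0"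
  shows "(\<integral>x. indicator {\<alpha><..} (norm x) * (u x * G x $ i + g x $ i * \<phi> x) \<partial>lebesgue) = 0"
  using \<alpha>
proof
  let ?h = "\<lambda>x. u x * G x $ i + g x $ i * \<phi> x"
  assume "\<alpha> = 0"
  have "AE x in lebesgue. indicator {\<alpha><..} (norm x) * ?h x = ?h x"
    using AE_neq_0 by eventually_elim (simp add: \<open>\<alpha> = 0\<close>)
  then have "(\<integral>x. indicator {\<alpha><..} (norm x) * ?h x \<partial>lebesgue) = (\<integral>x. ?h x \<partial>lebesgue)"
    by (rule lebesgue_integral_cong_AE(2))
  then show ?thesis using weak_gradD[OF wg \<phi>] by simp
next
  note by_parts = weak_gradD[OF wg \<phi>, where i=i]
  assume "\<alpha> > 0 \<and> v \<alpha> = 0"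
  then have "(\<integral>x. indicator {\<alpha><..} (norm x) * (u x * G x $ i) \<partial>lebesgue)
      = - (\<integral>x. indicator {\<alpha><..} (norm x) * (g x $ i * \<phi> x) \<partial>lebesgue)"
    using weak_grad_outside_zero[OF wg cont uv _ _ \<phi>] by blast
  then show ?thesis
    using integrable_indicator_norm_mult[OF by_parts(1), of "{\<alpha><..}"]
      integrable_indicator_norm_mult[OF by_parts(2), of "{\<alpha><..}"] by (simp add: distrib_left)
qed

lemma weak_grad_on_positive_component:
  fixes u :: "real^'n \<Rightarrow> real"
  assumes wg: "weak_grad u g"
    and cont: "continuous_on {0<..} v" and uv: "AE x in lebesgue. u x = v (norm x)"
    and \<phi>: "test_gradient \<phi> G" and C: "C \<in> components {r. r > 0 \<and> v r > 0}"
  shows "(\<integral>x. indicator C (norm x) * (u x * G x $ i + g x $ i * \<phi> x) \<partial>lebesgue) = 0"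
proof -
  let ?h = "\<lambda>x. u x * G x $ i + g x $ i * \<phi> x"
  note half_line = weak_grad_on_half_line[OF wg cont uv \<phi>, where i=i]
  from cont C show ?thesis
  proof (cases rule: positive_component_cases)
    case (1 a)
    then show ?thesis using half_line by simp
  next
    case (2 a b)
    have h: "integrable lebesgue ?h" using weak_gradD(1,2)[OF wg \<phi>, where i=i] by simp
    have "AE x in lebesgue. indicator C (norm x) * ?h x
        = indicator {a<..} (norm x) * ?h x - indicator {b<..} (norm x) * ?h x"
      using AE_norm_neq[of b] by eventually_elim (use 2 in \<open>auto simp: indicator_def\<close>)
    from lebesgue_integral_cong_AE(2)[OF this] show ?thesis
      using half_line[OF 2(3)] half_line[OF disjI2[OF 2(4)]]
        integrable_indicator_norm_mult[OF h, of "{a<..}"] integrable_indicator_norm_mult[OF h, of "{b<..}"] by simp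
  qed
qed

theorem weak_grad_positive_part:
  fixes u :: "real^'n \<Rightarrow> real"
  assumes wg: "weak_grad u g"
    and cont: "continuous_on {0<..} v" and uv: "AE x in lebesgue. u x = v (norm x)"
  shows "weak_grad (\<lambda>x. max 0 (u x)) (\<lambda>x. indicator {r. r > 0 \<and> v r > 0} (norm x) *\<^sub>R g x)"
proof (rule weak_gradI)
  let ?O = "{r. r > 0 \<and> v r > 0}"
  note O = open_positive_set[OF cont]
  show "(\<lambda>x. indicator ?O (norm x) *\<^sub>R g x) \<in> borel_measurable lebesgue"
    using O by (intro borel_measurable_scaleR borel_measurable_lebesgue_indicator_norm weak_grad_measurable[OF wg]) auto
  fix i :: 'n and \<phi> :: "real^'n \<Rightarrow> real" and G assume \<phi>: "test_gradient \<phi> G"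
  note by_parts = weak_gradD[OF wg \<phi>, where i=i]
  have uG: "integrable lebesgue (\<lambda>x. indicator ?O (norm x) * (u x * G x $ i))"
    and g\<phi>: "integrable lebesgue (\<lambda>x. indicator ?O (norm x) * (g x $ i * \<phi> x))"
    using O by_parts by (auto intro!: integrable_indicator_norm_mult)
  have AE_eq: "AE x in lebesgue. max 0 (u x) * G x $ i = indicator ?O (norm x) * (u x * G x $ i)"
    using uv AE_neq_0 by eventually_elim (auto simp: indicator_def max_def)
  show "integrable lebesgue (\<lambda>x. max 0 (u x) * G x $ i)"
    using uG lebesgue_integral_cong_AE(1)[OF AE_eq] by simp
  show "integrable lebesgue (\<lambda>x. (indicator ?O (norm x) *\<^sub>R g x) $ i * \<phi> x)"
    using g\<phi> by (simp add: mult.assoc)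
  have "(\<integral>x. indicator ?O (norm x) * (u x * G x $ i + g x $ i * \<phi> x) \<partial>lebesgue) = 0"
    using by_parts weak_grad_on_positive_component[OF wg cont uv \<phi>]
    by (intro integral_over_components_eq_0[OF O]) auto
  then show "(\<integral>x. max 0 (u x) * G x $ i \<partial>lebesgue) = - (\<integral>x. (indicator ?O (norm x) *\<^sub>R g x) $ i * \<phi> x \<partial>lebesgue)"
    using uG g\<phi> lebesgue_integral_cong_AE(2)[OF AE_eq] by (simp add: distrib_left mult.assoc)
qed

section \<open>The energy space\<close>

lemma abs_add_powr_le:
  fixes a b p :: real
  assumes "p \<ge> 0"
  shows "\<bar>a + b\<bar> powr p \<le> 2 powr p * (\<bar>a\<bar> powr p + \<bar>b\<bar> powr p)"
proof -
  have "\<bar>a + b\<bar> powr p \<le> (2 * max \<bar>a\<bar> \<bar>b\<bar>) powr p" by (rule powr_mono2[OF assms]) auto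
  also have "\<dots> = 2 powr p * max \<bar>a\<bar> \<bar>b\<bar> powr p" by (simp add: powr_mult)
  also have "\<dots> \<le> 2 powr p * (\<bar>a\<bar> powr p + \<bar>b\<bar> powr p)"
    by (intro mult_left_mono) (auto simp: max_def)
  finally show ?thesis .
qed

lemma integrable_abs_add_powr:
  fixes u h :: "'a \<Rightarrow> real"
  assumes "p \<ge> 0" "u \<in> borel_measurable M" "h \<in> borel_measurable M"
    and "integrable M (\<lambda>x. \<bar>u x\<bar> powr p)" "integrable M (\<lambda>x. \<bar>h x\<bar> powr p)"
  shows "integrable M (\<lambda>x. \<bar>u x + c * h x\<bar> powr p)"
proof (rule Bochner_Integration.integrable_bound)
  show "integrable M (\<lambda>x. 2 powr p * (\<bar>u x\<bar> powr p + \<bar>c\<bar> powr p * \<bar>h x\<bar> powr p))"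
    using assms(4,5) by simp
  show "(\<lambda>x. \<bar>u x + c * h x\<bar> powr p) \<in> borel_measurable M" using assms(2,3) by measurable
  show "AE x in M. norm (\<bar>u x + c * h x\<bar> powr p) \<le> norm (2 powr p * (\<bar>u x\<bar> powr p + \<bar>c\<bar> powr p * \<bar>h x\<bar> powr p))"
    using abs_add_powr_le[OF assms(1), of "u _" "c * h _"] by (auto simp: abs_mult powr_mult)
qed

lemma radial_add_scaled: "radial u \<Longrightarrow> radial h \<Longrightarrow> radial (\<lambda>x. u x + c * h x)"
  unfolding radial_def
proof (elim exE)
  fix v w assume "AE x in lebesgue. u x = v (norm x)" "AE x in lebesgue. h x = w (norm x)"
  then have "AE x in lebesgue. u x + c * h x = (\<lambda>r. v r + c * w r) (norm x)" by eventually_elim simp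
  then show "\<exists>v. AE x in lebesgue. u x + c * h x = v (norm x)" by (rule exI[of _ "\<lambda>r. v r + c * w r"])
qed

lemma D12I:
  fixes u :: "real^'n \<Rightarrow> real"
  assumes "u \<in> borel_measurable lebesgue"
    and "integrable lebesgue (\<lambda>x. \<bar>u x\<bar> powr (2 * real CARD('n) / (real CARD('n) - 2)))"
    and "weak_grad u g" "square_integrable lebesgue g"
  shows "D12 u"
  using assms unfolding D12_def square_integrable_def by blast

lemma critical_powr_bound:
  fixes m r B t :: real
  assumes m_pos: "m > 0" and r_pos: "r > 0" and B_nonneg: "B \<ge> 0" and t: "\<bar>t\<bar> \<le> B * sqrt (r powr (- m))"
  shows "\<bar>t\<bar> powr (2 * (m + 2) / m) \<le> B powr (4 / m) * (t\<^sup>2 / r\<^sup>2)"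
proof (cases "t = 0")
  case False
  have "\<bar>t\<bar> powr (2 * (m + 2) / m) = \<bar>t\<bar> powr (4 / m + 2)" using m_pos by (simp add: field_simps)
  also have "\<dots> = \<bar>t\<bar> powr (4 / m) * t\<^sup>2" using False by (simp add: powr_add)
  also have "\<dots> \<le> (B * sqrt (r powr (- m))) powr (4 / m) * t\<^sup>2"
    using m_pos t by (intro mult_right_mono powr_mono2) auto
  also have "(B * sqrt (r powr (- m))) powr (4 / m) = B powr (4 / m) * (r powr (- m / 2)) powr (4 / m)"
  proof -
    have "sqrt (r powr (- m)) = r powr (- m / 2)" by (simp add: powr_half_sqrt[symmetric] powr_powr)
    then show ?thesis using B_nonneg by (simp add: powr_mult)
  qed
  also have "(r powr (- m / 2)) powr (4 / m) = 1 / r\<^sup>2"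
  proof -
    have "(r powr (- m / 2)) powr (4 / m) = r powr (- 2)" unfolding powr_powr using m_pos by simp
    also have "\<dots> = 1 / r\<^sup>2" using r_pos by (simp add: powr_minus_divide)
    finally show ?thesis .
  qed
  finally show ?thesis by simp
qed simp

lemma square_integrable_component_mult:
  fixes h :: "'a \<Rightarrow> real^'n" and \<phi> :: "'a \<Rightarrow> real"
  assumes h: "square_integrable M h" and \<phi>: "square_integrable M \<phi>"
  shows "integrable M (\<lambda>x. h x $ i * \<phi> x)" "\<bar>\<integral>x. h x $ i * \<phi> x \<partial>M\<bar> \<le> L2_norm M h * L2_norm M \<phi>"
proof -
  have "(\<lambda>x. h x $ i) \<in> borel_measurable M"
    by (rule measurable_compose[OF square_integrableD(1)[OF h] borel_measurable_continuous_onI]) (intro continuous_intros)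
  then have meas: "(\<lambda>x. h x $ i * \<phi> x) \<in> borel_measurable M" using square_integrableD(1)[OF \<phi>] by simp
  have abs_le: "AE x in M. \<bar>h x $ i * \<phi> x\<bar> \<le> norm (h x) * norm (\<phi> x)"
    by (auto simp: abs_mult component_le_norm_cart intro!: mult_right_mono)
  show "integrable M (\<lambda>x. h x $ i * \<phi> x)" "\<bar>\<integral>x. h x $ i * \<phi> x \<partial>M\<bar> \<le> L2_norm M h * L2_norm M \<phi>"
    using integrable_if_le_norm_mult_norm[OF h \<phi> meas abs_le] by simp_all
qed

lemma L2_tendsto_component_mult:
  fixes gs :: "nat \<Rightarrow> 'a \<Rightarrow> real^'n" and \<phi> :: "'a \<Rightarrow> real"
  assumes g: "\<And>j. square_integrable M (gs j)" "square_integrable M g" "(\<lambda>j. L2_norm M (\<lambda>x. gs j x - g x)) \<longlonglongrightarrow> 0"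
    and \<phi>: "square_integrable M \<phi>"
  shows "(\<lambda>j. \<integral>x. gs j x $ i * \<phi> x \<partial>M) \<longlonglongrightarrow> (\<integral>x. g x $ i * \<phi> x \<partial>M)"
proof -
  have "(\<lambda>j. (\<integral>x. gs j x $ i * \<phi> x \<partial>M) - (\<integral>x. g x $ i * \<phi> x \<partial>M)) \<longlonglongrightarrow> 0"
  proof (rule Lim_null_comparison)
    have "(\<integral>x. gs j x $ i * \<phi> x \<partial>M) - (\<integral>x. g x $ i * \<phi> x \<partial>M) = (\<integral>x. (gs j x - g x) $ i * \<phi> x \<partial>M)" for j
      using square_integrable_component_mult(1)[OF g(1) \<phi>] square_integrable_component_mult(1)[OF g(2) \<phi>]
      by (simp add: left_diff_distrib)
    then show "\<forall>\<^sub>F j in sequentially. norm ((\<integral>x. gs j x $ i * \<phi> x \<partial>M) - (\<integral>x. g x $ i * \<phi> x \<partial>M))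
        \<le> L2_norm M (\<lambda>x. gs j x - g x) * L2_norm M \<phi>"
      using square_integrable_component_mult(2)[OF square_integrable_diff[OF g(1,2)] \<phi>] by simp
    show "(\<lambda>j. L2_norm M (\<lambda>x. gs j x - g x) * L2_norm M \<phi>) \<longlonglongrightarrow> 0" by (rule tendsto_mult_left_zero[OF g(3)])
  qed
  then show ?thesis by (simp add: LIM_zero_iff)
qed

proposition weak_grad_limit:
  fixes u :: "real^'n \<Rightarrow> real"
  assumes wg: "\<And>j. weak_grad (us j) (gs j)"
    and u: "u \<in> borel_measurable lebesgue" "AE x in lebesgue. (\<lambda>j. us j x) \<longlonglongrightarrow> u x"
    and D: "\<And>R. integrable lebesgue (\<lambda>x. indicator {..R} (norm x) * D x)" "\<And>j. AE x in lebesgue. \<bar>us j x\<bar> \<le> D x"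
    and g: "\<And>j. square_integrable lebesgue (gs j)" "square_integrable lebesgue g"
      "(\<lambda>j. L2_norm lebesgue (\<lambda>x. gs j x - g x)) \<longlonglongrightarrow> 0"
  shows "weak_grad u g"
proof (rule weak_gradI[OF square_integrableD(1)[OF g(2)]])
  fix i :: 'n and \<phi> :: "real^'n \<Rightarrow> real" and G assume \<phi>: "test_gradient \<phi> G"
  note by_parts = weak_gradD[OF wg \<phi>, where i=i]
  obtain R where R: "\<And>x. G x \<noteq> 0 \<Longrightarrow> norm x \<le> R"
    using test_gradient_bounded_support[OF \<phi>] by (auto simp: bounded_iff)
  obtain b where b: "b > 0" "\<And>x. norm (G x) \<le> b" using test_gradient_bounded[OF \<phi>] by metis
  let ?dom = "\<lambda>x. b * (indicator {..R} (norm x) * D x)"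
  have dom_int: "integrable lebesgue ?dom" using D(1) by (rule integrable_mult_right)
  have G_meas: "(\<lambda>x. G x $ i) \<in> borel_measurable lebesgue"
    using test_gradientD(2)[OF \<phi>] by (intro borel_measurable_lebesgue_continuous continuous_intros)
  have dominated: "AE x in lebesgue. norm (us j x * G x $ i) \<le> ?dom x" for j
    using D(2)[of j]
  proof eventually_elim
    case (elim x)
    have "\<bar>us j x\<bar> * \<bar>G x $ i\<bar> \<le> D x * b"
      using elim b(2)[of x] component_le_norm_cart[of "G x" i] by (intro mult_mono) auto
    moreover have "0 \<le> D x" using elim by linarith
    ultimately show ?case using R[of x] b(1) by (cases "G x = 0") (auto simp: abs_mult mult.commute)
  qed
  have lim: "AE x in lebesgue. (\<lambda>j. us j x * G x $ i) \<longlonglongrightarrow> u x * G x $ i"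
    using u(2) by eventually_elim (intro tendsto_intros)
  have uG_meas: "(\<lambda>x. u x * G x $ i) \<in> borel_measurable lebesgue" using u(1) G_meas by simp
  show "integrable lebesgue (\<lambda>x. u x * G x $ i)"
    by (rule integrable_dominated_convergence[OF uG_meas borel_measurable_integrable[OF by_parts(1)] dom_int lim dominated])
  have lim_uG: "(\<lambda>j. \<integral>x. us j x * G x $ i \<partial>lebesgue) \<longlonglongrightarrow> (\<integral>x. u x * G x $ i \<partial>lebesgue)"
    by (rule integral_dominated_convergence[OF uG_meas borel_measurable_integrable[OF by_parts(1)] dom_int lim dominated])
  have \<phi>_si: "square_integrable lebesgue \<phi>"
    by (rule square_integrable_continuous_bounded_support[OF test_gradientD(3,4)[OF \<phi>]])
  show "integrable lebesgue (\<lambda>x. g x $ i * \<phi> x)" by (rule square_integrable_component_mult(1)[OF g(2) \<phi>_si])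
  from tendsto_minus[OF L2_tendsto_component_mult[OF g \<phi>_si]] lim_uG
  show "(\<integral>x. u x * G x $ i \<partial>lebesgue) = - (\<integral>x. g x $ i * \<phi> x \<partial>lebesgue)"
    unfolding by_parts(3) using LIMSEQ_unique by blast
qed

definition Hardy_weight :: "(real \<Rightarrow> real) \<Rightarrow> real \<Rightarrow> real" where
  "Hardy_weight V r = V r + 1 / r\<^sup>2"

locale radial_potential =
  fixes V :: "real \<Rightarrow> real" and space_type :: "'n::finite itself"
  assumes dim: "CARD('n) \<ge> 3"
    and V_cont: "continuous_on {0<..} V" and V_nonneg: "\<And>r. r > 0 \<Longrightarrow> V r \<ge> 0"
begin

lemma dim_vec: "DIM(real^'n) \<ge> 3"
  using dim by simp

lemma V_measurable: "(\<lambda>x::real^'n. V (norm x)) \<in> borel_measurable lebesgue"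
  using borel_measurable_radial[OF V_cont] by (auto intro: measurable_completion)

definition admissible :: "(real^'n \<Rightarrow> real) \<Rightarrow> (real^'n \<Rightarrow> real^'n) \<Rightarrow> bool" where
  "admissible u g \<longleftrightarrow> H1Vr V u \<and> weak_grad u g \<and> square_integrable lebesgue g"

definition form :: "(real^'n \<Rightarrow> real) \<Rightarrow> (real^'n \<Rightarrow> real^'n) \<Rightarrow> (real^'n \<Rightarrow> real) \<Rightarrow> (real^'n \<Rightarrow> real^'n) \<Rightarrow> real" where
  "form u g h k = (\<integral>x. g x \<bullet> k x \<partial>lebesgue) + (\<integral>x. V (norm x) * u x * h x \<partial>lebesgue)"

definition norm_sq :: "(real^'n \<Rightarrow> real) \<Rightarrow> (real^'n \<Rightarrow> real^'n) \<Rightarrow> real" where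
  "norm_sq u g = form u g u g"

lemma norm_sq_eq: "norm_sq u g = (L2_norm lebesgue g)\<^sup>2 + (\<integral>x. V (norm x) * (u x)\<^sup>2 \<partial>lebesgue)"
  unfolding norm_sq_def form_def L2_norm_power2 power2_norm_eq_inner by (simp add: power2_eq_square mult.assoc)

lemma V_term_nonneg: "AE x::real^'n in lebesgue. 0 \<le> V (norm x) * (u x)\<^sup>2"
  using AE_neq_0 by eventually_elim (simp add: V_nonneg)

lemma norm_sq_nonneg: "norm_sq u g \<ge> 0"
  unfolding norm_sq_eq by (intro add_nonneg_nonneg integral_nonneg_AE V_term_nonneg) auto

lemma L2_norm_gradient_le: "(L2_norm lebesgue g)\<^sup>2 \<le> norm_sq u g"
  unfolding norm_sq_eq using integral_nonneg_AE[OF V_term_nonneg, of u] by simp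

lemma square_integrable_sqrt_V_iff:
  assumes "u \<in> borel_measurable lebesgue"
  shows "square_integrable lebesgue (\<lambda>x::real^'n. sqrt (V (norm x)) * u x)
    \<longleftrightarrow> integrable lebesgue (\<lambda>x. V (norm x) * (u x)\<^sup>2)"
proof -
  have "(\<lambda>x. sqrt (V (norm x)) * u x) \<in> borel_measurable lebesgue"
    using V_measurable assms by (intro borel_measurable_times measurable_compose[OF V_measurable borel_measurable_sqrt]) auto
  moreover have "AE x in lebesgue. (norm (sqrt (V (norm x)) * u x))\<^sup>2 = V (norm x) * (u x)\<^sup>2"
    using AE_neq_0 by eventually_elim (simp add: power_mult_distrib V_nonneg)
  ultimately show ?thesis
    unfolding square_integrable_def by (simp add: lebesgue_integral_cong_AE(1))
qed

lemma admissibleD: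
  assumes "admissible u g"
  shows "u \<in> borel_measurable lebesgue" "square_integrable lebesgue g"
    "integrable lebesgue (\<lambda>x. V (norm x) * (u x)\<^sup>2)" "D12 u" "radial u" "weak_grad u g"
    "integrable lebesgue (\<lambda>x. \<bar>u x\<bar> powr (2 * real CARD('n) / (real CARD('n) - 2)))"
    "square_integrable lebesgue (\<lambda>x. sqrt (V (norm x)) * u x)"
  using assms square_integrable_sqrt_V_iff[of u] by (auto simp: admissible_def H1Vr_def D12_def)

lemma admissibleI:
  assumes u: "u \<in> borel_measurable lebesgue" and "radial u"
    and "integrable lebesgue (\<lambda>x. \<bar>u x\<bar> powr (2 * real CARD('n) / (real CARD('n) - 2)))"
    and "integrable lebesgue (\<lambda>x. V (norm x) * (u x)\<^sup>2)"
    and "weak_grad u g" "square_integrable lebesgue g"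
  shows "admissible u g"
  using assms D12I[OF u] unfolding admissible_def H1Vr_def by blast

lemma admissible_add_scaleR:
  assumes "admissible u g" "admissible h k"
  shows "admissible (\<lambda>x. u x + c * h x) (\<lambda>x. g x + c *\<^sub>R k x)"
proof (rule admissibleI)
  note u = admissibleD[OF assms(1)] and h = admissibleD[OF assms(2)]
  show meas: "(\<lambda>x. u x + c * h x) \<in> borel_measurable lebesgue" using u(1) h(1) by simp
  show "integrable lebesgue (\<lambda>x. \<bar>u x + c * h x\<bar> powr (2 * real CARD('n) / (real CARD('n) - 2)))"
    using dim by (intro integrable_abs_add_powr u h) auto
  have "square_integrable lebesgue (\<lambda>x. sqrt (V (norm x)) * u x + c *\<^sub>R (sqrt (V (norm x)) * h x))"
    by (intro square_integrable_add square_integrable_scaleR u h)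
  then show "integrable lebesgue (\<lambda>x. V (norm x) * (u x + c * h x)\<^sup>2)"
    using square_integrable_sqrt_V_iff[OF meas] by (simp add: algebra_simps)
  show "radial (\<lambda>x. u x + c * h x)" by (intro radial_add_scaled u h)
  show "weak_grad (\<lambda>x. u x + c * h x) (\<lambda>x. g x + c *\<^sub>R k x)" by (intro weak_grad_add_scaleR u h)
  show "square_integrable lebesgue (\<lambda>x. g x + c *\<^sub>R k x)"
    by (intro square_integrable_add square_integrable_scaleR u h)
qed

lemma admissible_zero: "admissible (\<lambda>_. 0) (\<lambda>_. 0)"
proof (rule admissibleI)
  show "weak_grad (\<lambda>_. 0) (\<lambda>_. 0)" by (rule C1_gradient_imp_weak_grad[OF C1_gradient_const])
qed (auto simp: radial_def square_integrable_def intro!: exI[of _ "\<lambda>_. 0"])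

lemma admissible_scaleR: "admissible u g \<Longrightarrow> admissible (\<lambda>x. c * u x) (\<lambda>x. c *\<^sub>R g x)"
  using admissible_add_scaleR[OF admissible_zero, of u g c] by simp

lemma admissible_average:
  assumes "admissible u g" "admissible h k"
  shows "admissible (\<lambda>x. (u x + h x) / 2) (\<lambda>x. (1/2) *\<^sub>R (g x + k x))"
  using admissible_scaleR[OF admissible_add_scaleR[OF assms, of 1], of "1/2"] by simp

lemma form_integrable:
  assumes "admissible u g" "admissible h k"
  shows "integrable lebesgue (\<lambda>x. g x \<bullet> k x)" "integrable lebesgue (\<lambda>x. V (norm x) * u x * h x)"
proof -
  note u = admissibleD[OF assms(1)] and h = admissibleD[OF assms(2)]
  show "integrable lebesgue (\<lambda>x. g x \<bullet> k x)" by (rule square_integrable_integrable_inner[OF u(2) h(2)])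
  have "AE x in lebesgue. (sqrt (V (norm x)) * u x) \<bullet> (sqrt (V (norm x)) * h x) = V (norm x) * u x * h x"
    using AE_neq_0 by eventually_elim (simp add: V_nonneg mult_ac)
  from lebesgue_integral_cong_AE(1)[OF this] show "integrable lebesgue (\<lambda>x. V (norm x) * u x * h x)"
    using square_integrable_integrable_inner[OF u(8) h(8)] by simp
qed

lemma norm_sq_add_scaleR:
  assumes "admissible u g" "admissible h k"
  shows "norm_sq (\<lambda>x. u x + c * h x) (\<lambda>x. g x + c *\<^sub>R k x) = norm_sq u g + 2 * c * form u g h k + c\<^sup>2 * norm_sq h k"
proof -
  note gg = form_integrable[OF assms(1,1)] and gk = form_integrable[OF assms] and kk = form_integrable[OF assms(2,2)]
  have "(g x + c *\<^sub>R k x) \<bullet> (g x + c *\<^sub>R k x) = g x \<bullet> g x + (2 * c * (g x \<bullet> k x) + c\<^sup>2 * (k x \<bullet> k x))" for x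
    by (simp add: inner_add_left inner_add_right inner_commute algebra_simps power2_eq_square)
  moreover have "V (norm x) * (u x + c * h x) * (u x + c * h x)
      = V (norm x) * u x * u x + (2 * c * (V (norm x) * u x * h x) + c\<^sup>2 * (V (norm x) * h x * h x))" for x
    by (simp add: algebra_simps power2_eq_square)
  ultimately show ?thesis
    unfolding norm_sq_def form_def using gg gk kk by (simp add: distrib_left)
qed

lemma norm_sq_scaleR:
  assumes "admissible u g"
  shows "norm_sq (\<lambda>x. c * u x) (\<lambda>x. c *\<^sub>R g x) = c\<^sup>2 * norm_sq u g"
  using norm_sq_add_scaleR[OF admissible_zero assms, of c] by (simp add: norm_sq_def form_def)

lemma norm_sq_parallelogram:
  assumes "admissible u g" "admissible h k"
  shows "(L2_norm lebesgue (\<lambda>x. g x - k x))\<^sup>2 / 4 + norm_sq (\<lambda>x. (u x + h x) / 2) (\<lambda>x. (1/2) *\<^sub>R (g x + k x))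
    \<le> (norm_sq u g + norm_sq h k) / 2"
proof -
  have "norm_sq (\<lambda>x. (u x + h x) / 2) (\<lambda>x. (1/2) *\<^sub>R (g x + k x)) = (norm_sq u g + 2 * form u g h k + norm_sq h k) / 4"
    using norm_sq_scaleR[OF admissible_add_scaleR[OF assms, of 1], of "1/2"] norm_sq_add_scaleR[OF assms, of 1]
    by (simp add: power2_eq_square)
  moreover have "(L2_norm lebesgue (\<lambda>x. g x - k x))\<^sup>2 \<le> norm_sq u g - 2 * form u g h k + norm_sq h k"
    using L2_norm_gradient_le[of "\<lambda>x. g x - k x" "\<lambda>x. u x - h x"] norm_sq_add_scaleR[OF assms, of "-1"] by simp
  ultimately show ?thesis by (simp add: field_simps)
qed

lemma admissible_profile: "admissible u g \<Longrightarrow> AE x in lebesgue. u x = profile g (norm x)"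
  using radial_representation[OF dim] admissibleD(2,4,5,6) by blast

definition Hardy_const :: real where
  "Hardy_const = 1 + 4 / (real CARD('n) - 2)\<^sup>2"

lemma Hardy_const_ge_1: "Hardy_const \<ge> 1"
  by (simp add: Hardy_const_def)

lemma Hardy_weight_nonneg: "x \<noteq> 0 \<Longrightarrow> Hardy_weight V (norm x) \<ge> 0" for x :: "real^'n"
  using V_nonneg[of "norm x"] by (simp add: Hardy_weight_def)

lemma Hardy_weight_measurable: "(\<lambda>x::real^'n. Hardy_weight V (norm x)) \<in> borel_measurable lebesgue"
  unfolding Hardy_weight_def
  by (intro borel_measurable_add V_measurable measurable_completion) measurable

lemma Hardy_inequality:
  assumes "admissible u g"
  shows "integrable lebesgue (\<lambda>x. Hardy_weight V (norm x) * (u x)\<^sup>2)"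
    and "(\<integral>x. Hardy_weight V (norm x) * (u x)\<^sup>2 \<partial>lebesgue) \<le> Hardy_const * norm_sq u g"
proof -
  note u = admissibleD[OF assms] and Hardy = Hardy_profile[OF dim_vec admissibleD(2)[OF assms]]
  let ?q = "\<lambda>x. (u x)\<^sup>2 / (norm x)\<^sup>2" and ?c = "4 / (real CARD('n) - 2)\<^sup>2"
  have AE_eq: "AE x in lebesgue. ?q x = (profile g (norm x))\<^sup>2 / (norm x)\<^sup>2"
    using admissible_profile[OF assms] by eventually_elim simp
  have q_int: "integrable lebesgue ?q" using Hardy(1) lebesgue_integral_cong_AE(1)[OF AE_eq] by simp
  have "(\<integral>x. ?q x \<partial>lebesgue) \<le> ?c * (L2_norm lebesgue g)\<^sup>2"
    using Hardy(2) lebesgue_integral_cong_AE(2)[OF AE_eq] by simp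
  also have "\<dots> \<le> ?c * norm_sq u g" by (intro mult_left_mono L2_norm_gradient_le) simp
  finally have q_le: "(\<integral>x. ?q x \<partial>lebesgue) \<le> ?c * norm_sq u g" .
  have weight: "Hardy_weight V (norm x) * (u x)\<^sup>2 = V (norm x) * (u x)\<^sup>2 + ?q x" for x
    by (simp add: Hardy_weight_def distrib_right)
  show "integrable lebesgue (\<lambda>x. Hardy_weight V (norm x) * (u x)\<^sup>2)" unfolding weight using u(3) q_int by simp
  have "(\<integral>x. V (norm x) * (u x)\<^sup>2 \<partial>lebesgue) \<le> norm_sq u g" by (simp add: norm_sq_eq)
  then show "(\<integral>x. Hardy_weight V (norm x) * (u x)\<^sup>2 \<partial>lebesgue) \<le> Hardy_const * norm_sq u g"
    unfolding weight Hardy_const_def using u(3) q_int q_le by (simp add: distrib_right)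
qed

lemma admissible_positive_part:
  assumes "admissible u g"
  obtains k where "admissible (\<lambda>x. max 0 (u x)) k" "norm_sq (\<lambda>x. max 0 (u x)) k \<le> norm_sq u g"
proof -
  note u = admissibleD[OF assms]
  let ?k = "\<lambda>x. indicator {r. r > 0 \<and> profile g r > 0} (norm x) *\<^sub>R g x" and ?u = "\<lambda>x. max 0 (u x)"
  have wg: "weak_grad ?u ?k"
    by (rule weak_grad_positive_part[OF u(6) continuous_on_profile[OF dim_vec u(2)] admissible_profile[OF assms]])
  have k_le: "norm (?k x) \<le> norm (g x)" for x by (simp add: indicator_def)
  have k: "square_integrable lebesgue ?k"
    by (rule square_integrable_bound[OF u(2) weak_grad_measurable[OF wg] AE_I2[OF k_le]])
  have u_meas: "?u \<in> borel_measurable lebesgue" using u(1) by simp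
  have V_le: "AE x in lebesgue. V (norm x) * (?u x)\<^sup>2 \<le> V (norm x) * (u x)\<^sup>2"
    using AE_neq_0 by eventually_elim (auto intro!: mult_left_mono mult_nonneg_nonneg V_nonneg simp: max_def)
  have V_int: "integrable lebesgue (\<lambda>x. V (norm x) * (?u x)\<^sup>2)"
  proof (rule Bochner_Integration.integrable_bound[OF u(3)])
    show "(\<lambda>x. V (norm x) * (?u x)\<^sup>2) \<in> borel_measurable lebesgue" using V_measurable u_meas by simp
    show "AE x in lebesgue. norm (V (norm x) * (?u x)\<^sup>2) \<le> norm (V (norm x) * (u x)\<^sup>2)"
      using V_le AE_neq_0 by eventually_elim (simp add: abs_mult V_nonneg)
  qed
  have "admissible ?u ?k"
  proof (rule admissibleI[OF u_meas _ _ V_int wg k])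
    show "integrable lebesgue (\<lambda>x. \<bar>?u x\<bar> powr (2 * real CARD('n) / (real CARD('n) - 2)))"
      using u_meas dim by (intro Bochner_Integration.integrable_bound[OF u(7)]) (auto intro!: powr_mono2)
    obtain v where "AE x in lebesgue. u x = v (norm x)" using u(5) by (auto simp: radial_def)
    then have "AE x in lebesgue. ?u x = (\<lambda>r. max 0 (v r)) (norm x)" by eventually_elim simp
    then show "radial ?u" unfolding radial_def by (rule exI[of _ "\<lambda>r. max 0 (v r)"])
  qed
  moreover have "(L2_norm lebesgue ?k)\<^sup>2 \<le> (L2_norm lebesgue g)\<^sup>2"
    unfolding L2_norm_power2
    by (intro integral_mono square_integrableD(2)[OF k] square_integrableD(2)[OF u(2)] power_mono k_le) simp
  then have "norm_sq ?u ?k \<le> norm_sq u g"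
    unfolding norm_sq_eq using integral_mono_AE[OF V_int u(3) V_le] by linarith
  ultimately show ?thesis using that by blast
qed

definition decay_bound :: "real \<Rightarrow> real^'n \<Rightarrow> real" where
  "decay_bound M x = profile_const CARD('n) * sqrt M * sqrt (norm x powr (2 - real CARD('n)))"

lemma admissible_le_decay_bound:
  assumes "admissible u g" "norm_sq u g \<le> M"
  shows "AE x in lebesgue. \<bar>u x\<bar> \<le> decay_bound M x"
  using admissible_profile[OF assms(1)] AE_neq_0
proof eventually_elim
  case (elim x)
  have "L2_norm lebesgue g \<le> sqrt M"
    using L2_norm_gradient_le[of g u] assms(2) by (intro real_le_rsqrt) simp
  then have "profile_const CARD('n) * L2_norm lebesgue g * sqrt (norm x powr (2 - real CARD('n))) \<le> decay_bound M x"
    unfolding decay_bound_def using profile_const_nonneg[OF dim] by (intro mult_right_mono mult_left_mono) auto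
  then show ?case using profile_bound[OF dim_vec admissibleD(2)[OF assms(1)], of "norm x"] elim by simp
qed

lemma decay_bound_locally_integrable:
  "integrable lebesgue (\<lambda>x. indicator {..R} (norm x) * decay_bound M x)"
proof -
  have "sqrt (norm x powr (2 - real CARD('n))) = norm x powr ((2 - real CARD('n)) / 2)" for x :: "real^'n"
    by (simp add: powr_half_sqrt[symmetric] powr_powr)
  then have "(\<lambda>x. indicator {..R} (norm x) * decay_bound M x) = (\<lambda>x::real^'n.
      profile_const CARD('n) * sqrt M * (indicator {..R} (norm x) * norm x powr ((2 - real CARD('n)) / 2)))"
    by (simp add: decay_bound_def mult_ac)
  moreover have "integrable lebesgue (\<lambda>x::real^'n. indicator {..R} (norm x) * norm x powr ((2 - real CARD('n)) / 2))"
    using dim by (intro integrable_norm_powr_inside) (simp add: field_simps)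
  ultimately show ?thesis by simp
qed

lemma admissible_convergent_subsequence:
  assumes us: "\<And>k. admissible (us k) (gs k)" "\<And>k. norm_sq (us k) (gs k) \<le> M"
  obtains s :: "nat \<Rightarrow> nat" and v where "strict_mono s" "(\<lambda>x::real^'n. v (norm x)) \<in> borel_measurable lebesgue"
    "AE x in lebesgue. (\<lambda>j. us (s j) x) \<longlonglongrightarrow> v (norm x)"
proof -
  have gs_le: "L2_norm lebesgue (gs k) \<le> sqrt M" for k
    using L2_norm_gradient_le[of "gs k" "us k"] us(2)[of k] by (intro real_le_rsqrt) simp
  obtain s :: "nat \<Rightarrow> nat" where s: "strict_mono s" and conv: "\<And>r. r > 0 \<Longrightarrow> convergent (\<lambda>j. profile (gs (s j)) r)"
    using profile_convergent_subsequence[of gs "sqrt M", OF dim_vec admissibleD(2)[OF us(1)] gs_le] by metis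
  define v where "v r = lim (\<lambda>j. profile (gs (s j)) r)" for r
  have v: "(\<lambda>j. profile (gs (s j)) r) \<longlonglongrightarrow> v r" if "r > 0" for r
    using conv[OF that] by (simp add: v_def convergent_LIMSEQ_iff)
  have "(\<lambda>x::real^'n. profile (gs (s j)) (norm x)) \<in> borel_measurable lebesgue" for j
    using profile_norm_measurable[OF dim_vec admissibleD(2)[OF us(1)]] by (intro measurable_completion) simp
  then have v_meas: "(\<lambda>x::real^'n. v (norm x)) \<in> borel_measurable lebesgue"
    unfolding v_def by (rule borel_measurable_lim_metric)
  have "AE x in lebesgue. \<forall>j. us (s j) x = profile (gs (s j)) (norm x)"
    unfolding AE_all_countable using admissible_profile[OF us(1)] by blast
  then have "AE x in lebesgue. (\<lambda>j. us (s j) x) \<longlonglongrightarrow> v (norm x)"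
    using AE_neq_0 by eventually_elim (simp add: v)
  then show ?thesis using that s v_meas by blast
qed

lemma integrable_critical_powr:
  fixes u :: "real^'n \<Rightarrow> real"
  assumes u: "u \<in> borel_measurable lebesgue" "integrable lebesgue (\<lambda>x. Hardy_weight V (norm x) * (u x)\<^sup>2)"
    and u_le: "AE x in lebesgue. \<bar>u x\<bar> \<le> decay_bound M x" and M_nonneg: "M \<ge> 0"
  shows "integrable lebesgue (\<lambda>x. \<bar>u x\<bar> powr (2 * real CARD('n) / (real CARD('n) - 2)))"
proof (rule Bochner_Integration.integrable_bound)
  define d where "d = real CARD('n) - 2"
  have d: "d > 0" "real CARD('n) = d + 2" using dim by (auto simp: d_def)
  let ?c = "profile_const CARD('n) * sqrt M"
  show "integrable lebesgue (\<lambda>x. ?c powr (4 / d) * (Hardy_weight V (norm x) * (u x)\<^sup>2))"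
    using u(2) by (rule integrable_mult_right)
  show "AE x in lebesgue. norm (\<bar>u x\<bar> powr (2 * real CARD('n) / (real CARD('n) - 2)))
      \<le> norm (?c powr (4 / d) * (Hardy_weight V (norm x) * (u x)\<^sup>2))"
    using u_le AE_neq_0
  proof eventually_elim
    case (elim x)
    have "\<bar>u x\<bar> powr (2 * (d + 2) / d) \<le> ?c powr (4 / d) * ((u x)\<^sup>2 / (norm x)\<^sup>2)"
      using elim d profile_const_nonneg[OF dim] M_nonneg by (intro critical_powr_bound) (auto simp: decay_bound_def)
    also have "\<dots> \<le> ?c powr (4 / d) * (Hardy_weight V (norm x) * (u x)\<^sup>2)"
      using V_nonneg[of "norm x"] elim by (intro mult_left_mono) (auto simp: Hardy_weight_def distrib_right)
    finally have "\<bar>u x\<bar> powr (2 * (d + 2) / d) \<le> ?c powr (4 / d) * (Hardy_weight V (norm x) * (u x)\<^sup>2)" .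
    then show ?case by (simp add: d)
  qed
qed (use u(1) in simp)

lemma norm_sq_lower_semicontinuous:
  assumes us: "\<And>j. admissible (us j) (gs j)" and L: "(\<lambda>j. norm_sq (us j) (gs j)) \<longlonglongrightarrow> L"
    and u: "u \<in> borel_measurable lebesgue" "AE x in lebesgue. (\<lambda>j. us j x) \<longlonglongrightarrow> u x"
    and g: "square_integrable lebesgue g" "AE x in lebesgue. (\<lambda>j. gs j x) \<longlonglongrightarrow> g x"
  shows "integrable lebesgue (\<lambda>x. V (norm x) * (u x)\<^sup>2)" "norm_sq u g \<le> L"
proof -
  let ?f = "\<lambda>u g x. (norm (g x))\<^sup>2 + V (norm x) * (u x)\<^sup>2"
  note us' = admissibleD(3)[OF us] square_integrableD(2)[OF admissibleD(2)[OF us]]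
  have nonneg: "AE x in lebesgue. 0 \<le> ?f (us j) (gs j) x" for j
    using V_term_nonneg[of "us j"] by eventually_elim simp
  have lim: "AE x in lebesgue. (\<lambda>j. ?f (us j) (gs j) x) \<longlonglongrightarrow> ?f u g x"
    using u(2) g(2) by eventually_elim (intro tendsto_intros)
  have meas: "?f u g \<in> borel_measurable lebesgue"
    using V_measurable u(1) square_integrableD(1)[OF g(1)] by simp
  have "(\<lambda>j. \<integral>x. ?f (us j) (gs j) x \<partial>lebesgue) \<longlonglongrightarrow> L"
    using L us' by (simp add: norm_sq_eq L2_norm_power2)
  note Fatou = Fatou_integrable_LIMSEQ[of lebesgue "\<lambda>j. ?f (us j) (gs j)", OF _ nonneg this lim meas]
  have f_int: "integrable lebesgue (?f u g)" and f_le: "(\<integral>x. ?f u g x \<partial>lebesgue) \<le> L"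
    using Fatou us' by simp_all
  show "integrable lebesgue (\<lambda>x. V (norm x) * (u x)\<^sup>2)"
    using Bochner_Integration.integrable_diff[OF f_int square_integrableD(2)[OF g(1)]] by simp
  then show "norm_sq u g \<le> L" using f_le square_integrableD(2)[OF g(1)] by (simp add: norm_sq_eq L2_norm_power2)
qed

lemma Hardy_weight_integrable_limit:
  assumes us: "\<And>j. admissible (us j) (gs j)" "\<And>j. norm_sq (us j) (gs j) \<le> M"
    and u: "u \<in> borel_measurable lebesgue" "AE x in lebesgue. (\<lambda>j. us j x) \<longlonglongrightarrow> u x"
  shows "integrable lebesgue (\<lambda>x. Hardy_weight V (norm x) * (u x)\<^sup>2)"
    and "(\<integral>x. Hardy_weight V (norm x) * (u x)\<^sup>2 \<partial>lebesgue) \<le> Hardy_const * M"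
proof -
  have nonneg: "AE x in lebesgue. 0 \<le> Hardy_weight V (norm x) * (us j x)\<^sup>2" for j
    using AE_neq_0 by eventually_elim (simp add: Hardy_weight_nonneg)
  have integral_le: "(\<integral>x. Hardy_weight V (norm x) * (us j x)\<^sup>2 \<partial>lebesgue) \<le> Hardy_const * M" for j
    using Hardy_inequality(2)[OF us(1)[of j]] mult_left_mono[OF us(2)[of j], of Hardy_const] Hardy_const_ge_1 by linarith
  have lim: "AE x in lebesgue. (\<lambda>j. Hardy_weight V (norm x) * (us j x)\<^sup>2) \<longlonglongrightarrow> Hardy_weight V (norm x) * (u x)\<^sup>2"
    using u(2) by eventually_elim (intro tendsto_intros)
  have meas: "(\<lambda>x. Hardy_weight V (norm x) * (u x)\<^sup>2) \<in> borel_measurable lebesgue"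
    using Hardy_weight_measurable u(1) by simp
  show "integrable lebesgue (\<lambda>x. Hardy_weight V (norm x) * (u x)\<^sup>2)"
    "(\<integral>x. Hardy_weight V (norm x) * (u x)\<^sup>2 \<partial>lebesgue) \<le> Hardy_const * M"
    using Fatou_integrable[OF Hardy_inequality(1)[OF us(1)] nonneg integral_le lim meas] by blast+
qed

proposition admissible_limit:
  assumes us: "\<And>j. admissible (us j) (gs j)" "\<And>j. norm_sq (us j) (gs j) \<le> M" "(\<lambda>j. norm_sq (us j) (gs j)) \<longlonglongrightarrow> L"
    and v: "(\<lambda>x::real^'n. v (norm x)) \<in> borel_measurable lebesgue" "AE x in lebesgue. (\<lambda>j. us j x) \<longlonglongrightarrow> v (norm x)"
    and g: "square_integrable lebesgue g" "AE x in lebesgue. (\<lambda>j. gs j x) \<longlonglongrightarrow> g x"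
      "(\<lambda>j. L2_norm lebesgue (\<lambda>x. gs j x - g x)) \<longlonglongrightarrow> 0"
  shows "admissible (\<lambda>x. v (norm x)) g" "norm_sq (\<lambda>x. v (norm x)) g \<le> L"
proof -
  note semicont = norm_sq_lower_semicontinuous[where u="\<lambda>x. v (norm x)", OF us(1,3) v g(1,2)]
  show "norm_sq (\<lambda>x. v (norm x)) g \<le> L" by (rule semicont(2))
  have M_nonneg: "M \<ge> 0" using norm_sq_nonneg[of "us 0" "gs 0"] us(2)[of 0] by linarith
  have us_le: "AE x in lebesgue. \<bar>us j x\<bar> \<le> decay_bound M x" for j
    by (rule admissible_le_decay_bound[OF us(1,2)])
  then have "AE x in lebesgue. \<forall>j. \<bar>us j x\<bar> \<le> decay_bound M x" by (simp add: AE_all_countable)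
  with v(2) have v_le: "AE x in lebesgue. \<bar>v (norm x)\<bar> \<le> decay_bound M x"
    by eventually_elim (rule LIMSEQ_le_const2[OF tendsto_rabs], auto)
  show "admissible (\<lambda>x. v (norm x)) g"
  proof (rule admissibleI[OF v(1) _ _ semicont(1) _ g(1)])
    show "radial (\<lambda>x::real^'n. v (norm x))" unfolding radial_def by auto
    show "integrable lebesgue (\<lambda>x::real^'n. \<bar>v (norm x)\<bar> powr (2 * real CARD('n) / (real CARD('n) - 2)))"
      by (rule integrable_critical_powr[OF v(1) Hardy_weight_integrable_limit(1)[where u="\<lambda>x. v (norm x)", OF us(1,2) v] v_le M_nonneg])
    show "weak_grad (\<lambda>x. v (norm x)) g"
      by (rule weak_grad_limit[where u="\<lambda>x. v (norm x)", OF admissibleD(6)[OF us(1)] v decay_bound_locally_integrable us_le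
            admissibleD(2)[OF us(1)] g(1,3)])
  qed
qed

end

section \<open>The potential energy of the nonlinearity\<close>

lemma Fprim_nonpos: "t \<le> 0 \<Longrightarrow> Fprim f t = 0"
  by (cases "t = 0") (auto simp: Fprim_def)

lemma Fprim_max_0: "Fprim f (max 0 t) = Fprim f t"
  by (cases "t \<ge> 0") (auto simp: Fprim_nonpos max_def)

text \<open>Since \<open>integral {0..t} f\<close> is 0 for negative \<open>t\<close>, the derivative there is \<open>f 0 = 0\<close>.\<close>

lemma Fprim_has_real_derivative:
  assumes f: "continuous_on UNIV f" and f0: "f 0 = 0"
  shows "(Fprim f has_real_derivative f (max 0 t)) (at t)"
proof -
  define h where "h s = f (max 0 s)" for s
  have h_cont: "continuous_on A h" for A
    unfolding h_def by (rule continuous_on_compose2[OF f]) (auto intro!: continuous_intros)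
  define c where "c = min t 0 - 1"
  have c_less: "c < t" "c < 0" by (auto simp: c_def)
  have Fprim_eq: "integral {c..s} h = Fprim f s" for s
  proof (cases "s \<ge> 0")
    case True
    have "integral {c..0} h + integral {0..s} h = integral {c..s} h"
      using True c_less by (intro Henstock_Kurzweil_Integration.integral_combine integrable_continuous_real h_cont) auto
    moreover have "integral {c..0} h = integral {c..0} (\<lambda>_. 0)" by (rule integral_cong) (auto simp: h_def f0)
    moreover have "integral {0..s} h = integral {0..s} f" by (rule integral_cong) (auto simp: h_def)
    ultimately show ?thesis by (simp add: Fprim_def)
  next
    case False
    then have "integral {c..s} h = integral {c..s} (\<lambda>_. 0)" by (intro integral_cong) (auto simp: h_def f0)
    then show ?thesis using False by (simp add: Fprim_nonpos)
  qed
  have "((\<lambda>s. integral {c..s} h) has_real_derivative h t) (at t within {c..t+1})"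
    using c_less by (intro integral_has_real_derivative[OF h_cont]) auto
  moreover have "at t within {c..t+1} = at t" using c_less by (intro at_within_interior) auto
  ultimately show ?thesis by (simp add: Fprim_eq h_def)
qed

locale sublinear_problem = radial_potential V space_type
  for V :: "real \<Rightarrow> real" and space_type :: "'n::finite itself" +
  fixes K f growth :: "real \<Rightarrow> real" and remainder :: "real^'n \<Rightarrow> real"
  assumes K_cont: "continuous_on {0<..} K" and K_pos: "\<And>r. r > 0 \<Longrightarrow> K r > 0"
    and f_cont: "continuous_on UNIV f" and f_0: "f 0 = 0"
    and f_growth: "\<And>t. t \<ge> 0 \<Longrightarrow> \<bar>f t\<bar> \<le> growth t"
    and growth_mono: "\<And>s t. 0 \<le> s \<Longrightarrow> s \<le> t \<Longrightarrow> growth s \<le> growth t"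
    and remainder_integrable: "integrable lebesgue remainder"
    and absorb: "\<And>e. e > 0 \<Longrightarrow> \<exists>C. \<forall>x t. x \<noteq> 0 \<longrightarrow> t \<ge> 0 \<longrightarrow>
      K (norm x) * (t * growth t) \<le> e * (Hardy_weight V (norm x) * t\<^sup>2) + C * remainder x"
begin

definition potential :: "(real^'n \<Rightarrow> real) \<Rightarrow> real" where
  "potential u = (\<integral>x. K (norm x) * Fprim f (u x) \<partial>lebesgue)"

definition energy :: "(real^'n \<Rightarrow> real) \<Rightarrow> (real^'n \<Rightarrow> real^'n) \<Rightarrow> real" where
  "energy u g = norm_sq u g / 2 - potential u"

definition energy_infimum :: real where
  "energy_infimum = Inf {energy u g |u g. admissible u g}"

definition minimizer :: "(real^'n \<Rightarrow> real) \<Rightarrow> (real^'n \<Rightarrow> real^'n) \<Rightarrow> bool" where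
  "minimizer u g \<longleftrightarrow> admissible u g \<and> (\<forall>h k. admissible h k \<longrightarrow> energy u g \<le> energy h k)"

lemma K_measurable: "(\<lambda>x::real^'n. K (norm x)) \<in> borel_measurable lebesgue"
  using borel_measurable_radial[OF K_cont] by (auto intro: measurable_completion)

lemma growth_nonneg: "t \<ge> 0 \<Longrightarrow> growth t \<ge> 0"
  using f_growth[of t] by (meson abs_ge_zero order_trans)

lemma Fprim_derivative: "(Fprim f has_real_derivative f (max 0 t)) (at t)"
  by (rule Fprim_has_real_derivative[OF f_cont f_0])

lemma isCont_Fprim: "isCont (Fprim f) t"
  using Fprim_derivative by (rule DERIV_isCont)

lemma Fprim_measurable:
  assumes "u \<in> borel_measurable M"
  shows "(\<lambda>x. Fprim f (u x)) \<in> borel_measurable M"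
  using isCont_Fprim by (intro measurable_compose[OF assms] borel_measurable_continuous_onI continuous_at_imp_continuous_on) auto

lemma Fprim_diff_le:
  assumes "\<bar>s\<bar> \<le> T" "\<bar>t\<bar> \<le> T"
  shows "\<bar>Fprim f t - Fprim f s\<bar> \<le> growth T * \<bar>t - s\<bar>"
proof -
  have "norm (Fprim f t - Fprim f s) \<le> growth T * norm (t - s)"
  proof (rule field_differentiable_bound[of "{min s t..max s t}" _ "\<lambda>t. f (max 0 t)"])
    fix z assume z: "z \<in> {min s t..max s t}"
    show "(Fprim f has_field_derivative f (max 0 z)) (at z within {min s t..max s t})"
      by (rule has_field_derivative_at_within[OF Fprim_derivative])
    have "max 0 z \<le> T" using z assms by auto
    then have "growth (max 0 z) \<le> growth T" by (intro growth_mono) auto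
    then show "norm (f (max 0 z)) \<le> growth T" using f_growth[of "max 0 z"] by simp
  qed auto
  then show ?thesis by simp
qed

lemma Fprim_le: "\<bar>Fprim f t\<bar> \<le> \<bar>t\<bar> * growth \<bar>t\<bar>"
  using Fprim_diff_le[of 0 "\<bar>t\<bar>" t] by (simp add: Fprim_nonpos mult.commute)

lemma K_Fprim_absorbed:
  assumes "e > 0"
  shows "\<exists>C. \<forall>x t. x \<noteq> 0 \<longrightarrow> \<bar>K (norm x) * Fprim f t\<bar> \<le> e * (Hardy_weight V (norm x) * t\<^sup>2) + C * remainder x"
proof -
  obtain C where C: "\<And>x t. x \<noteq> 0 \<Longrightarrow> t \<ge> 0 \<Longrightarrow>
      K (norm x) * (t * growth t) \<le> e * (Hardy_weight V (norm x) * t\<^sup>2) + C * remainder x"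
    using absorb[OF assms] by blast
  have "\<bar>K (norm x) * Fprim f t\<bar> \<le> e * (Hardy_weight V (norm x) * t\<^sup>2) + C * remainder x" if "x \<noteq> 0" for x t
  proof -
    have "\<bar>K (norm x) * Fprim f t\<bar> \<le> K (norm x) * (\<bar>t\<bar> * growth \<bar>t\<bar>)"
      using K_pos[of "norm x"] that Fprim_le[of t] by (simp add: abs_mult)
    also have "\<dots> \<le> e * (Hardy_weight V (norm x) * t\<^sup>2) + C * remainder x" using C[of x "\<bar>t\<bar>"] that by simp
    finally show ?thesis .
  qed
  then show ?thesis by blast
qed

lemma K_Fprim_integrable:
  fixes u :: "real^'n \<Rightarrow> real"
  assumes "u \<in> borel_measurable lebesgue" "integrable lebesgue (\<lambda>x. Hardy_weight V (norm x) * (u x)\<^sup>2)"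
  shows "integrable lebesgue (\<lambda>x. K (norm x) * Fprim f (u x))"
proof -
  obtain C where C: "\<And>x t. x \<noteq> 0 \<Longrightarrow> \<bar>K (norm x) * Fprim f t\<bar> \<le> 1 * (Hardy_weight V (norm x) * t\<^sup>2) + C * remainder x"
    using K_Fprim_absorbed[OF zero_less_one] by blast
  show ?thesis
  proof (rule Bochner_Integration.integrable_bound)
    show "integrable lebesgue (\<lambda>x. Hardy_weight V (norm x) * (u x)\<^sup>2 + C * remainder x)"
      using assms(2) remainder_integrable by simp
    show "(\<lambda>x. K (norm x) * Fprim f (u x)) \<in> borel_measurable lebesgue"
      using K_measurable Fprim_measurable[OF assms(1)] by simp
    show "AE x in lebesgue. norm (K (norm x) * Fprim f (u x)) \<le> norm (Hardy_weight V (norm x) * (u x)\<^sup>2 + C * remainder x)"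
      using AE_neq_0
    proof eventually_elim
      case (elim x)
      then show ?case using C[of x "u x"] by simp
    qed
  qed
qed

lemma potential_absorbed:
  assumes "e > 0"
  shows "\<exists>C. \<forall>u. u \<in> borel_measurable lebesgue \<longrightarrow> integrable lebesgue (\<lambda>x. Hardy_weight V (norm x) * (u x)\<^sup>2) \<longrightarrow>
    potential u \<le> e * (\<integral>x. Hardy_weight V (norm x) * (u x)\<^sup>2 \<partial>lebesgue) + C"
proof -
  obtain C where C: "\<And>x t. x \<noteq> 0 \<Longrightarrow> \<bar>K (norm x) * Fprim f t\<bar> \<le> e * (Hardy_weight V (norm x) * t\<^sup>2) + C * remainder x"
    using K_Fprim_absorbed[OF assms] by blast
  have "potential u \<le> e * (\<integral>x. Hardy_weight V (norm x) * (u x)\<^sup>2 \<partial>lebesgue) + C * (\<integral>x. remainder x \<partial>lebesgue)"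
    if u: "u \<in> borel_measurable lebesgue" "integrable lebesgue (\<lambda>x. Hardy_weight V (norm x) * (u x)\<^sup>2)" for u
  proof -
    have "AE x in lebesgue. K (norm x) * Fprim f (u x) \<le> e * (Hardy_weight V (norm x) * (u x)\<^sup>2) + C * remainder x"
      using AE_neq_0
    proof eventually_elim
      case (elim x)
      then show ?case using C[of x "u x"] by linarith
    qed
    then have "potential u \<le> (\<integral>x. e * (Hardy_weight V (norm x) * (u x)\<^sup>2) + C * remainder x \<partial>lebesgue)"
      unfolding potential_def using K_Fprim_integrable[OF u] u(2) remainder_integrable by (intro integral_mono_AE) auto
    then show ?thesis using u(2) remainder_integrable by simp
  qed
  then show ?thesis by blast
qed

lemma energy_coercive: "\<exists>C. \<forall>u g. admissible u g \<longrightarrow> norm_sq u g / 4 - C \<le> energy u g"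
proof -
  have e: "1 / (4 * Hardy_const) > 0" using Hardy_const_ge_1 by simp
  obtain C where C: "\<And>u. u \<in> borel_measurable lebesgue \<Longrightarrow> integrable lebesgue (\<lambda>x. Hardy_weight V (norm x) * (u x)\<^sup>2) \<Longrightarrow>
      potential u \<le> 1 / (4 * Hardy_const) * (\<integral>x. Hardy_weight V (norm x) * (u x)\<^sup>2 \<partial>lebesgue) + C"
    using potential_absorbed[OF e] by blast
  have "norm_sq u g / 4 - C \<le> energy u g" if u: "admissible u g" for u g
  proof -
    have "potential u \<le> 1 / (4 * Hardy_const) * (\<integral>x. Hardy_weight V (norm x) * (u x)\<^sup>2 \<partial>lebesgue) + C"
      by (rule C[OF admissibleD(1)[OF u] Hardy_inequality(1)[OF u]])
    also have "\<dots> \<le> 1 / (4 * Hardy_const) * (Hardy_const * norm_sq u g) + C"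
      using e by (intro add_right_mono mult_left_mono Hardy_inequality(2)[OF u]) auto
    also have "\<dots> = norm_sq u g / 4 + C" using Hardy_const_ge_1 by simp
    finally show ?thesis by (simp add: energy_def)
  qed
  then show ?thesis by blast
qed

lemma energy_infimum_le:
  assumes "admissible u g"
  shows "energy_infimum \<le> energy u g"
proof -
  obtain C where C: "\<And>u g. admissible u g \<Longrightarrow> norm_sq u g / 4 - C \<le> energy u g" using energy_coercive by blast
  have "- C \<le> energy u g" if "admissible u g" for u g using C[OF that] norm_sq_nonneg[of u g] by linarith
  then have "bdd_below {energy u g |u g. admissible u g}" by (intro bdd_belowI[of _ "- C"]) auto
  then show ?thesis unfolding energy_infimum_def using assms by (intro cInf_lower) auto
qed

lemma admissible_positive_part_energy:
  assumes "admissible u g"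
  obtains k where "admissible (\<lambda>x. max 0 (u x)) k" "energy (\<lambda>x. max 0 (u x)) k \<le> energy u g"
proof -
  obtain k where k: "admissible (\<lambda>x. max 0 (u x)) k" "norm_sq (\<lambda>x. max 0 (u x)) k \<le> norm_sq u g"
    by (rule admissible_positive_part[OF assms])
  moreover have "potential (\<lambda>x. max 0 (u x)) = potential u" by (simp add: potential_def Fprim_max_0)
  ultimately show ?thesis using that by (simp add: energy_def)
qed

lemma potential_tendsto:
  assumes us: "\<And>k. admissible (us k) (gs k)" "\<And>k. norm_sq (us k) (gs k) \<le> M"
    and u: "u \<in> borel_measurable lebesgue" "AE x in lebesgue. (\<lambda>k. us k x) \<longlonglongrightarrow> u x"
  shows "(\<lambda>k. potential (us k)) \<longlonglongrightarrow> potential u"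
  unfolding potential_def
proof (rule tendsto_integral_absorbed)
  let ?W = "\<lambda>u x. Hardy_weight V (norm x) * (u x)\<^sup>2"
  note W_u = Hardy_weight_integrable_limit[OF us u] and W_us = Hardy_inequality(1)[OF us(1)]
  show "integrable lebesgue (\<lambda>x. K (norm x) * Fprim f (us k x))" for k
    by (rule K_Fprim_integrable[OF admissibleD(1)[OF us(1)] W_us])
  show "integrable lebesgue (\<lambda>x. K (norm x) * Fprim f (u x))" by (rule K_Fprim_integrable[OF u(1) W_u(1)])
  show "AE x in lebesgue. (\<lambda>k. K (norm x) * Fprim f (us k x)) \<longlonglongrightarrow> K (norm x) * Fprim f (u x)"
    using u(2) by eventually_elim (intro tendsto_intros isCont_tendsto_compose[OF isCont_Fprim])
  show "integrable lebesgue (\<lambda>x. ?W (us k) x + ?W u x)" for k using W_us W_u(1) by simp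
  show "AE x in lebesgue. 0 \<le> ?W (us k) x + ?W u x" for k
    using AE_neq_0 by eventually_elim (simp add: Hardy_weight_nonneg)
  have W_us_le: "(\<integral>x. ?W (us k) x \<partial>lebesgue) \<le> Hardy_const * M" for k
    using Hardy_inequality(2)[OF us(1)[of k]] mult_left_mono[OF us(2)[of k], of Hardy_const] Hardy_const_ge_1 by linarith
  show "(\<integral>x. ?W (us k) x + ?W u x \<partial>lebesgue) \<le> Hardy_const * M + Hardy_const * M" for k
    unfolding Bochner_Integration.integral_add[OF W_us W_u(1)] using W_us_le W_u(2) by (rule add_mono)
  show "integrable lebesgue remainder" by (rule remainder_integrable)
  fix e :: real assume e_pos: "e > 0"
  obtain C where C: "\<And>x t. x \<noteq> 0 \<Longrightarrow> \<bar>K (norm x) * Fprim f t\<bar> \<le> e * (Hardy_weight V (norm x) * t\<^sup>2) + C * remainder x"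
    using K_Fprim_absorbed[OF e_pos] by blast
  have "AE x in lebesgue. \<bar>K (norm x) * Fprim f (us k x) - K (norm x) * Fprim f (u x)\<bar>
      \<le> e * (?W (us k) x + ?W u x) + 2 * C * remainder x" for k
    using AE_neq_0
  proof eventually_elim
    case (elim x)
    have "e * (?W (us k) x + ?W u x) + 2 * C * remainder x
        = (e * ?W (us k) x + C * remainder x) + (e * ?W u x + C * remainder x)" by (simp add: algebra_simps)
    then show ?case using C[OF elim, of "us k x"] C[OF elim, of "u x"] by linarith
  qed
  then show "\<exists>C. \<forall>k. AE x in lebesgue. \<bar>K (norm x) * Fprim f (us k x) - K (norm x) * Fprim f (u x)\<bar>
      \<le> e * (?W (us k) x + ?W u x) + C * remainder x" by blast
qed

end

section \<open>The minimizer\<close>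

context sublinear_problem
begin

lemma minimizing_sequence:
  obtains us gs M where "\<And>k. admissible (us k) (gs k)" "\<And>k x. us k x \<ge> 0" "\<And>k. norm_sq (us k) (gs k) \<le> M"
    "(\<lambda>k. energy (us k) (gs k)) \<longlonglongrightarrow> energy_infimum"
proof -
  have "\<exists>u g. admissible u g \<and> (\<forall>x. u x \<ge> 0) \<and> energy u g < energy_infimum + 1 / real (Suc k)" for k
  proof -
    have "{energy u g |u g. admissible u g} \<noteq> {}" using admissible_zero by auto
    from cInf_lessD[OF this, of "energy_infimum + 1 / real (Suc k)"]
    obtain u g where ug: "admissible u g" "energy u g < energy_infimum + 1 / real (Suc k)"
      by (auto simp: energy_infimum_def)
    obtain g' where "admissible (\<lambda>x. max 0 (u x)) g'" "energy (\<lambda>x. max 0 (u x)) g' \<le> energy u g"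
      by (rule admissible_positive_part_energy[OF ug(1)])
    then show ?thesis using ug(2) by (intro exI[of _ "\<lambda>x. max 0 (u x)"] exI[of _ g']) auto
  qed
  then obtain us gs where us: "\<And>k. admissible (us k) (gs k)" "\<And>k x. us k x \<ge> 0"
    and energy_less: "\<And>k. energy (us k) (gs k) < energy_infimum + 1 / real (Suc k)" by metis
  obtain C where C: "\<And>u g. admissible u g \<Longrightarrow> norm_sq u g / 4 - C \<le> energy u g" using energy_coercive by blast
  have "norm_sq (us k) (gs k) \<le> 4 * (energy_infimum + 1 + C)" for k
  proof -
    have "1 / real (Suc k) \<le> 1" by simp
    with C[OF us(1)[of k]] energy_less[of k] have "norm_sq (us k) (gs k) / 4 - C \<le> energy_infimum + 1" by linarith
    then show ?thesis by simp
  qed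
  moreover have "(\<lambda>k. energy (us k) (gs k)) \<longlonglongrightarrow> energy_infimum"
  proof (rule tendsto_sandwich[of "\<lambda>_. energy_infimum" _ _ "\<lambda>k. energy_infimum + 1 / real (Suc k)"])
    show "(\<lambda>k. energy_infimum + 1 / real (Suc k)) \<longlonglongrightarrow> energy_infimum"
      using LIMSEQ_inverse_real_of_nat_add[of energy_infimum] by (simp add: inverse_eq_divide)
  qed (use energy_infimum_le[OF us(1)] energy_less in \<open>auto intro!: always_eventually less_imp_le\<close>)
  ultimately show ?thesis using us by (intro that)
qed

lemma norm_sq_average_le:
  assumes "admissible u g" "admissible h k" and "norm_sq u g \<le> M" "norm_sq h k \<le> M"
  shows "norm_sq (\<lambda>x. (u x + h x) / 2) (\<lambda>x. (1/2) *\<^sub>R (g x + k x)) \<le> M"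
  using norm_sq_parallelogram[OF assms(1,2)] assms(3,4) zero_le_power2[of "L2_norm lebesgue (\<lambda>x. g x - k x)"]
  by argo

lemma potential_averages_tendsto:
  assumes us: "\<And>k. admissible (us k) (gs k)" "\<And>k. norm_sq (us k) (gs k) \<le> M"
    and u: "u \<in> borel_measurable lebesgue" "AE x in lebesgue. (\<lambda>k. us k x) \<longlonglongrightarrow> u x" and e_pos: "e > 0"
  shows "\<exists>N. \<forall>p\<ge>N. \<forall>q\<ge>N. \<bar>potential (\<lambda>x. (us p x + us q x) / 2) - potential u\<bar> < e"
proof (rule ccontr)
  assume "\<not> ?thesis"
  then have "\<forall>N. \<exists>p q. p \<ge> N \<and> q \<ge> N \<and> \<bar>potential (\<lambda>x. (us p x + us q x) / 2) - potential u\<bar> \<ge> e"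
    by (meson not_le)
  then obtain p q where pq: "\<And>N. p N \<ge> N" "\<And>N. q N \<ge> N"
    and far: "\<And>N. \<bar>potential (\<lambda>x. (us (p N) x + us (q N) x) / 2) - potential u\<bar> \<ge> e" by metis
  let ?A = "\<lambda>N x. (us (p N) x + us (q N) x) / 2"
  have at_top: "filterlim p sequentially sequentially" "filterlim q sequentially sequentially"
    using pq by (auto intro!: filterlim_at_top_mono[OF filterlim_ident] always_eventually)
  have "AE x in lebesgue. (\<lambda>N. ?A N x) \<longlonglongrightarrow> u x"
    using u(2)
  proof eventually_elim
    case (elim x)
    have "(\<lambda>N. ?A N x) \<longlonglongrightarrow> (u x + u x) / 2"
      by (intro tendsto_intros filterlim_compose[OF elim at_top(1)] filterlim_compose[OF elim at_top(2)]) simp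
    then show ?case by simp
  qed
  then have "(\<lambda>N. potential (?A N)) \<longlonglongrightarrow> potential u"
    by (intro potential_tendsto[OF admissible_average[OF us(1,1)] norm_sq_average_le[OF us(1,1,2,2)] u(1)])
  then obtain N where "\<bar>potential (?A N) - potential u\<bar> < e" using LIMSEQ_D[OF _ e_pos] by fastforce
  then show False using far[of N] by linarith
qed

text \<open>Two almost minimal functions have an average of almost the same potential, so the parallelogram
  inequality forces their gradients to be close.\<close>

lemma minimizing_gradients_Cauchy:
  assumes us: "\<And>k. admissible (us k) (gs k)" "\<And>k. norm_sq (us k) (gs k) \<le> M"
    and u: "u \<in> borel_measurable lebesgue" "AE x in lebesgue. (\<lambda>k. us k x) \<longlonglongrightarrow> u x"
    and energy: "(\<lambda>k. energy (us k) (gs k)) \<longlonglongrightarrow> energy_infimum" and e_pos: "e > 0"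
  shows "\<exists>N. \<forall>p\<ge>N. \<forall>q\<ge>N. (\<integral>x. (norm (gs p x - gs q x))\<^sup>2 \<partial>lebesgue) < e"
proof -
  have e': "e / 32 > 0" using e_pos by simp
  obtain N1 where N1: "\<And>p q. p \<ge> N1 \<Longrightarrow> q \<ge> N1 \<Longrightarrow> \<bar>potential (\<lambda>x. (us p x + us q x) / 2) - potential u\<bar> < e / 32"
    using potential_averages_tendsto[OF us u e'] by blast
  obtain N2 where N2: "\<And>p. p \<ge> N2 \<Longrightarrow> \<bar>potential (us p) - potential u\<bar> < e / 32"
    using LIMSEQ_D[OF potential_tendsto[OF us u] e'] by auto
  obtain N3 where N3: "\<And>p. p \<ge> N3 \<Longrightarrow> \<bar>energy (us p) (gs p) - energy_infimum\<bar> < e / 32"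
    using LIMSEQ_D[OF energy e'] by auto
  have "(\<integral>x. (norm (gs p x - gs q x))\<^sup>2 \<partial>lebesgue) < e" if p: "p \<ge> max N1 (max N2 N3)" and q: "q \<ge> max N1 (max N2 N3)" for p q
  proof -
    define A where "A x = (us p x + us q x) / 2" for x
    define G where "G x = (1/2) *\<^sub>R (gs p x + gs q x)" for x
    have "(L2_norm lebesgue (\<lambda>x. gs p x - gs q x))\<^sup>2 / 4 + norm_sq A G \<le> (norm_sq (us p) (gs p) + norm_sq (us q) (gs q)) / 2"
      unfolding A_def G_def by (rule norm_sq_parallelogram[OF us(1,1)])
    moreover have "energy_infimum + potential u - e / 32 < norm_sq A G / 2"
    proof -
      have "energy_infimum \<le> energy A G"
        unfolding A_def G_def by (rule energy_infimum_le[OF admissible_average[OF us(1,1)]])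
      moreover have "\<bar>potential A - potential u\<bar> < e / 32" unfolding A_def using p q by (intro N1) auto
      ultimately show ?thesis unfolding energy_def abs_less_iff by argo
    qed
    moreover have "norm_sq (us k) (gs k) / 2 < energy_infimum + potential u + e / 16" if "k \<ge> max N1 (max N2 N3)" for k
      using N2[of k] N3[of k] that unfolding energy_def abs_less_iff max.bounded_iff by argo
    from this[OF p] this[OF q]
    have "(norm_sq (us p) (gs p) + norm_sq (us q) (gs q)) / 2 < 2 * (energy_infimum + potential u) + e / 8" by simp
    ultimately have "(L2_norm lebesgue (\<lambda>x. gs p x - gs q x))\<^sup>2 < e" using e_pos by argo
    then show ?thesis by (simp add: L2_norm_power2)
  qed
  then show ?thesis by blast
qed

theorem minimizer_exists:
  obtains u g where "minimizer u g" "AE x in lebesgue. u x \<ge> 0"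
proof -
  obtain us gs M where us: "\<And>k. admissible (us k) (gs k)" "\<And>k x. us k x \<ge> 0" "\<And>k. norm_sq (us k) (gs k) \<le> M"
    and energy: "(\<lambda>k. energy (us k) (gs k)) \<longlonglongrightarrow> energy_infimum"
    by (rule minimizing_sequence) (rule that)
  obtain s :: "nat \<Rightarrow> nat" and v where s: "strict_mono s" and v: "(\<lambda>x::real^'n. v (norm x)) \<in> borel_measurable lebesgue"
    and us_lim: "AE x in lebesgue. (\<lambda>j. us (s j) x) \<longlonglongrightarrow> v (norm x)"
    by (rule admissible_convergent_subsequence[OF us(1,3)])
  let ?u = "\<lambda>x::real^'n. v (norm x)"
  have energy_s: "(\<lambda>j. energy (us (s j)) (gs (s j))) \<longlonglongrightarrow> energy_infimum"
    using LIMSEQ_subseq_LIMSEQ[OF energy s] by (simp add: o_def)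
  note gradients_Cauchy = minimizing_gradients_Cauchy[where us="\<lambda>j. us (s j)" and u="?u", OF us(1,3) v us_lim energy_s]
  obtain g and t :: "nat \<Rightarrow> nat" where t: "strict_mono t" and g: "square_integrable lebesgue g"
    "AE x in lebesgue. (\<lambda>j. gs (s (t j)) x) \<longlonglongrightarrow> g x" "(\<lambda>j. L2_norm lebesgue (\<lambda>x. gs (s (t j)) x - g x)) \<longlonglongrightarrow> 0"
    by (rule L2_Cauchy_limit[of lebesgue "\<lambda>j. gs (s j)", OF admissibleD(2)[OF us(1)] gradients_Cauchy])
  have us_t_lim: "AE x in lebesgue. (\<lambda>j. us (s (t j)) x) \<longlonglongrightarrow> ?u x"
    using us_lim
  proof eventually_elim
    case (elim x)
    from LIMSEQ_subseq_LIMSEQ[OF this t] show ?case by (simp add: o_def)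
  qed
  have "(\<lambda>j. 2 * (energy (us (s (t j))) (gs (s (t j))) + potential (us (s (t j))))) \<longlonglongrightarrow> 2 * (energy_infimum + potential ?u)"
    using LIMSEQ_subseq_LIMSEQ[OF energy_s t] potential_tendsto[where u="?u", OF us(1,3) v us_t_lim]
    by (intro tendsto_intros) (simp_all add: o_def)
  then have norm_sq_lim: "(\<lambda>j. norm_sq (us (s (t j))) (gs (s (t j)))) \<longlonglongrightarrow> 2 * (energy_infimum + potential ?u)"
    by (simp add: energy_def)
  note limit = admissible_limit[OF us(1,3) norm_sq_lim v us_t_lim g]
  have "energy ?u g \<le> energy_infimum" using limit(2) by (simp add: energy_def)
  then have "minimizer ?u g" using limit(1) energy_infimum_le order_trans unfolding minimizer_def by blast
  moreover have "AE x in lebesgue. ?u x \<ge> 0"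
    using us_lim by eventually_elim (auto intro: LIMSEQ_le_const simp: us(2))
  ultimately show ?thesis by (rule that)
qed

lemma growth_term_dominated:
  fixes u h :: "real^'n \<Rightarrow> real"
  assumes u: "integrable lebesgue (\<lambda>x. Hardy_weight V (norm x) * (u x)\<^sup>2)"
    and h: "integrable lebesgue (\<lambda>x. Hardy_weight V (norm x) * (h x)\<^sup>2)"
  obtains d where "integrable lebesgue d"
    "AE x in lebesgue. K (norm x) * ((\<bar>u x\<bar> + \<bar>h x\<bar>) * growth (\<bar>u x\<bar> + \<bar>h x\<bar>)) \<le> d x"
proof -
  obtain C where C: "\<And>x t. x \<noteq> 0 \<Longrightarrow> t \<ge> 0 \<Longrightarrow>
      K (norm x) * (t * growth t) \<le> 1 * (Hardy_weight V (norm x) * t\<^sup>2) + C * remainder x"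
    using absorb[of 1] by auto
  let ?d = "\<lambda>x. 2 * (Hardy_weight V (norm x) * (u x)\<^sup>2) + 2 * (Hardy_weight V (norm x) * (h x)\<^sup>2) + C * remainder x"
  have "AE x in lebesgue. K (norm x) * ((\<bar>u x\<bar> + \<bar>h x\<bar>) * growth (\<bar>u x\<bar> + \<bar>h x\<bar>)) \<le> ?d x"
    using AE_neq_0
  proof eventually_elim
    case (elim x)
    have "K (norm x) * ((\<bar>u x\<bar> + \<bar>h x\<bar>) * growth (\<bar>u x\<bar> + \<bar>h x\<bar>))
        \<le> Hardy_weight V (norm x) * (\<bar>u x\<bar> + \<bar>h x\<bar>)\<^sup>2 + C * remainder x"
      using C[OF elim, of "\<bar>u x\<bar> + \<bar>h x\<bar>"] by simp
    also have "(\<bar>u x\<bar> + \<bar>h x\<bar>)\<^sup>2 \<le> 2 * (u x)\<^sup>2 + 2 * (h x)\<^sup>2"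
      using sum_squares_bound[of "\<bar>u x\<bar>" "\<bar>h x\<bar>"] by (simp add: power2_sum)
    then have "Hardy_weight V (norm x) * (\<bar>u x\<bar> + \<bar>h x\<bar>)\<^sup>2 + C * remainder x
        \<le> Hardy_weight V (norm x) * (2 * (u x)\<^sup>2 + 2 * (h x)\<^sup>2) + C * remainder x"
      using Hardy_weight_nonneg[OF elim] by (intro add_right_mono mult_left_mono)
    also have "\<dots> = ?d x" by (simp add: algebra_simps)
    finally show ?case .
  qed
  then show ?thesis using that[of ?d] u h remainder_integrable by simp
qed

lemma difference_quotient_Fprim_le:
  assumes "\<bar>s\<bar> \<le> B" "B \<ge> 1" "s \<noteq> 0"
  shows "\<bar>(Fprim f (t + s * r) - Fprim f t) / s\<bar> \<le> (\<bar>t\<bar> + \<bar>B * r\<bar>) * growth (\<bar>t\<bar> + \<bar>B * r\<bar>)"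
proof -
  let ?T = "\<bar>t\<bar> + \<bar>B * r\<bar>"
  have "\<bar>s * r\<bar> \<le> \<bar>B * r\<bar>" using assms by (simp add: abs_mult mult_right_mono)
  then have "\<bar>Fprim f (t + s * r) - Fprim f t\<bar> \<le> growth ?T * \<bar>(t + s * r) - t\<bar>" by (intro Fprim_diff_le) auto
  then have "\<bar>(Fprim f (t + s * r) - Fprim f t) / s\<bar> \<le> growth ?T * \<bar>r\<bar>"
    using assms(3) by (simp add: abs_mult divide_le_eq mult_ac)
  also have "\<dots> \<le> growth ?T * ?T"
  proof (rule mult_left_mono)
    have "1 * \<bar>r\<bar> \<le> \<bar>B * r\<bar>" using assms(2) unfolding abs_mult by (intro mult_right_mono) auto
    then show "\<bar>r\<bar> \<le> ?T" by simp
  qed (simp add: growth_nonneg)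
  finally show ?thesis by (simp add: mult.commute)
qed

lemma difference_quotient_Fprim_tendsto:
  assumes "X \<longlonglongrightarrow> 0" "\<And>i. X i \<noteq> 0"
  shows "(\<lambda>i. (Fprim f (t + X i * r) - Fprim f t) / X i) \<longlonglongrightarrow> f (max 0 t) * r"
proof -
  have "((\<lambda>s. Fprim f (t + s * r)) has_real_derivative f (max 0 (t + 0 * r)) * r) (at 0)"
    by (rule DERIV_chain2[OF Fprim_derivative]) (auto intro!: derivative_eq_intros)
  then have "(\<lambda>s. (Fprim f (t + s * r) - Fprim f t) / s) \<midarrow>0\<rightarrow> f (max 0 t) * r" by (simp add: DERIV_def)
  moreover have "filterlim X (at 0) sequentially" using assms by (simp add: filterlim_at)
  ultimately show ?thesis by (rule filterlim_compose)
qed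

lemma potential_difference_quotient_eq:
  assumes u: "admissible u g" and h: "admissible h k"
  shows "(potential (\<lambda>x. u x + s * h x) - potential u) / s
    = (\<integral>x. K (norm x) * ((Fprim f (u x + s * h x) - Fprim f (u x)) / s) \<partial>lebesgue)"
proof -
  have uh: "admissible (\<lambda>x. u x + s * h x) (\<lambda>x. g x + s *\<^sub>R k x)" by (rule admissible_add_scaleR[OF u h])
  note K_F = K_Fprim_integrable[OF admissibleD(1)[OF u] Hardy_inequality(1)[OF u]]
    K_Fprim_integrable[OF admissibleD(1)[OF uh] Hardy_inequality(1)[OF uh]]
  have "K (norm x) * ((Fprim f (u x + s * h x) - Fprim f (u x)) / s)
      = (K (norm x) * Fprim f (u x + s * h x) - K (norm x) * Fprim f (u x)) / s" for x
    by (simp add: right_diff_distrib)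
  then show ?thesis by (simp only: potential_def integral_divide_zero Bochner_Integration.integral_diff[OF K_F(2,1)])
qed

lemma potential_difference_quotient_tendsto:
  assumes u: "admissible u g" and h: "admissible h k" and X: "X \<longlonglongrightarrow> 0" "\<And>i. X i \<noteq> 0"
  shows "integrable lebesgue (\<lambda>x. K (norm x) * f (max 0 (u x)) * h x)"
    and "(\<lambda>i. (potential (\<lambda>x. u x + X i * h x) - potential u) / X i) \<longlonglongrightarrow> (\<integral>x. K (norm x) * f (max 0 (u x)) * h x \<partial>lebesgue)"
proof -
  obtain B where B: "\<And>i. \<bar>X i\<bar> \<le> B" "B \<ge> 1"
  proof -
    obtain B where "\<And>i. norm (X i) \<le> B" using convergent_imp_Bseq[OF convergentI[OF X(1)]] by (auto simp: Bseq_def)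
    then show ?thesis using that[of "max 1 B"] by (simp add: le_max_iff_disj)
  qed
  have Bh: "admissible (\<lambda>x. B * h x) (\<lambda>x. B *\<^sub>R k x)" by (rule admissible_scaleR[OF h])
  obtain d where d: "integrable lebesgue d"
    "AE x in lebesgue. K (norm x) * ((\<bar>u x\<bar> + \<bar>B * h x\<bar>) * growth (\<bar>u x\<bar> + \<bar>B * h x\<bar>)) \<le> d x"
    by (rule growth_term_dominated[OF Hardy_inequality(1)[OF u] Hardy_inequality(1)[OF Bh]])
  let ?q = "\<lambda>i x. K (norm x) * ((Fprim f (u x + X i * h x) - Fprim f (u x)) / X i)"
  let ?l = "\<lambda>x. K (norm x) * f (max 0 (u x)) * h x"
  note [measurable] = K_measurable admissibleD(1)[OF u] admissibleD(1)[OF h]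
  have [measurable]: "f \<in> borel_measurable borel" by (rule borel_measurable_continuous_onI[OF f_cont])
  have l_meas: "?l \<in> borel_measurable lebesgue" by measurable
  have q_meas: "?q i \<in> borel_measurable lebesgue" for i
    by (intro borel_measurable_times borel_measurable_divide borel_measurable_diff Fprim_measurable) measurable
  have lim: "AE x in lebesgue. (\<lambda>i. ?q i x) \<longlonglongrightarrow> ?l x"
    unfolding mult.assoc by (intro AE_I2 tendsto_mult_left difference_quotient_Fprim_tendsto[OF X])
  have dominated: "AE x in lebesgue. norm (?q i x) \<le> d x" for i
    using d(2) AE_neq_0
  proof eventually_elim
    case (elim x)
    have "norm (?q i x) = K (norm x) * \<bar>(Fprim f (u x + X i * h x) - Fprim f (u x)) / X i\<bar>"
      using K_pos[of "norm x"] elim(2) by (simp add: abs_mult)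
    also have "\<dots> \<le> K (norm x) * ((\<bar>u x\<bar> + \<bar>B * h x\<bar>) * growth (\<bar>u x\<bar> + \<bar>B * h x\<bar>))"
      using K_pos[of "norm x"] elim(2) by (intro mult_left_mono difference_quotient_Fprim_le B X(2)) auto
    finally show ?case using elim(1) by linarith
  qed
  show "integrable lebesgue ?l" by (rule integrable_dominated_convergence[OF l_meas q_meas d(1) lim dominated])
  show "(\<lambda>i. (potential (\<lambda>x. u x + X i * h x) - potential u) / X i) \<longlonglongrightarrow> (\<integral>x. ?l x \<partial>lebesgue)"
    unfolding potential_difference_quotient_eq[OF u h] by (rule integral_dominated_convergence[OF l_meas q_meas d(1) lim dominated])
qed

lemma potential_has_real_derivative:
  assumes "admissible u g" "admissible h k"
  shows "((\<lambda>s. potential (\<lambda>x. u x + s * h x)) has_real_derivative (\<integral>x. K (norm x) * f (max 0 (u x)) * h x \<partial>lebesgue)) (at 0)"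
  using potential_difference_quotient_tendsto(2)[OF assms]
  by (auto simp: DERIV_def tendsto_at_iff_sequentially o_def)

proposition Euler_Lagrange:
  assumes "minimizer u g" and h: "admissible h k"
  shows "form u g h k = (\<integral>x. K (norm x) * f (max 0 (u x)) * h x \<partial>lebesgue)"
proof -
  have u: "admissible u g" and min: "\<And>h k. admissible h k \<Longrightarrow> energy u g \<le> energy h k"
    using assms(1) by (auto simp: minimizer_def)
  let ?E = "\<lambda>s. energy (\<lambda>x. u x + s * h x) (\<lambda>x. g x + s *\<^sub>R k x)"
  have "((\<lambda>s. (norm_sq u g + 2 * s * form u g h k + s\<^sup>2 * norm_sq h k) / 2) has_real_derivative form u g h k) (at 0)"
    by (auto intro!: derivative_eq_intros)
  from DERIV_diff[OF this potential_has_real_derivative[OF u h]]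
  have E_deriv: "(?E has_real_derivative form u g h k - (\<integral>x. K (norm x) * f (max 0 (u x)) * h x \<partial>lebesgue)) (at 0)"
    by (simp add: energy_def norm_sq_add_scaleR[OF u h])
  have "\<forall>s. \<bar>0 - s\<bar> < 1 \<longrightarrow> ?E 0 \<le> ?E s" using min[OF admissible_add_scaleR[OF u h]] by simp
  from DERIV_local_min[OF E_deriv zero_less_one this]
  have "form u g h k - (\<integral>x. K (norm x) * f (max 0 (u x)) * h x \<partial>lebesgue) = 0" .
  then show ?thesis by simp
qed

lemma radial_solution_minimizer:
  assumes min: "minimizer u g" and nonneg: "AE x in lebesgue. u x \<ge> 0"
  shows "radial_solution V K f u"
  unfolding radial_solution_def
proof (intro conjI allI impI)
  have u: "admissible u g" using min by (simp add: minimizer_def)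
  then show "H1Vr V u" by (simp add: admissible_def)
  fix g' gh and h :: "real^'n \<Rightarrow> real" assume g': "weak_grad u g'" and "H1Vr V h" and gh: "weak_grad h gh"
  then obtain k where h: "admissible h k" and k: "weak_grad h k"
    by (auto simp: H1Vr_def D12_def admissible_def square_integrable_def weak_grad_measurable)
  have AE_inner: "AE x in lebesgue. g' x \<bullet> gh x = g x \<bullet> k x"
    using weak_grad_unique[OF g' admissibleD(6)[OF u]] weak_grad_unique[OF gh k] by eventually_elim simp
  have AE_f: "AE x in lebesgue. K (norm x) * f (u x) * h x = K (norm x) * f (max 0 (u x)) * h x"
    using nonneg by eventually_elim (simp add: max_def)
  note integrable = form_integrable[OF u h]
  show "integrable lebesgue (\<lambda>x. g' x \<bullet> gh x)"
    using integrable(1) by (simp add: lebesgue_integral_cong_AE(1)[OF AE_inner])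
  show "integrable lebesgue (\<lambda>x. V (norm x) * u x * h x)" by (rule integrable(2))
  show "integrable lebesgue (\<lambda>x. K (norm x) * f (u x) * h x)"
    unfolding lebesgue_integral_cong_AE(1)[OF AE_f]
    by (rule potential_difference_quotient_tendsto(1)[OF u h LIMSEQ_inverse_real_of_nat]) simp
  show "(\<integral>x. g' x \<bullet> gh x \<partial>lebesgue) + (\<integral>x. V (norm x) * u x * h x \<partial>lebesgue) = (\<integral>x. K (norm x) * f (u x) * h x \<partial>lebesgue)"
    using Euler_Lagrange[OF min h] unfolding lebesgue_integral_cong_AE(2)[OF AE_inner] lebesgue_integral_cong_AE(2)[OF AE_f] form_def .
qed

theorem solution_if_negative_energy:
  assumes "admissible h k" "energy h k < 0"
  shows "\<exists>u :: real^'n \<Rightarrow> real. radial_solution V K f u \<and> (AE x in lebesgue. u x \<ge> 0) \<and> \<not> (AE x in lebesgue. u x = 0)"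
proof -
  obtain u g where min: "minimizer u g" and nonneg: "AE x in lebesgue. u x \<ge> 0" by (rule minimizer_exists)
  have "\<not> (AE x in lebesgue. u x = 0)"
  proof
    assume "AE x in lebesgue. u x = 0"
    then have "AE x in lebesgue. K (norm x) * Fprim f (u x) = 0" by eventually_elim (simp add: Fprim_nonpos)
    then have "potential u = 0" unfolding potential_def by (rule integral_eq_zero_AE)
    then have "energy u g \<ge> 0" using norm_sq_nonneg[of u g] by (simp add: energy_def)
    then show False using min assms unfolding minimizer_def by fastforce
  qed
  then show ?thesis using radial_solution_minimizer[OF min nonneg] nonneg by blast
qed

end

section \<open>The weights and the exponents\<close>

lemma Liminf_pos_eventually_greater:
  fixes h :: "'a \<Rightarrow> real"
  assumes "Liminf F (\<lambda>x. ereal (h x)) > 0"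
  obtains c where "c > 0" "\<forall>\<^sub>F x in F. h x > c"
proof -
  obtain c where c: "0 < ereal c" "ereal c < Liminf F (\<lambda>x. ereal (h x))"
    using ereal_dense2[OF assms] by auto
  then show ?thesis using that[of c] less_LiminfD[OF c(2)] by auto
qed

lemma Limsup_finite_eventually_less:
  fixes h :: "'a \<Rightarrow> real"
  assumes "Limsup F (\<lambda>x. ereal (h x)) < \<infinity>"
  obtains C where "C > 0" "\<forall>\<^sub>F x in F. h x < C"
proof -
  obtain c where "Limsup F (\<lambda>x. ereal (h x)) < ereal c" using ereal_dense2[OF assms] by auto
  from Limsup_lessD[OF this] have "\<forall>\<^sub>F x in F. h x < max c 1" by eventually_elim auto
  then show ?thesis using that[of "max c 1"] by auto
qed

lemma continuous_on_bounded_interval: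
  fixes p :: "real \<Rightarrow> real"
  assumes "continuous_on {0<..} p" "0 < r"
  obtains C where "C \<ge> 0" "\<And>t. t \<in> {r..s} \<Longrightarrow> \<bar>p t\<bar> \<le> C"
proof -
  have "compact (p ` {r..s})"
    using assms(2) by (intro compact_continuous_image continuous_on_subset[OF assms(1)]) auto
  then obtain C where "C > 0" "\<And>y. y \<in> p ` {r..s} \<Longrightarrow> norm y \<le> C"
    using compact_imp_bounded bounded_pos by metis
  then show ?thesis using that[of C] by auto
qed

lemma integrable_radial_bound:
  fixes p b :: "real \<Rightarrow> real"
  assumes p: "continuous_on {0<..} p" and A: "A \<in> sets borel"
    and b: "integrable lebesgue (\<lambda>x::'a::euclidean_space. b (norm x))"
    and p_le: "\<And>r. r > 0 \<Longrightarrow> r \<in> A \<Longrightarrow> \<bar>p r\<bar> \<le> b r" "\<And>r. r > 0 \<Longrightarrow> r \<notin> A \<Longrightarrow> 0 \<le> b r"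
  shows "integrable lebesgue (\<lambda>x::'a. indicator A (norm x) * p (norm x))"
proof (rule Bochner_Integration.integrable_bound[OF b])
  have "(\<lambda>x::'a. p (norm x)) \<in> borel_measurable lebesgue"
    using borel_measurable_radial[OF p] by (auto intro: measurable_completion)
  then show "(\<lambda>x::'a. indicator A (norm x) * p (norm x)) \<in> borel_measurable lebesgue"
    by (intro borel_measurable_times borel_measurable_lebesgue_indicator_norm[OF A])
  show "AE x::'a in lebesgue. norm (indicator A (norm x) * p (norm x)) \<le> norm (b (norm x))"
    using AE_neq_0
  proof eventually_elim
    case (elim x)
    then show ?case using p_le[of "norm x"] by (cases "norm x \<in> A") auto
  qed
qed

lemma integrable_radial_near_0:
  fixes p :: "real \<Rightarrow> real"
  assumes p: "continuous_on {0<..} p" "\<And>r. r > 0 \<Longrightarrow> p r \<ge> 0"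
    and p_le: "\<forall>\<^sub>F r in at_right 0. p r \<le> C * r powr e" and e: "e > - real DIM('a::euclidean_space)"
  shows "integrable lebesgue (\<lambda>x::'a. indicator {..R} (norm x) * p (norm x))"
proof -
  obtain r0 where r0: "r0 > 0" "\<And>r. 0 < r \<Longrightarrow> r < r0 \<Longrightarrow> p r \<le> C * r powr e"
    using p_le by (auto simp: eventually_at_right_field)
  obtain D where D: "D \<ge> 0" "\<And>t. t \<in> {r0..R} \<Longrightarrow> \<bar>p t\<bar> \<le> D"
    by (rule continuous_on_bounded_interval[OF p(1) r0(1)]) blast
  let ?b = "\<lambda>r. \<bar>C\<bar> * (indicator {..R} r * r powr e) + D * (indicator {..R} r * r powr 0)"
  show ?thesis
  proof (rule integrable_radial_bound[OF p(1), where b="?b"])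
    show "integrable lebesgue (\<lambda>x::'a. ?b (norm x))"
      using integrable_norm_powr_inside[where 'a='a and e=e, OF e] integrable_norm_powr_inside[where 'a='a and e=0] by simp
    fix r :: real assume r: "r > 0" "r \<in> {..R}"
    have "p r \<le> \<bar>C\<bar> * r powr e + D"
    proof (cases "r < r0")
      case True
      have "p r \<le> C * r powr e" by (rule r0(2)[OF r(1) True])
      also have "\<dots> \<le> \<bar>C\<bar> * r powr e" by (intro mult_right_mono) auto
      finally show ?thesis using D(1) by linarith
    next
      case False
      then have "p r \<le> D" using D(2)[of r] r by (simp add: abs_le_iff)
      moreover have "0 \<le> \<bar>C\<bar> * r powr e" by simp
      ultimately show ?thesis by linarith
    qed
    then show "\<bar>p r\<bar> \<le> ?b r" using p(2)[OF r(1)] r by simp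
  qed simp_all
qed

lemma integrable_radial_near_infinity:
  fixes p :: "real \<Rightarrow> real"
  assumes p: "continuous_on {0<..} p" "\<And>r. r > 0 \<Longrightarrow> p r \<ge> 0"
    and p_le: "\<forall>\<^sub>F r in at_top. p r \<le> C * r powr e" and e: "e < - real DIM('a::euclidean_space)" and R_pos: "R > 0"
  shows "integrable lebesgue (\<lambda>x::'a. indicator {R<..} (norm x) * p (norm x))"
proof -
  obtain r0 where r0: "\<And>r. r > r0 \<Longrightarrow> p r \<le> C * r powr e" using p_le by (auto simp: eventually_at_top_dense)
  obtain D where D: "D \<ge> 0" "\<And>t. t \<in> {R..r0} \<Longrightarrow> \<bar>p t\<bar> \<le> D"
    by (rule continuous_on_bounded_interval[OF p(1) R_pos]) blast
  let ?b = "\<lambda>r. \<bar>C\<bar> * (indicator {R<..} r * r powr e) + D * (indicator {..r0} r * r powr 0)"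
  show ?thesis
  proof (rule integrable_radial_bound[OF p(1), where b="?b"])
    have "integrable lebesgue (\<lambda>x::'a. indicator {R<..} (norm x) * norm x powr e)"
      using has_bochner_integral_norm_powr_outside[OF e R_pos] by (simp add: has_bochner_integral_iff)
    then show "integrable lebesgue (\<lambda>x::'a. ?b (norm x))"
      using integrable_norm_powr_inside[where 'a='a and e=0] by simp
    show "0 \<le> ?b r" for r using D(1) by simp
    fix r :: real assume r: "r > 0" "r \<in> {R<..}"
    have "p r \<le> ?b r"
    proof (cases "r > r0")
      case True
      have "p r \<le> C * r powr e" by (rule r0[OF True])
      also have "\<dots> \<le> \<bar>C\<bar> * r powr e" by (intro mult_right_mono) auto
      finally show ?thesis using r True by simp
    next
      case False
      then have "p r \<le> D" using D(2)[of r] r by (simp add: abs_le_iff)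
      moreover have "0 \<le> \<bar>C\<bar> * r powr e" by simp
      ultimately have "p r \<le> \<bar>C\<bar> * r powr e + D" by linarith
      then show ?thesis using False r by simp
    qed
    then show "\<bar>p r\<bar> \<le> ?b r" using p(2)[OF r(1)] by simp
  qed simp
qed

text \<open>Young's inequality with exponents \<open>2 / q\<close> and \<open>2 / (2 - q)\<close>, applied to \<open>e * W * t\<^sup>2\<close> and the remaining factor.\<close>

lemma mult_powr_le_quadratic_plus_dual:
  fixes k W e t q :: real
  assumes k_pos: "k > 0" and W_pos: "W > 0" and e_pos: "e > 0" and t_nonneg: "t \<ge> 0" and q: "0 < q" "q < 2"
  shows "k * t powr q \<le> e * (W * t\<^sup>2) + e powr (- q / (2 - q)) * (k powr (2 / (2 - q)) * W powr (- q / (2 - q)))"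
proof (cases "t = 0")
  case False
  define A where "A = e * (W * t\<^sup>2)"
  define D where "D = e powr (- q / (2 - q)) * (k powr (2 / (2 - q)) * W powr (- q / (2 - q)))"
  have pos: "A > 0" "D > 0" using e_pos W_pos k_pos False by (auto simp: A_def D_def)
  have exponents: "- q / (2 - q) * (1 - q / 2) = - q / 2" "2 / (2 - q) * (1 - q / 2) = 1"
    using q by (auto simp: field_simps)
  have "(t\<^sup>2) powr (q / 2) = t powr q" using t_nonneg False by (simp add: powr_powr flip: powr_numeral)
  then have "A powr (q / 2) = e powr (q / 2) * (W powr (q / 2) * t powr q)"
    using e_pos W_pos by (simp add: A_def powr_mult)
  moreover have "D powr (1 - q / 2) = e powr (- q / 2) * (k * W powr (- q / 2))"
    unfolding D_def powr_mult powr_powr exponents using k_pos by simp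
  ultimately have "A powr (q / 2) * D powr (1 - q / 2)
      = (e powr (q / 2) * e powr (- q / 2)) * (W powr (q / 2) * W powr (- q / 2)) * (k * t powr q)"
    by (simp only: mult_ac)
  also have "\<dots> = k * t powr q" using e_pos W_pos by (simp add: powr_add[symmetric])
  finally have "k * t powr q = A powr (q / 2) * D powr (1 - q / 2)" by simp
  also have "\<dots> \<le> q / 2 * A + (1 - q / 2) * D"
    using q pos by (intro Youngs_inequality_0) auto
  also have "\<dots> \<le> 1 * A + 1 * D" using q pos by (intro add_mono mult_right_mono) auto
  finally show ?thesis by (simp add: A_def D_def)
qed simp

definition dual_weight :: "(real \<Rightarrow> real) \<Rightarrow> (real \<Rightarrow> real) \<Rightarrow> real \<Rightarrow> real \<Rightarrow> real" where
  "dual_weight V K q r = K r powr (2 / (2 - q)) * Hardy_weight V r powr (- q / (2 - q))"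

lemma dual_weight_nonneg: "dual_weight V K q r \<ge> 0"
  by (simp add: dual_weight_def)

lemma Hardy_weight_pos: "r > 0 \<Longrightarrow> V r \<ge> 0 \<Longrightarrow> Hardy_weight V r > 0"
  by (simp add: Hardy_weight_def add_nonneg_pos)

lemma continuous_on_dual_weight:
  assumes "continuous_on {0<..} V" "continuous_on {0<..} K" "\<And>r. r > 0 \<Longrightarrow> V r \<ge> 0" "\<And>r. r > 0 \<Longrightarrow> K r > 0"
  shows "continuous_on {0<..} (dual_weight V K q)"
proof -
  have "Hardy_weight V r \<noteq> 0" "K r \<noteq> 0" if "r > 0" for r
    using Hardy_weight_pos[of r V] assms(3,4)[OF that] that by simp_all
  then show ?thesis
    unfolding dual_weight_def Hardy_weight_def by (intro continuous_intros assms(1,2)) auto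
qed

lemma Hardy_weight_ge_powr:
  assumes r_pos: "r > 0" and V: "V r \<ge> 0" "c * r powr a \<le> V r" and \<alpha>: "\<alpha> = a \<or> \<alpha> = - 2"
  shows "min c 1 * r powr \<alpha> \<le> Hardy_weight V r"
  using \<alpha>
proof
  assume "\<alpha> = a"
  have "min c 1 * r powr a \<le> c * r powr a" by (intro mult_right_mono) auto
  also have "\<dots> \<le> Hardy_weight V r" using V(2) by (simp add: Hardy_weight_def add_increasing2)
  finally show ?thesis by (simp add: \<open>\<alpha> = a\<close>)
next
  assume "\<alpha> = - 2"
  have "min c 1 * r powr (- 2) \<le> 1 * r powr (- 2)" by (intro mult_right_mono) auto
  also have "\<dots> = 1 / r\<^sup>2" using r_pos by (simp add: powr_minus_divide)
  also have "\<dots> \<le> Hardy_weight V r" using V(1) by (simp add: Hardy_weight_def)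
  finally show ?thesis by (simp add: \<open>\<alpha> = - 2\<close>)
qed

lemma dual_weight_le_powr:
  assumes q: "0 < q" "q < 2" and r_pos: "r > 0" and K: "0 \<le> K r" "K r \<le> C * r powr b" and C_nonneg: "C \<ge> 0"
    and W: "c * r powr \<alpha> \<le> Hardy_weight V r" and c_pos: "c > 0"
  shows "dual_weight V K q r \<le> (C powr (2 / (2 - q)) * c powr (- q / (2 - q))) * r powr ((2 * b - \<alpha> * q) / (2 - q))"
proof -
  have "dual_weight V K q r \<le> (C * r powr b) powr (2 / (2 - q)) * (c * r powr \<alpha>) powr (- q / (2 - q))"
    unfolding dual_weight_def using K W c_pos r_pos q
    by (intro mult_mono powr_mono2 powr_mono2') (auto intro: divide_nonpos_pos)
  also have "\<dots> = (C powr (2 / (2 - q)) * c powr (- q / (2 - q))) * (r powr (b * (2 / (2 - q))) * r powr (\<alpha> * (- q / (2 - q))))"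
    using C_nonneg c_pos by (simp add: powr_mult powr_powr)
  also have "r powr (b * (2 / (2 - q))) * r powr (\<alpha> * (- q / (2 - q))) = r powr ((2 * b - \<alpha> * q) / (2 - q))"
    unfolding powr_add[symmetric] by (simp add: diff_divide_distrib mult.commute)
  finally show ?thesis .
qed

lemma dual_weight_eventually_le_powr:
  assumes q: "0 < q" "q < 2" and pos: "\<forall>\<^sub>F r in F. r > 0"
    and V: "\<And>r. r > 0 \<Longrightarrow> V r \<ge> 0" "Liminf F (\<lambda>r. ereal (V r / r powr a)) > 0"
    and K: "\<And>r. r > 0 \<Longrightarrow> K r \<ge> 0" "Limsup F (\<lambda>r. ereal (K r / r powr b)) < \<infinity>"
    and \<alpha>: "\<alpha> = a \<or> \<alpha> = - 2"
  obtains C where "\<forall>\<^sub>F r in F. dual_weight V K q r \<le> C * r powr ((2 * b - \<alpha> * q) / (2 - q))"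
proof -
  obtain c where c: "c > 0" "\<forall>\<^sub>F r in F. V r / r powr a > c" by (rule Liminf_pos_eventually_greater[OF V(2)])
  obtain C where C: "C > 0" "\<forall>\<^sub>F r in F. K r / r powr b < C" by (rule Limsup_finite_eventually_less[OF K(2)])
  have "\<forall>\<^sub>F r in F. dual_weight V K q r \<le> (C powr (2 / (2 - q)) * (min c 1) powr (- q / (2 - q))) * r powr ((2 * b - \<alpha> * q) / (2 - q))"
    using pos c(2) C(2)
  proof eventually_elim
    case (elim r)
    then have "c * r powr a \<le> V r" "K r \<le> C * r powr b" by (simp_all add: field_simps)
    then show ?case
      using elim(1) q c(1) C(1) V(1) K(1) \<alpha> by (intro dual_weight_le_powr Hardy_weight_ge_powr) auto
  qed
  then show ?thesis by (rule that)
qed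

definition dual_remainder :: "(real \<Rightarrow> real) \<Rightarrow> (real \<Rightarrow> real) \<Rightarrow> real \<Rightarrow> real \<Rightarrow> 'a::real_normed_vector \<Rightarrow> real" where
  "dual_remainder V K q1 q2 x = dual_weight V K (if norm x \<le> 1 then q1 else q2) (norm x)"

lemma I1_exponent_conditions:
  assumes N: "N \<ge> 3" and b0: "b0 > Min {a0, -(N - a0)/2, -(N + 2)/2}" and q: "q \<in> I1 N a0 b0"
  shows "1 < q" "q * (N + min a0 (-2)) < 2 * (N + b0)"
proof -
  have low: "q_low1 N a0 b0 < q" and up: "ereal q < q_up1 N a0 b0" using q by (auto simp: I1_def)
  have "q_low1 N a0 b0 \<ge> 1" by (auto simp: q_low1_def)
  then show "1 < q" using low by linarith
  consider "a0 \<ge> -2" | "-N < a0" "a0 < -2" | "a0 = -N" | "a0 < -N" by linarith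
  then show "q * (N + min a0 (-2)) < 2 * (N + b0)"
  proof cases
    case 1
    then have "q < 2 * (N + b0) / (N - 2)" using up N by (auto simp: q_up1_def)
    then show ?thesis using 1 N by (simp add: less_divide_eq)
  next
    case 2
    then have "q < 2 * (N + b0) / (N + a0)" using up N by (auto simp: q_up1_def)
    then show ?thesis using 2 by (simp add: less_divide_eq)
  next
    case 3
    then have "b0 > -N" using b0 N by (auto simp: min_def split: if_splits)
    then show ?thesis using 3 N by simp
  next
    case 4
    then have "2 * (N + b0) / (N + a0) < q" using low by (auto simp: q_low1_def split: if_splits)
    then show ?thesis using 4 N by (simp add: divide_less_eq)
  qed
qed

lemma I2_exponent_conditions:
  assumes N: "N \<ge> 3" and q: "q \<in> I2 N a b"
  shows "1 < q" "2 * (N + b) < q * (N + max a (-2))"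
proof -
  have low: "q_low2 N a b < q" using q by (auto simp: I2_def)
  have "q_low2 N a b \<ge> 1" by (auto simp: q_low2_def)
  then show "1 < q" using low by linarith
  show "2 * (N + b) < q * (N + max a (-2))"
  proof (cases "a \<le> -2")
    case True
    then have "2 * (N + b) / (N - 2) < q" using low by (auto simp: q_low2_def)
    then show ?thesis using True N by (simp add: divide_less_eq)
  next
    case False
    then have "2 * (N + b) / (N + a) < q" using low by (auto simp: q_low2_def)
    then show ?thesis using False N by (simp add: divide_less_eq max_def)
  qed
qed

proposition dual_remainder_integrable:
  fixes V K :: "real \<Rightarrow> real"
  assumes V: "continuous_on {0<..} V" "\<And>r. r > 0 \<Longrightarrow> V r \<ge> 0" "Liminf (at_right 0) (\<lambda>r. ereal (V r / r powr a0)) > 0"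
      "Liminf at_top (\<lambda>r. ereal (V r / r powr a)) > 0"
    and K: "continuous_on {0<..} K" "\<And>r. r > 0 \<Longrightarrow> K r > 0" "Limsup (at_right 0) (\<lambda>r. ereal (K r / r powr b0)) < \<infinity>"
      "Limsup at_top (\<lambda>r. ereal (K r / r powr b)) < \<infinity>"
    and q1: "0 < q1" "q1 < 2" "q1 * (real DIM('a) + min a0 (-2)) < 2 * (real DIM('a) + b0)"
    and q2: "0 < q2" "q2 < 2" "2 * (real DIM('a) + b) < q2 * (real DIM('a) + max a (-2))"
  shows "integrable lebesgue (dual_remainder V K q1 q2 :: 'a::euclidean_space \<Rightarrow> real)"
proof -
  note K_nonneg = less_imp_le[OF K(2)] and cont = continuous_on_dual_weight[OF V(1) K(1) V(2) K(2)]
  obtain C1 where C1: "\<forall>\<^sub>F r in at_right 0. dual_weight V K q1 r \<le> C1 * r powr ((2 * b0 - min a0 (-2) * q1) / (2 - q1))"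
    by (rule dual_weight_eventually_le_powr[OF q1(1,2) _ V(2,3) K_nonneg K(3), where \<alpha>="min a0 (-2)"])
      (auto simp: eventually_at_right_less min_def)
  have "- real DIM('a) < (2 * b0 - min a0 (-2) * q1) / (2 - q1)"
    using q1 by (simp add: less_divide_eq algebra_simps)
  from integrable_radial_near_0[OF cont dual_weight_nonneg C1 this, of 1]
  have near_0: "integrable lebesgue (\<lambda>x::'a. indicator {..1} (norm x) * dual_weight V K q1 (norm x))" .
  obtain C2 where C2: "\<forall>\<^sub>F r in at_top. dual_weight V K q2 r \<le> C2 * r powr ((2 * b - max a (-2) * q2) / (2 - q2))"
    by (rule dual_weight_eventually_le_powr[OF q2(1,2) _ V(2,4) K_nonneg K(4), where \<alpha>="max a (-2)"])
      (auto simp: eventually_gt_at_top max_def)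
  have "(2 * b - max a (-2) * q2) / (2 - q2) < - real DIM('a)"
    using q2 by (simp add: divide_less_eq algebra_simps)
  from integrable_radial_near_infinity[OF cont dual_weight_nonneg C2 this zero_less_one]
  have "integrable lebesgue (\<lambda>x::'a. indicator {1<..} (norm x) * dual_weight V K q2 (norm x))" .
  from Bochner_Integration.integrable_add[OF near_0 this] show ?thesis
    by (rule Bochner_Integration.integrable_cong[THEN iffD1, rotated 2]) (auto simp: dual_remainder_def)
qed

definition min_power :: "real \<Rightarrow> real \<Rightarrow> real \<Rightarrow> real" where
  "min_power q1 q2 t = min (t powr (q1 - 1)) (t powr (q2 - 1))"

lemma min_power_mono: "1 < q1 \<Longrightarrow> 1 < q2 \<Longrightarrow> 0 \<le> s \<Longrightarrow> s \<le> t \<Longrightarrow> min_power q1 q2 s \<le> min_power q1 q2 t"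
  unfolding min_power_def by (intro min.mono powr_mono2) auto

lemma mult_min_power_le:
  assumes "t \<ge> 0" "q = q1 \<or> q = q2"
  shows "t * min_power q1 q2 t \<le> t powr q"
proof -
  have "t * min_power q1 q2 t \<le> t * t powr (q - 1)"
    using assms by (intro mult_left_mono) (auto simp: min_power_def)
  also have "\<dots> = t powr q" using assms(1) by (cases "t = 0") (auto simp: powr_diff)
  finally show ?thesis .
qed

lemma SUP_finite_imp_min_power_growth:
  fixes f :: "real \<Rightarrow> real"
  assumes "(SUP t\<in>{0<..}. ereal (\<bar>f t\<bar> / min_power q1 q2 t)) < \<infinity>" and f0: "f 0 = 0"
  obtains M where "M > 0" "\<And>t. t \<ge> 0 \<Longrightarrow> \<bar>f t\<bar> \<le> M * min_power q1 q2 t"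
proof -
  obtain c where c: "(SUP t\<in>{0<..}. ereal (\<bar>f t\<bar> / min_power q1 q2 t)) < ereal c"
    using ereal_dense2[OF assms(1)] by auto
  have "\<bar>f t\<bar> \<le> max c 1 * min_power q1 q2 t" if "t \<ge> 0" for t
  proof (cases "t = 0")
    case False
    then have "ereal (\<bar>f t\<bar> / min_power q1 q2 t) < ereal c"
      using that by (intro le_less_trans[OF SUP_upper c]) auto
    then have "\<bar>f t\<bar> / min_power q1 q2 t \<le> max c 1" by simp
    moreover have "min_power q1 q2 t > 0" using False that by (simp add: min_power_def)
    ultimately show ?thesis by (simp only: pos_divide_le_eq)
  qed (simp add: f0 min_power_def)
  then show ?thesis using that[of "max c 1"] by auto
qed

lemma min_power_growth_absorbed:
  assumes V: "\<And>r. r > 0 \<Longrightarrow> V r \<ge> 0" and K: "\<And>r. r > 0 \<Longrightarrow> K r > 0" and M_pos: "M > 0" and e_pos: "e > 0"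
    and q1: "1 < q1" "q1 < 2" and q2: "1 < q2" "q2 < 2"
  shows "\<exists>C. \<forall>x t. x \<noteq> 0 \<longrightarrow> t \<ge> 0 \<longrightarrow> K (norm x) * (t * (M * min_power q1 q2 t))
    \<le> e * (Hardy_weight V (norm x) * t\<^sup>2) + C * dual_remainder V K q1 q2 x"
proof (intro exI allI impI)
  define C where "C q = e powr (- q / (2 - q)) * M powr (2 / (2 - q))" for q
  fix x :: "'a::real_normed_vector" and t :: real
  assume "x \<noteq> 0" and t_nonneg: "t \<ge> 0"
  then have x: "norm x > 0" by simp
  define q where "q = (if norm x \<le> 1 then q1 else q2)"
  have q: "0 < q" "q < 2" "q = q1 \<or> q = q2" using q1 q2 by (auto simp: q_def)
  have "K (norm x) * (t * (M * min_power q1 q2 t)) = M * K (norm x) * (t * min_power q1 q2 t)" by (simp add: mult_ac)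
  also have "\<dots> \<le> M * K (norm x) * t powr q"
    using M_pos K[OF x] by (intro mult_left_mono mult_min_power_le[OF t_nonneg q(3)]) simp
  also have "\<dots> \<le> e * (Hardy_weight V (norm x) * t\<^sup>2) + C q * dual_weight V K q (norm x)"
    using mult_powr_le_quadratic_plus_dual[of "M * K (norm x)" "Hardy_weight V (norm x)", OF _ _ e_pos t_nonneg q(1,2)]
      M_pos K[OF x] Hardy_weight_pos[OF x, of V] V[OF x]
    by (simp add: C_def dual_weight_def powr_mult mult_ac)
  also have "\<dots> \<le> e * (Hardy_weight V (norm x) * t\<^sup>2) + max (C q1) (C q2) * dual_weight V K q (norm x)"
    using q(3) dual_weight_nonneg by (intro add_left_mono mult_right_mono) auto
  finally show "K (norm x) * (t * (M * min_power q1 q2 t))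
      \<le> e * (Hardy_weight V (norm x) * t\<^sup>2) + max (C q1) (C q2) * dual_remainder V K q1 q2 x"
    by (simp add: dual_remainder_def q_def)
qed

section \<open>Functions of negative energy\<close>

definition annulus_bump :: "real \<Rightarrow> real" where
  "annulus_bump r = smooth_step (r - 1) * smooth_step (3 - r)"

lemma annulus_bump_nonneg: "0 \<le> annulus_bump r" and annulus_bump_le_1: "annulus_bump r \<le> 1"
  by (auto simp: annulus_bump_def smooth_step_nonneg smooth_step_le_1 intro: mult_le_one)

lemma annulus_bump_eq_0: "r \<notin> {1..3} \<Longrightarrow> annulus_bump r = 0"
  by (auto simp: annulus_bump_def smooth_step_eq_0 not_le)

lemma annulus_bump_pos: "1 < r \<Longrightarrow> r < 3 \<Longrightarrow> annulus_bump r > 0"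
  by (simp add: annulus_bump_def smooth_step_pos)

lemma test_gradient_annulus_bump:
  obtains G where "test_gradient (\<lambda>x::'a::euclidean_space. annulus_bump (norm x)) G"
proof -
  let ?m' = "\<lambda>r. smooth_step_deriv (r - 1) * smooth_step (3 - r) - smooth_step_deriv (3 - r) * smooth_step (r - 1)"
  have "(annulus_bump has_real_derivative ?m' r) (at r)" for r
    unfolding annulus_bump_def
    using DERIV_mult[OF smooth_step_affine_has_real_derivative[of 1 "-1" r] smooth_step_affine_has_real_derivative[of "-1" 3 r]]
    by simp
  then have "C1_gradient (\<lambda>x::'a. annulus_bump (norm x)) (\<lambda>x. ?m' (norm x) *\<^sub>R sgn x)"
    by (intro C1_gradient_radial[OF zero_less_one, where c=0] continuous_intros) (simp_all add: annulus_bump_eq_0)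
  moreover have "bounded {x::'a. annulus_bump (norm x) \<noteq> 0}"
    using annulus_bump_eq_0 by (intro bounded_subset[OF bounded_cball[of 0 3]]) force
  ultimately show ?thesis using that unfolding test_gradient_def by blast
qed

lemma integrable_radial_annulus:
  fixes h :: "real \<Rightarrow> real"
  assumes "continuous_on {0<..} h" "\<And>r. r \<notin> {1..3} \<Longrightarrow> h r = 0"
  shows "integrable lebesgue (\<lambda>x::'a::euclidean_space. h (norm x))"
proof -
  obtain D where D: "\<And>t. t \<in> {1..3} \<Longrightarrow> \<bar>h t\<bar> \<le> D"
    by (rule continuous_on_bounded_interval[OF assms(1) zero_less_one]) blast
  have "integrable lebesgue (\<lambda>x::'a. indicator {1..3} (norm x) * h (norm x))"
  proof (rule integrable_radial_bound[OF assms(1), where b="\<lambda>r. D * (indicator {..3} r * r powr 0)"])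
    show "integrable lebesgue (\<lambda>x::'a. D * (indicator {..3} (norm x) * norm x powr 0))"
      by (intro integrable_mult_right integrable_norm_powr_inside) simp
    show "0 \<le> D * (indicator {..3} r * r powr 0)" for r using D[of 1] by simp
  qed (use D in auto)
  moreover have "indicator {1..3} r * h r = h r" for r using assms(2)[of r] by (auto simp: indicator_def)
  ultimately show ?thesis by simp
qed

lemma integral_annulus_bump_pos:
  assumes K: "continuous_on {0<..} K" "\<And>r. r > 0 \<Longrightarrow> K r > 0" and \<kappa>_pos: "\<kappa> > 0"
  shows "integrable lebesgue (\<lambda>x::'a::euclidean_space. K (norm x) * annulus_bump (norm x) powr \<kappa>)"
    and "(\<integral>x. K (norm x) * annulus_bump (norm x) powr \<kappa> \<partial>(lebesgue :: 'a measure)) > 0"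
proof -
  have "continuous_on {0<..} (\<lambda>r. K r * annulus_bump r powr \<kappa>)"
    unfolding annulus_bump_def using \<kappa>_pos smooth_step_nonneg
    by (intro continuous_intros K(1) continuous_on_powr') auto
  then show integrable: "integrable lebesgue (\<lambda>x::'a. K (norm x) * annulus_bump (norm x) powr \<kappa>)"
    by (rule integrable_radial_annulus) (simp add: annulus_bump_eq_0)
  have nonneg: "AE x::'a in lebesgue. 0 \<le> K (norm x) * annulus_bump (norm x) powr \<kappa>"
    using AE_neq_0 by eventually_elim (simp add: K(2) less_imp_le)
  let ?A = "{x::'a. 1 < norm x} \<inter> {x. norm x < 3}"
  have "\<not> (AE x::'a in lebesgue. K (norm x) * annulus_bump (norm x) powr \<kappa> = 0)"
  proof
    assume "AE x::'a in lebesgue. K (norm x) * annulus_bump (norm x) powr \<kappa> = 0"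
    then have "AE x in lebesgue. x \<notin> ?A"
    proof eventually_elim
      case (elim x)
      have "K (norm x) > 0" "annulus_bump (norm x) > 0" if "x \<in> ?A"
        using that by (auto intro!: K(2) annulus_bump_pos)
      then show ?case using elim by auto
    qed
    moreover have open_A: "open ?A" by (intro open_Int open_Collect_less continuous_intros)
    ultimately have "negligible ?A" by (simp add: AE_iff_null_sets negligible_iff_null_sets)
    moreover have "2 *\<^sub>R (SOME i. i \<in> Basis) \<in> ?A" by (simp add: SOME_Basis)
    ultimately show False using open_not_negligible[OF open_A] by blast
  qed
  then show "(\<integral>x. K (norm x) * annulus_bump (norm x) powr \<kappa> \<partial>(lebesgue :: 'a measure)) > 0"
    using integral_nonneg_eq_0_iff_AE[OF integrable nonneg] integral_nonneg_AE[OF nonneg] by linarith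
qed

lemma (in radial_potential) admissible_annulus_bump:
  obtains G where "admissible (\<lambda>x. annulus_bump (norm x)) G"
proof -
  obtain G where G: "test_gradient (\<lambda>x::real^'n. annulus_bump (norm x)) G" by (rule test_gradient_annulus_bump)
  have cont: "continuous_on {0<..} annulus_bump" unfolding annulus_bump_def by (intro continuous_intros)
  have "admissible (\<lambda>x. annulus_bump (norm x)) G"
  proof (rule admissibleI)
    show "(\<lambda>x::real^'n. annulus_bump (norm x)) \<in> borel_measurable lebesgue"
      by (rule borel_measurable_lebesgue_continuous[OF test_gradientD(3)[OF G]])
    show "radial (\<lambda>x::real^'n. annulus_bump (norm x))" unfolding radial_def by auto
    show "integrable lebesgue (\<lambda>x::real^'n. \<bar>annulus_bump (norm x)\<bar> powr (2 * real CARD('n) / (real CARD('n) - 2)))"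
      using dim annulus_bump_eq_0
      by (intro integrable_radial_annulus continuous_on_powr' continuous_intros cont) (auto simp: divide_pos_pos)
    show "integrable lebesgue (\<lambda>x::real^'n. V (norm x) * (annulus_bump (norm x))\<^sup>2)"
      by (rule integrable_radial_annulus) (auto intro!: continuous_intros cont V_cont simp: annulus_bump_eq_0)
    show "weak_grad (\<lambda>x. annulus_bump (norm x)) G" by (rule C1_gradient_imp_weak_grad[OF test_gradientD(1)[OF G]])
    show "square_integrable lebesgue G"
      by (rule square_integrable_continuous_bounded_support[OF test_gradientD(2)[OF G] test_gradient_bounded_support[OF G]])
  qed
  then show ?thesis by (rule that)
qed

text \<open>Enlarging the exponent only weakens the bound near 0; a positive one makes \<open>t powr \<kappa>\<close> continuous there.\<close>

lemma Liminf_pos_imp_powr_lower_bound: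
  fixes F :: "real \<Rightarrow> real"
  assumes "Liminf (at_right 0) (\<lambda>t. ereal (F t / t powr \<theta>)) > 0" "\<theta> < 2" and F0: "F 0 = 0"
  obtains c \<kappa> \<delta> where "c > 0" "0 < \<kappa>" "\<kappa> < 2" "\<delta> > 0" "\<And>t. 0 \<le> t \<Longrightarrow> t < \<delta> \<Longrightarrow> c * t powr \<kappa> \<le> F t"
proof -
  obtain c where c: "c > 0" "\<forall>\<^sub>F t in at_right 0. F t / t powr \<theta> > c"
    by (rule Liminf_pos_eventually_greater[OF assms(1)])
  then obtain \<delta> where \<delta>: "\<delta> > 0" "\<And>t. 0 < t \<Longrightarrow> t < \<delta> \<Longrightarrow> F t / t powr \<theta> > c"
    by (auto simp: eventually_at_right_field)
  have "c * t powr (max \<theta> 1) \<le> F t" if "0 \<le> t" "t < min \<delta> 1" for t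
  proof (cases "t = 0")
    case False
    then have t: "0 < t" "t < \<delta>" "t \<le> 1" using that by auto
    have "c * t powr (max \<theta> 1) \<le> c * t powr \<theta>" using t c(1) by (intro mult_left_mono powr_mono') auto
    also have "\<dots> \<le> F t" using \<delta>(2)[OF t(1,2)] t(1) by (simp add: less_divide_eq)
    finally show ?thesis .
  qed (simp add: F0)
  then show ?thesis using that[of c "max \<theta> 1" "min \<delta> 1"] c(1) \<delta>(1) assms(2) by auto
qed

context sublinear_problem
begin

lemma potential_scaled_ge:
  assumes \<phi>: "admissible \<phi> G" "\<And>x. 0 \<le> \<phi> x" "\<And>x. \<phi> x \<le> 1"
    and F: "\<And>s. 0 \<le> s \<Longrightarrow> s < \<delta> \<Longrightarrow> c * s powr \<kappa> \<le> Fprim f s" and t: "0 < t" "t < \<delta>"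
    and I: "integrable lebesgue (\<lambda>x. K (norm x) * \<phi> x powr \<kappa>)"
  shows "c * t powr \<kappa> * (\<integral>x. K (norm x) * \<phi> x powr \<kappa> \<partial>lebesgue) \<le> potential (\<lambda>x. t * \<phi> x)"
proof -
  note t\<phi> = admissible_scaleR[OF \<phi>(1), of t]
  have "AE x in lebesgue. (c * t powr \<kappa>) * (K (norm x) * \<phi> x powr \<kappa>) \<le> K (norm x) * Fprim f (t * \<phi> x)"
    using AE_neq_0
  proof eventually_elim
    case (elim x)
    have "t * \<phi> x \<le> t * 1" using t \<phi>(3) by (intro mult_left_mono) auto
    then have "t * \<phi> x < \<delta>" using t(2) by linarith
    then have "c * (t * \<phi> x) powr \<kappa> \<le> Fprim f (t * \<phi> x)" using t \<phi>(2)[of x] by (intro F) auto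
    then have "K (norm x) * (c * (t * \<phi> x) powr \<kappa>) \<le> K (norm x) * Fprim f (t * \<phi> x)"
      using K_pos[of "norm x"] elim by (intro mult_left_mono) auto
    then show ?case using t \<phi>(2)[of x] by (simp add: powr_mult mult_ac)
  qed
  then have "(\<integral>x. (c * t powr \<kappa>) * (K (norm x) * \<phi> x powr \<kappa>) \<partial>lebesgue) \<le> potential (\<lambda>x. t * \<phi> x)"
    unfolding potential_def using I K_Fprim_integrable[OF admissibleD(1)[OF t\<phi>] Hardy_inequality(1)[OF t\<phi>]]
    by (intro integral_mono_AE) auto
  then show ?thesis by simp
qed

proposition negative_energy_exists:
  assumes "Liminf (at_right 0) (\<lambda>t. ereal (Fprim f t / t powr \<theta>)) > 0" "\<theta> < 2"
  obtains h k where "admissible h k" "energy h k < 0"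
proof -
  obtain c \<kappa> \<delta> where c_pos: "c > 0" and \<kappa>: "0 < \<kappa>" "\<kappa> < 2" and \<delta>_pos: "\<delta> > 0"
    and F: "\<And>t. 0 \<le> t \<Longrightarrow> t < \<delta> \<Longrightarrow> c * t powr \<kappa> \<le> Fprim f t"
    by (rule Liminf_pos_imp_powr_lower_bound[OF assms Fprim_nonpos[OF order_refl]]) blast
  let ?\<phi> = "\<lambda>x::real^'n. annulus_bump (norm x)"
  obtain G where G: "admissible ?\<phi> G" by (rule admissible_annulus_bump)
  define I where "I = (\<integral>x. K (norm x) * ?\<phi> x powr \<kappa> \<partial>lebesgue)"
  have I: "integrable lebesgue (\<lambda>x. K (norm x) * ?\<phi> x powr \<kappa>)" "I > 0"
    using integral_annulus_bump_pos[where 'a="real^'n", OF K_cont K_pos \<kappa>(1)] by (simp_all add: I_def)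
  have "((\<lambda>t. t powr (2 - \<kappa>) * (norm_sq ?\<phi> G / 2)) \<longlongrightarrow> 0 powr (2 - \<kappa>) * (norm_sq ?\<phi> G / 2)) (at_right 0)"
    using \<kappa> by (intro tendsto_intros tendsto_powr') (auto simp: eventually_at_right_field gt_ex)
  then have "\<forall>\<^sub>F t in at_right 0. t powr (2 - \<kappa>) * (norm_sq ?\<phi> G / 2) < c * I"
    using c_pos I(2) by (intro order_tendstoD(2)) auto
  moreover have "\<forall>\<^sub>F t in at_right 0. 0 < t \<and> t < \<delta>" using \<delta>_pos by (auto simp: eventually_at_right_field)
  ultimately obtain t where t: "0 < t" "t < \<delta>" "t powr (2 - \<kappa>) * (norm_sq ?\<phi> G / 2) < c * I"
    using eventually_happens'[OF trivial_limit_at_right_real eventually_conj] by blast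
  have "t\<^sup>2 = t powr \<kappa> * t powr (2 - \<kappa>)" using t by (simp add: powr_add[symmetric])
  then have "norm_sq (\<lambda>x. t * ?\<phi> x) (\<lambda>x. t *\<^sub>R G x) / 2 = t powr \<kappa> * (t powr (2 - \<kappa>) * (norm_sq ?\<phi> G / 2))"
    by (simp add: norm_sq_scaleR[OF G])
  also have "\<dots> < t powr \<kappa> * (c * I)" using t by (intro mult_strict_left_mono) auto
  also have "\<dots> \<le> potential (\<lambda>x. t * ?\<phi> x)"
    using potential_scaled_ge[OF G annulus_bump_nonneg annulus_bump_le_1 F t(1,2) I(1)] by (simp add: I_def mult_ac)
  finally have "energy (\<lambda>x. t * ?\<phi> x) (\<lambda>x. t *\<^sub>R G x) < 0" by (simp add: energy_def)
  then show ?thesis using that admissible_scaleR[OF G] by blast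
qed

end

theorem mainTheorem3:
  fixes V K :: "real \<Rightarrow> real" and a0 a b0 b :: real
    and f :: "real \<Rightarrow> real"
  assumes N3: "CARD('n::finite) \<ge> 3"
    and V_cont: "continuous_on {0<..} V" and V_nonneg: "\<forall>r>0. V r \<ge> 0"
    and V0: "Liminf (at_right 0) (\<lambda>r. ereal (V r / r powr a0)) > 0"
    and Vinf: "Liminf at_top (\<lambda>r. ereal (V r / r powr a)) > 0"
    and K_cont: "continuous_on {0<..} K" and K_pos: "\<forall>r>0. K r > 0"
    and K0: "Limsup (at_right 0) (\<lambda>r. ereal (K r / r powr b0)) < \<infinity>"
    and Kinf: "Limsup at_top (\<lambda>r. ereal (K r / r powr b)) < \<infinity>"
    and hb0: "b0 > Min {a0, -(real CARD('n) - a0)/2, -(real CARD('n) + 2)/2}"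
    and hb: "b < max a (-2)"
    and f_cont: "continuous_on UNIV f" and f0: "f 0 = 0"
    and f7: "\<exists>q1 q2. q1 < 2 \<and> q2 < 2 \<and> q1 \<in> I1 (real CARD('n)) a0 b0
               \<and> q2 \<in> I2 (real CARD('n)) a b
               \<and> (SUP t\<in>{0<..}. ereal (\<bar>f t\<bar> / min (t powr (q1 - 1)) (t powr (q2 - 1)))) < \<infinity>"
    and f8: "\<exists>\<theta><2. Liminf (at_right 0) (\<lambda>t. ereal (Fprim f t / t powr \<theta>)) > 0"
  shows "\<exists>u :: real^'n \<Rightarrow> real. radial_solution V K f u
           \<and> (AE x in lebesgue. u x \<ge> 0) \<and> \<not> (AE x in lebesgue. u x = 0)"
proof -
  obtain q1 q2 where q: "q1 < 2" "q2 < 2" "q1 \<in> I1 (real CARD('n)) a0 b0" "q2 \<in> I2 (real CARD('n)) a b"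
    and SUP_finite: "(SUP t\<in>{0<..}. ereal (\<bar>f t\<bar> / min_power q1 q2 t)) < \<infinity>"
    using f7 by (auto simp: min_power_def)
  have N: "real CARD('n) \<ge> 3" using N3 by simp
  note q1 = I1_exponent_conditions[OF N hb0 q(3)] and q2 = I2_exponent_conditions[OF N q(4)]
  have V_nonneg': "\<And>r. r > 0 \<Longrightarrow> V r \<ge> 0" and K_pos': "\<And>r. r > 0 \<Longrightarrow> K r > 0" using V_nonneg K_pos by auto
  obtain M where M: "M > 0" "\<And>t. t \<ge> 0 \<Longrightarrow> \<bar>f t\<bar> \<le> M * min_power q1 q2 t"
    by (rule SUP_finite_imp_min_power_growth[OF SUP_finite f0]) blast
  interpret sublinear_problem V "TYPE('n)" K f "\<lambda>t. M * min_power q1 q2 t" "dual_remainder V K q1 q2"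
  proof
    show "integrable lebesgue (dual_remainder V K q1 q2 :: real^'n \<Rightarrow> real)"
      using q q1 q2 by (intro dual_remainder_integrable[OF V_cont V_nonneg' V0 Vinf K_cont K_pos' K0 Kinf]) auto
  qed (use N3 V_cont V_nonneg K_cont K_pos f_cont f0 M q q1 q2 min_power_mono min_power_growth_absorbed[of V K M _ q1 q2] in auto)
  obtain \<theta> where "\<theta> < 2" "Liminf (at_right 0) (\<lambda>t. ereal (Fprim f t / t powr \<theta>)) > 0" using f8 by blast
  then obtain h :: "real^'n \<Rightarrow> real" and k where "admissible h k" "energy h k < 0" using negative_energy_exists by metis
  then show ?thesis by (rule solution_if_negative_energy)
qed

end
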